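(* Let $\nu\ge1$, let $H$ be a self-adjoint operator on $\ell^2(\mathbb{Z}^\nu)$, let $\rho$ be a Hausdorff dimension function, and let $\psi\in\ell^2(\mathbb{Z}^\nu)$ with $\|\psi\|=1$. Suppose $P_{\rho c}\psi\neq0$, where $P_{\rho c}$ is the orthogonal projection onto $\mathscr{H}_{\rho c}$. Then for each $m>0$ there exists a constant $C=C(\psi,m)>0$ such that for every $T>1$ $$\big\langle\big\langle|X|^m\big\rangle\big\rangle_T> C\,\rho(1/T)^{-m/\nu}.$$
   Context: A Hausdorff dimension function is a strictly increasing differentiable $\rho:(0,\infty)\to(0,\infty)$ with $\lim_{t\to0^+}\rho(t)=0$. The Hausdorff measure is $\mu^\rho(S)=\lim_{\delta\to0}\inf\{\sum_i\rho(|S_i|)\}$, the infimum over countable covers of $S$ by sets $S_i$ of diameter $|S_i|\le\delta$. A Borel measure $\mu$ on $\mathbb{R}$ is $\rho$-continuous if $\mu(S)=0$ for every set $S$ with $\mu^\rho(S)=0$. With $\mu_\psi$ the spectral measure of $H$ for the vector $\psi$, $\mathscr{H}_{\rho c}=\{\psi:\mu_\psi\text{ is }\rho\text{-continuous}\}$ (a closed subspace). $\psi(t)=e^{-iHt}\psi$; $\langle A\rangle(t)=\langle\psi(t),A\psi(t)\rangle$; $\langle f\rangle_T=\frac1T\int_0^Tf(t)\,dt$; and $|X|^m=\sum_{n\in\mathbb{Z}^\nu}|n|^m\langle\delta_n,\cdot\rangle\delta_n$. Thus $\langle\langle|X|^m\rangle\rangle_T=\frac1T\int_0^T\sum_{n\in\mathbb{Z}^\nu}|n|^m|\langle\delta_n,\psi(t)\rangle|^2dt\in[0,\infty]$.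 *)

theory Defs
  imports "HOL-Analysis.Analysis"
begin

section \<open>The Hilbert space of square-summable functions\<close>

definition ell2 :: "('a \<Rightarrow> complex) set" where
  "ell2 = {f. (\<lambda>x. (cmod (f x))\<^sup>2) summable_on UNIV}"

definition ell2_inner :: "('a \<Rightarrow> complex) \<Rightarrow> ('a \<Rightarrow> complex) \<Rightarrow> complex" where
  "ell2_inner f g = (\<Sum>\<^sub>\<infinity>x. cnj (f x) * g x)"

definition ell2_norm :: "('a \<Rightarrow> complex) \<Rightarrow> real" where
  "ell2_norm f = sqrt (\<Sum>\<^sub>\<infinity>x. (cmod (f x))\<^sup>2)"

definition delta :: "'a \<Rightarrow> 'a \<Rightarrow> complex" where
  "delta n = (\<lambda>k. if k = n then 1 else 0)"

definition ell2_subspace :: "('a \<Rightarrow> complex) set \<Rightarrow> bool" where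
  "ell2_subspace M \<longleftrightarrow> M \<subseteq> ell2 \<and> (\<lambda>_. 0) \<in> M \<and>
     (\<forall>f\<in>M. \<forall>g\<in>M. \<forall>c. (\<lambda>x. f x + c * g x) \<in> M)"

definition ell2_dense :: "('a \<Rightarrow> complex) set \<Rightarrow> bool" where
  "ell2_dense M \<longleftrightarrow> (\<forall>f\<in>ell2. \<forall>\<epsilon>>0. \<exists>g\<in>M. ell2_norm (\<lambda>x. f x - g x) < \<epsilon>)"

definition linear_operator_on ::
  "('a \<Rightarrow> complex) set \<Rightarrow> (('a \<Rightarrow> complex) \<Rightarrow> 'a \<Rightarrow> complex) \<Rightarrow> bool" where
  "linear_operator_on D A \<longleftrightarrow> ell2_subspace D \<and> (\<forall>f\<in>D. A f \<in> ell2) \<and>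
     (\<forall>f\<in>D. \<forall>g\<in>D. \<forall>c. A (\<lambda>x. f x + c * g x) = (\<lambda>x. A f x + c * A g x))"

definition orth_proj :: "('a \<Rightarrow> complex) set \<Rightarrow> ('a \<Rightarrow> complex) \<Rightarrow> 'a \<Rightarrow> complex" where
  "orth_proj M f = (THE p. p \<in> M \<and> (\<forall>g\<in>M. ell2_inner g (\<lambda>x. f x - p x) = 0))"


section \<open>Self-adjoint operators and their spectral measures\<close>

text \<open>A possibly unbounded operator is given by its domain \<open>D\<close> and a function \<open>A\<close> that
  matters only on \<open>D\<close>; bounded operators are the case \<open>D = ell2\<close>.\<close>

definition adjoint_graph ::
  "('a \<Rightarrow> complex) set \<Rightarrow> (('a \<Rightarrow> complex) \<Rightarrow> 'a \<Rightarrow> complex) \<Rightarrow>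
   (('a \<Rightarrow> complex) \<times> ('a \<Rightarrow> complex)) set" where
  "adjoint_graph D A =
     {(f, h). f \<in> ell2 \<and> h \<in> ell2 \<and> (\<forall>g\<in>D. ell2_inner f (A g) = ell2_inner h g)}"

definition self_adjoint ::
  "('a \<Rightarrow> complex) set \<Rightarrow> (('a \<Rightarrow> complex) \<Rightarrow> 'a \<Rightarrow> complex) \<Rightarrow> bool" where
  "self_adjoint D A \<longleftrightarrow>
     linear_operator_on D A \<and> ell2_dense D \<and> adjoint_graph D A = (\<lambda>f. (f, A f)) ` D"

definition is_orth_projection :: "(('a \<Rightarrow> complex) \<Rightarrow> 'a \<Rightarrow> complex) \<Rightarrow> bool" where
  "is_orth_projection P \<longleftrightarrow> linear_operator_on ell2 P \<and> (\<forall>f\<in>ell2. P (P f) = P f) \<and>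
     (\<forall>f\<in>ell2. \<forall>g\<in>ell2. ell2_inner (P f) g = ell2_inner f (P g))"

definition projection_valued_measure ::
  "(real set \<Rightarrow> ('a \<Rightarrow> complex) \<Rightarrow> 'a \<Rightarrow> complex) \<Rightarrow> bool" where
  "projection_valued_measure E \<longleftrightarrow>
     (\<forall>S\<in>sets borel. is_orth_projection (E S)) \<and>
     (\<forall>f\<in>ell2. E {} f = (\<lambda>_. 0) \<and> E UNIV f = f) \<and>
     (\<forall>S\<in>sets borel. \<forall>S'\<in>sets borel. \<forall>f\<in>ell2. E (S \<inter> S') f = E S (E S' f)) \<and>
     (\<forall>B :: nat \<Rightarrow> real set. range B \<subseteq> sets borel \<longrightarrow> disjoint_family B \<longrightarrow>
        (\<forall>f\<in>ell2. (\<lambda>N. ell2_norm (\<lambda>x. E (\<Union>i. B i) f x - (\<Sum>i<N. E (B i) f x)))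
           \<longlonglongrightarrow> 0))"

text \<open>The Borel measure \<open>S \<mapsto> \<langle>f, E(S) f\<rangle>\<close>.\<close>

definition scalar_measure ::
  "(real set \<Rightarrow> ('a \<Rightarrow> complex) \<Rightarrow> 'a \<Rightarrow> complex) \<Rightarrow> ('a \<Rightarrow> complex) \<Rightarrow> real measure" where
  "scalar_measure E f =
     measure_of UNIV (sets borel) (\<lambda>S. ennreal (Re (ell2_inner f (E S f))))"

text \<open>\<open>A = \<integral> \<lambda> dE(\<lambda>)\<close>: the domain of \<open>A\<close> consists of all \<open>f\<close> with
  \<open>\<integral> \<lambda>\<^sup>2 d\<langle>f, E f\<rangle> < \<infinity>\<close>, and there \<open>A\<close> is determined by its quadratic form.\<close>

definition is_spectral_resolution ::
  "('a \<Rightarrow> complex) set \<Rightarrow> (('a \<Rightarrow> complex) \<Rightarrow> 'a \<Rightarrow> complex) \<Rightarrow>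
   (real set \<Rightarrow> ('a \<Rightarrow> complex) \<Rightarrow> 'a \<Rightarrow> complex) \<Rightarrow> bool" where
  "is_spectral_resolution D A E \<longleftrightarrow> projection_valued_measure E \<and>
     D = {f \<in> ell2. (\<integral>\<^sup>+ x. ennreal (x\<^sup>2) \<partial>scalar_measure E f) < \<infinity>} \<and>
     (\<forall>f\<in>D. ell2_inner f (A f) = complex_of_real (\<integral>x. x \<partial>scalar_measure E f))"

text \<open>By the spectral theorem, a self-adjoint operator has a spectral resolution, unique on
  Borel sets and vectors of \<open>ell2\<close>; the choice operator only fixes irrelevant values
  elsewhere.\<close>

definition spectral_resolution ::
  "('a \<Rightarrow> complex) set \<Rightarrow> (('a \<Rightarrow> complex) \<Rightarrow> 'a \<Rightarrow> complex) \<Rightarrow>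
   real set \<Rightarrow> ('a \<Rightarrow> complex) \<Rightarrow> 'a \<Rightarrow> complex" where
  "spectral_resolution D A = (SOME E. is_spectral_resolution D A E)"

definition spectral_measure ::
  "('a \<Rightarrow> complex) set \<Rightarrow> (('a \<Rightarrow> complex) \<Rightarrow> 'a \<Rightarrow> complex) \<Rightarrow> ('a \<Rightarrow> complex) \<Rightarrow>
   real measure" where
  "spectral_measure D A f = scalar_measure (spectral_resolution D A) f"

text \<open>The integral \<open>\<integral> \<phi> d\<langle>g, E f\<rangle>\<close> of a bounded Borel function against the complex
  spectral measure of the pair \<open>g, f\<close>, obtained by polarization (the inner product is
  conjugate-linear in its first argument).\<close>

definition spectral_integral ::
  "('a \<Rightarrow> complex) set \<Rightarrow> (('a \<Rightarrow> complex) \<Rightarrow> 'a \<Rightarrow> complex) \<Rightarrow> (real \<Rightarrow> complex) \<Rightarrow>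
   ('a \<Rightarrow> complex) \<Rightarrow> ('a \<Rightarrow> complex) \<Rightarrow> complex" where
  "spectral_integral D A \<phi> g f =
     (1 / 4) * (\<Sum>k<4::nat. \<i> ^ k *
        (\<integral>x. \<phi> x \<partial>spectral_measure D A (\<lambda>n. f n + \<i> ^ k * g n)))"

text \<open>The vector \<open>\<phi>(A) f\<close> for bounded Borel \<open>\<phi>\<close>, through its coordinates
  \<open>\<langle>\<delta>\<^sub>n, \<phi>(A) f\<rangle>\<close>.\<close>

definition functional_calculus ::
  "('a \<Rightarrow> complex) set \<Rightarrow> (('a \<Rightarrow> complex) \<Rightarrow> 'a \<Rightarrow> complex) \<Rightarrow> (real \<Rightarrow> complex) \<Rightarrow>
   ('a \<Rightarrow> complex) \<Rightarrow> 'a \<Rightarrow> complex" where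
  "functional_calculus D A \<phi> f = (\<lambda>n. spectral_integral D A \<phi> (delta n) f)"

definition evolution ::
  "('a \<Rightarrow> complex) set \<Rightarrow> (('a \<Rightarrow> complex) \<Rightarrow> 'a \<Rightarrow> complex) \<Rightarrow> ('a \<Rightarrow> complex) \<Rightarrow>
   real \<Rightarrow> 'a \<Rightarrow> complex" where
  "evolution D A \<psi> t =
     functional_calculus D A (\<lambda>x. exp (- \<i> * complex_of_real x * complex_of_real t)) \<psi>"


section \<open>Hausdorff measures and continuity of measures\<close>

definition hausdorff_dimension_function :: "(real \<Rightarrow> real) \<Rightarrow> bool" where
  "hausdorff_dimension_function \<rho> \<longleftrightarrow>
     (\<forall>t>0. \<rho> t > 0) \<and> strict_mono_on {0<..} \<rho> \<and>
     (\<forall>t>0. \<rho> differentiable (at t)) \<and> (\<rho> \<longlongrightarrow> 0) (at_right 0)"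

text \<open>Since \<open>\<rho>\<close> is only given on positive reals, sets of diameter 0 get the limiting
  weight 0. Boundedness is required because \<^const>\<open>diameter\<close> is meaningless on
  unbounded sets. Empty sets \<open>U i\<close> account for finite covers.\<close>

definition hausdorff_measure :: "(real \<Rightarrow> real) \<Rightarrow> real set \<Rightarrow> ennreal" where
  "hausdorff_measure \<rho> S = Lim (at_right 0) (\<lambda>\<delta>::real.
     INF U \<in> {U :: nat \<Rightarrow> real set.
                S \<subseteq> (\<Union>i. U i) \<and> (\<forall>i. bounded (U i) \<and> diameter (U i) \<le> \<delta>)}.
       \<Sum>i. ennreal (if diameter (U i) = 0 then 0 else \<rho> (diameter (U i))))"

text \<open>The sets \<open>S\<close> need not be Borel, so \<open>\<mu>(S) = 0\<close> is meant in the completion of \<open>\<mu>\<close>.\<close>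

definition rho_continuous :: "(real \<Rightarrow> real) \<Rightarrow> real measure \<Rightarrow> bool" where
  "rho_continuous \<rho> \<mu> \<longleftrightarrow>
     (\<forall>S. hausdorff_measure \<rho> S = 0 \<longrightarrow> S \<in> null_sets (completion \<mu>))"

definition rho_continuous_subspace ::
  "(real \<Rightarrow> real) \<Rightarrow> ('a \<Rightarrow> complex) set \<Rightarrow> (('a \<Rightarrow> complex) \<Rightarrow> 'a \<Rightarrow> complex) \<Rightarrow>
   ('a \<Rightarrow> complex) set" where
  "rho_continuous_subspace \<rho> D A = {f \<in> ell2. rho_continuous \<rho> (spectral_measure D A f)}"


section \<open>Moments of the position operator\<close>

definition lattice_norm :: "int ^ 'n \<Rightarrow> real" where
  "lattice_norm n = norm (\<chi> i. real_of_int (n $ i))"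

definition position_moment :: "real \<Rightarrow> (int ^ 'n \<Rightarrow> complex) \<Rightarrow> ennreal" where
  "position_moment m f =
     (\<Sum>\<^sub>\<infinity>n. ennreal (lattice_norm n powr m * (cmod (ell2_inner (delta n) f))\<^sup>2))"

definition time_average :: "real \<Rightarrow> (real \<Rightarrow> ennreal) \<Rightarrow> ennreal" where
  "time_average T f = ennreal (1 / T) * (\<integral>\<^sup>+ t \<in> {0..T}. f t \<partial>lborel)"

end

theory Submission
  imports Defs "HOL-Probability.Probability"
begin

text \<open>Let \<open>p\<close> be the projection of \<open>\<psi>\<close> to the \<open>\<rho>\<close>-continuous subspace. By a Vitali covering
  argument the points where the spectral measure of \<open>p\<close> has infinite upper \<open>\<rho>\<close>-density form a
  set of Hausdorff measure zero, so some spectral projection of \<open>p\<close> is a nonzero vector \<open>f\<close> whose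
  spectral measure \<open>\<mu>\<close> satisfies \<open>\<mu>(I) \<le> K \<rho>(|I|)\<close> for all intervals of length at most 1, while
  \<open>\<langle>f, \<psi>\<rangle> = \<parallel>f\<parallel>\<^sup>2\<close>. Averaging with a Gaussian weight bounds the time average of \<open>|\<langle>g, f(t)\<rangle>|\<^sup>2\<close> up
  to time \<open>T\<close> by a multiple of \<open>\<rho>(1/T) \<parallel>g\<parallel>\<^sup>2\<close>. Hence a lattice ball with fewer than
  \<open>c / \<rho>(1/T)\<close> sites captures on average only a small part of \<open>f(t)\<close>, and since
  \<open>\<langle>f(t), \<psi>(t)\<rangle> = \<parallel>f\<parallel>\<^sup>2\<close> is conserved, a fixed fraction of \<open>\<psi>(t)\<close> lies outside that ball.

  The spectral resolution comes from the Cayley transform \<open>U\<close>: the Fejer densities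
  \<open>\<parallel>\<Sum>k<N. exp (-\<i>kx) U\<^sup>k f\<parallel>\<^sup>2 / (2\<pi>N)\<close> converge weakly, by Helly's theorem, to a measure with
  Fourier coefficients \<open>\<langle>f, U\<^sup>k f\<rangle>\<close>.\<close>

section \<open>The Hilbert space of square-summable functions as a type\<close>

text \<open>\<open>spectral_resolution\<close> is a choice, so nothing is known about it until some
  resolution exists; hence the need for the spectral theorem. Both its construction and the later
  use of the chosen resolution run through the locale \<open>spectral_family\<close>, which rebuilds
  the bounded functional calculus from scalar measures alone. The Gaussian is chosen because
  Gaussian averaging in time and Gaussian smearing in energy produce the same kernel in
  \<open>x - y\<close>. An average over times can thus be exchanged for an integral over energies,
  where Cauchy-Schwarz separates the two vectors and only the measure of \<open>f\<close> has to be
  spread out. Counting sites gives information only for large \<open>T\<close>. On the remaining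
  bounded range of \<open>T\<close> it is enough that the averaged moment stays away from 0. This
  could fail only for a state that sits at the origin up to time 1 and therefore forever, which the
  bound for large \<open>T\<close> excludes.\<close>

lemma ell2_zero: "(\<lambda>_. 0) \<in> ell2"
  by (simp add: ell2_def)

lemma ell2_add_cmult:
  assumes "f \<in> ell2" "g \<in> ell2"
  shows "(\<lambda>x. f x + c * g x) \<in> ell2"
proof -
  have "(\<lambda>x. 2 * (cmod (f x))\<^sup>2 + 2 * (cmod c)\<^sup>2 * (cmod (g x))\<^sup>2) summable_on UNIV"
    using assms by (intro summable_on_add summable_on_cmult_right) (auto simp: ell2_def)
  then show ?thesis
    unfolding ell2_def mem_Collect_eq
  proof (rule summable_on_comparison_test)
    fix x
    have "(cmod (f x + c * g x))\<^sup>2 \<le> (cmod (f x) + cmod c * cmod (g x))\<^sup>2"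
      by (rule power_mono) (metis norm_mult norm_triangle_ineq, simp)
    also have "\<dots> \<le> 2 * (cmod (f x))\<^sup>2 + 2 * (cmod c * cmod (g x))\<^sup>2"
      using sum_squares_bound[of "cmod (f x)" "cmod c * cmod (g x)"]
      by (simp add: power2_sum)
    finally show "(cmod (f x + c * g x))\<^sup>2 \<le> 2 * (cmod (f x))\<^sup>2 + 2 * (cmod c)\<^sup>2 * (cmod (g x))\<^sup>2"
      by (simp add: power_mult_distrib)
  qed simp
qed

lemma ell2_add: "f \<in> ell2 \<Longrightarrow> g \<in> ell2 \<Longrightarrow> (\<lambda>x. f x + g x) \<in> ell2"
  using ell2_add_cmult[of f g 1] by simp

lemma ell2_cmult: "g \<in> ell2 \<Longrightarrow> (\<lambda>x. c * g x) \<in> ell2"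
  using ell2_add_cmult[OF ell2_zero, of g c] by simp

lemma ell2_diff: "f \<in> ell2 \<Longrightarrow> g \<in> ell2 \<Longrightarrow> (\<lambda>x. f x - g x) \<in> ell2"
  using ell2_add_cmult[of f g "-1"] by simp

lemma ell2_inner_summable:
  assumes "f \<in> ell2" "g \<in> ell2"
  shows "(\<lambda>x. cnj (f x) * g x) summable_on UNIV"
proof (rule abs_summable_summable)
  have "(\<lambda>x. (cmod (f x))\<^sup>2 + (cmod (g x))\<^sup>2) summable_on UNIV"
    using assms by (intro summable_on_add) (auto simp: ell2_def)
  then show "(\<lambda>x. norm (cnj (f x) * g x)) summable_on UNIV"
  proof (rule summable_on_comparison_test)
    fix x
    show "norm (cnj (f x) * g x) \<le> (cmod (f x))\<^sup>2 + (cmod (g x))\<^sup>2"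
      using sum_squares_bound[of "cmod (f x)" "cmod (g x)"]
            mult_nonneg_nonneg[OF norm_ge_zero[of "f x"] norm_ge_zero[of "g x"]]
      unfolding norm_mult complex_mod_cnj by linarith
  qed simp
qed

lemma ell2_inner_add_cmult:
  assumes "f \<in> ell2" "g \<in> ell2" "h \<in> ell2"
  shows "ell2_inner h (\<lambda>x. f x + c * g x) = ell2_inner h f + c * ell2_inner h g"
proof -
  have "ell2_inner h (\<lambda>x. f x + c * g x)
      = (\<Sum>\<^sub>\<infinity>x. cnj (h x) * f x + c * (cnj (h x) * g x))"
    unfolding ell2_inner_def by (rule infsum_cong) (simp add: algebra_simps)
  also have "\<dots> = (\<Sum>\<^sub>\<infinity>x. cnj (h x) * f x) + (\<Sum>\<^sub>\<infinity>x. c * (cnj (h x) * g x))"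
    using assms by (intro infsum_add summable_on_cmult_right ell2_inner_summable)
  also have "(\<Sum>\<^sub>\<infinity>x. c * (cnj (h x) * g x)) = c * (\<Sum>\<^sub>\<infinity>x. cnj (h x) * g x)"
    by (rule infsum_cmult_right) (use assms ell2_inner_summable in blast)
  finally show ?thesis by (simp add: ell2_inner_def)
qed

lemma ell2_inner_commute: "ell2_inner g f = cnj (ell2_inner f g)"
  unfolding ell2_inner_def infsum_cnj[symmetric] by (simp add: mult.commute)

lemma ell2_inner_self:
  assumes "f \<in> ell2"
  shows "ell2_inner f f = complex_of_real (\<Sum>\<^sub>\<infinity>x. (cmod (f x))\<^sup>2)"
proof -
  have "(\<Sum>\<^sub>\<infinity>x. complex_of_real ((cmod (f x))\<^sup>2)) = complex_of_real (\<Sum>\<^sub>\<infinity>x. (cmod (f x))\<^sup>2)"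
    using has_sum_of_real[OF has_sum_infsum[OF assms[unfolded ell2_def mem_Collect_eq]]]
    by (rule infsumI)
  then show ?thesis
    unfolding ell2_inner_def complex_norm_square by (simp add: mult.commute)
qed

text \<open>A type, unlike the set \<open>ell2\<close>, can be an instance of
  \<open>real_inner\<close> and \<open>banach\<close>, which supplies limits and the real
  Cauchy-Schwarz inequality. The class is real, so its inner product is the real part of the complex
  one; the complex structure is added afterwards by \<open>scaleC\<close> and
  \<open>cinner\<close>.\<close>

typedef 'a l2 = "ell2 :: ('a \<Rightarrow> complex) set" morphisms coord vec
  using ell2_zero by blast

lemma coord_ell2 [simp]: "coord x \<in> ell2"
  by (rule coord)

instantiation l2 :: (type) real_inner
begin

definition "0 = vec (\<lambda>_. 0)"
definition "x + y = vec (\<lambda>n. coord x n + coord y n)"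
definition "x - y = vec (\<lambda>n. coord x n - coord y n)"
definition "- x = vec (\<lambda>n. - coord x n)"
definition "r *\<^sub>R x = vec (\<lambda>n. complex_of_real r * coord x n)"
definition "inner x y = Re (ell2_inner (coord x) (coord y))"
definition norm_l2_def: "norm (x :: 'a l2) = sqrt (inner x x)"
definition "dist (x :: 'a l2) y = norm (x - y)"
definition sgn_l2_def: "sgn (x :: 'a l2) = scaleR (inverse (norm x)) x"
definition "uniformity = (INF e\<in>{0 <..}. principal {(x :: 'a l2, y). dist x y < e})"
definition "open (U :: 'a l2 set)
  \<longleftrightarrow> (\<forall>x\<in>U. \<forall>\<^sub>F (x', y) in uniformity. x' = x \<longrightarrow> y \<in> U)"

lemma coord_zero: "coord 0 = (\<lambda>_. 0)"
  by (simp add: zero_l2_def vec_inverse ell2_zero)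
lemma coord_plus: "coord (x + y) = (\<lambda>n. coord x n + coord y n)"
  by (simp add: plus_l2_def vec_inverse ell2_add)
lemma coord_minus: "coord (x - y) = (\<lambda>n. coord x n - coord y n)"
  by (simp add: minus_l2_def vec_inverse ell2_diff)
lemma coord_uminus: "coord (- x) = (\<lambda>n. - coord x n)"
  using ell2_cmult[OF coord_ell2, of "-1" x] by (simp add: uminus_l2_def vec_inverse)
lemma coord_scaleR: "coord (r *\<^sub>R x) = (\<lambda>n. complex_of_real r * coord x n)"
  by (simp add: scaleR_l2_def vec_inverse ell2_cmult)

instance
proof
  fix x y z :: "'a l2" and a b r :: real
  note ext = coord_inject[THEN iffD1]
  show "x + y + z = x + (y + z)" "x + y = y + x" "0 + x = x" "- x + x = 0" "x - y = x + - y"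
    by (rule ext; simp add: coord_zero coord_plus coord_minus coord_uminus algebra_simps)+
  show "scaleR a (x + y) = scaleR a x + scaleR a y" "scaleR (a + b) x = scaleR a x + scaleR b x"
       "scaleR a (scaleR b x) = scaleR (a * b) x" "scaleR 1 x = x"
    by (rule ext; simp add: coord_plus coord_scaleR algebra_simps)+
  show "sgn x = scaleR (inverse (norm x)) x" "dist x y = norm (x - y)" "norm x = sqrt (inner x x)"
       "uniformity = (INF e\<in>{0 <..}. principal {(x :: 'a l2, y). dist x y < e})"
    by (fact sgn_l2_def dist_l2_def norm_l2_def uniformity_l2_def)+
  show "open U \<longleftrightarrow> (\<forall>x\<in>U. \<forall>\<^sub>F (x', y) in uniformity. x' = x \<longrightarrow> y \<in> U)"
    for U :: "'a l2 set" by (fact open_l2_def)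
  show "inner x y = inner y x"
    unfolding inner_l2_def by (subst ell2_inner_commute) simp
  have *: "inner z (x + scaleR r y) = inner z x + r * inner z y" for z x y :: "'a l2" and r
    unfolding inner_l2_def coord_plus coord_scaleR
    by (simp add: ell2_inner_add_cmult)
  have comm: "inner x y = inner y x" for x y :: "'a l2"
    unfolding inner_l2_def by (subst ell2_inner_commute) simp
  have "scaleR 1 y = y" for y :: "'a l2"
    by (rule ext) (simp add: coord_scaleR)
  then have "inner z (x + y) = inner z x + inner z y" for z x y :: "'a l2"
    using *[of z x 1 y] by simp
  then show "inner (x + y) z = inner x z + inner y z"
    by (simp add: comm[of _ z])
  have "inner z (0 + scaleR r y) = r * inner z y" for z y :: "'a l2"
    by (subst *) (simp add: inner_l2_def coord_zero ell2_inner_def)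
  moreover have "0 + scaleR r x = scaleR r x"
    by (rule ext) (simp add: coord_zero coord_plus)
  ultimately show "inner (scaleR r x) y = r * inner x y"
    by (metis comm)
  have sm: "(\<lambda>n. (cmod (coord x n))\<^sup>2) summable_on UNIV"
    using coord_ell2[of x] by (simp add: ell2_def)
  have self: "inner x x = (\<Sum>\<^sub>\<infinity>n. (cmod (coord x n))\<^sup>2)"
    by (simp add: inner_l2_def ell2_inner_self)
  show "0 \<le> inner x x"
    unfolding self by (rule infsum_nonneg) simp
  show "inner x x = 0 \<longleftrightarrow> x = 0"
  proof
    assume "inner x x = 0"
    then have "(cmod (coord x n))\<^sup>2 = 0" for n
      using nonneg_infsum_le_0D[of "\<lambda>n. (cmod (coord x n))\<^sup>2" UNIV n] sm self by simp
    then show "x = 0" by (intro ext) (auto simp: coord_zero)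
  qed (simp add: inner_l2_def coord_zero ell2_inner_def)
qed

end

definition scaleC :: "complex \<Rightarrow> 'a l2 \<Rightarrow> 'a l2"  (infixr \<open>*\<^sub>C\<close> 75)
  where "c *\<^sub>C x = vec (\<lambda>n. c * coord x n)"

definition cinner :: "'a l2 \<Rightarrow> 'a l2 \<Rightarrow> complex"
  where "cinner x y = ell2_inner (coord x) (coord y)"

definition basis_vec :: "'a \<Rightarrow> 'a l2"
  where "basis_vec n = vec (delta n)"

lemma coord_scaleC: "coord (c *\<^sub>C x) = (\<lambda>n. c * coord x n)"
  by (simp add: scaleC_def vec_inverse ell2_cmult)

lemmas coord_simps = coord_zero coord_plus coord_minus coord_uminus coord_scaleR coord_scaleC

lemma l2_eqI: "(\<And>n. coord x n = coord y n) \<Longrightarrow> x = y"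
  by (metis coord_inject ext)

lemma scaleC_of_real: "complex_of_real r *\<^sub>C x = r *\<^sub>R x"
  by (rule l2_eqI) (simp add: coord_simps)

lemma scaleC_simps [simp]:
  "0 *\<^sub>C x = 0" "1 *\<^sub>C x = x" "c *\<^sub>C 0 = 0" "a *\<^sub>C b *\<^sub>C x = (a * b) *\<^sub>C x"
  "(-1) *\<^sub>C x = - x"
  by (rule l2_eqI; simp add: coord_simps)+

lemma scaleC_distrib:
  "c *\<^sub>C (x + y) = c *\<^sub>C x + c *\<^sub>C y" "c *\<^sub>C (x - y) = c *\<^sub>C x - c *\<^sub>C y"
  "(a + b) *\<^sub>C x = a *\<^sub>C x + b *\<^sub>C x" "(a - b) *\<^sub>C x = a *\<^sub>C x - b *\<^sub>C x"
  "c *\<^sub>C (- x) = - (c *\<^sub>C x)" "(- c) *\<^sub>C x = - (c *\<^sub>C x)"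
  by (rule l2_eqI; simp add: coord_simps algebra_simps)+

lemma cinner_commute: "cinner y x = cnj (cinner x y)"
  unfolding cinner_def by (rule ell2_inner_commute)

lemma cinner_add_scaleC_right: "cinner z (x + c *\<^sub>C y) = cinner z x + c * cinner z y"
  by (simp add: cinner_def coord_simps ell2_inner_add_cmult)

lemma cinner_zero [simp]: "cinner x 0 = 0" "cinner 0 x = 0"
  by (simp_all add: cinner_def coord_zero ell2_inner_def)

lemma cinner_scaleC_right: "cinner z (c *\<^sub>C y) = c * cinner z y"
  using cinner_add_scaleC_right[of z 0 c y] by simp

lemma cinner_add_right: "cinner z (x + y) = cinner z x + cinner z y"
  using cinner_add_scaleC_right[of z x 1 y] by simp

lemma cinner_diff_right: "cinner z (x - y) = cinner z x - cinner z y"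
  using cinner_add_scaleC_right[of z x "-1" y] by simp

lemma cinner_minus_right: "cinner z (- x) = - cinner z x"
  using cinner_diff_right[of z 0 x] by simp

lemma cinner_scaleC_left: "cinner (c *\<^sub>C z) y = cnj c * cinner z y"
  by (metis cinner_commute cinner_scaleC_right complex_cnj_mult)

lemma cinner_add_left: "cinner (x + y) z = cinner x z + cinner y z"
  by (metis cinner_commute cinner_add_right complex_cnj_add)

lemma cinner_diff_left: "cinner (x - y) z = cinner x z - cinner y z"
  by (metis cinner_commute cinner_diff_right complex_cnj_diff)

lemma cinner_minus_left: "cinner (- x) z = - cinner x z"
  using cinner_diff_left[of 0 x z] by simp

lemmas cinner_simps = cinner_add_right cinner_add_left cinner_diff_right cinner_diff_left
  cinner_scaleC_right cinner_scaleC_left cinner_minus_right cinner_minus_left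

lemma cinner_self: "cinner x x = complex_of_real ((norm x)\<^sup>2)"
proof -
  have "cinner x x = complex_of_real (\<Sum>\<^sub>\<infinity>n. (cmod (coord x n))\<^sup>2)"
    by (simp add: cinner_def ell2_inner_self)
  moreover have "(norm x)\<^sup>2 = Re (cinner x x)"
    unfolding power2_norm_eq_inner by (simp add: inner_l2_def cinner_def)
  ultimately show ?thesis by simp
qed

lemma norm_eq_ell2_norm: "norm x = ell2_norm (coord x)"
  by (simp add: norm_l2_def inner_l2_def ell2_inner_self ell2_norm_def)

lemma inner_eq_Re_cinner: "inner x y = Re (cinner x y)"
  by (simp add: inner_l2_def cinner_def)

lemma norm_scaleC [simp]: "norm (c *\<^sub>C x) = cmod c * norm x"
proof -
  have "complex_of_real ((norm (c *\<^sub>C x))\<^sup>2) = complex_of_real ((cmod c * norm x)\<^sup>2)"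
    unfolding cinner_self[symmetric] power_mult_distrib of_real_mult complex_norm_square
    by (simp add: cinner_simps)
  then have "(norm (c *\<^sub>C x))\<^sup>2 = (cmod c * norm x)\<^sup>2"
    using of_real_eq_iff by blast
  then show ?thesis by (simp add: power2_eq_iff_nonneg)
qed

text \<open>Multiplying \<open>y\<close> by a phase makes the complex inner product real and
  non-negative, so the real Cauchy-Schwarz inequality applies.\<close>

lemma cmod_cinner_le: "cmod (cinner x y) \<le> norm x * norm y"
proof (cases "cinner x y = 0")
  case False
  define u where "u = cnj (cinner x y) / cmod (cinner x y)"
  have u: "cmod u = 1" using False by (simp add: u_def norm_divide)
  have "u * cinner x y = cmod (cinner x y)"
    using False unfolding u_def
    by (simp add: complex_norm_square[symmetric] power2_eq_square mult.commute)
  then have "cmod (cinner x y) = inner x (u *\<^sub>C y)"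
    unfolding inner_eq_Re_cinner cinner_scaleC_right by simp
  also have "\<dots> \<le> norm x * norm (u *\<^sub>C y)" by (rule norm_cauchy_schwarz)
  finally show ?thesis by (simp add: u)
qed simp

lemma delta_ell2: "delta n \<in> ell2"
proof -
  have "(\<lambda>x. (cmod (delta n x))\<^sup>2) summable_on UNIV \<longleftrightarrow> (\<lambda>x. (cmod (delta n x))\<^sup>2) summable_on {n}"
    by (rule summable_on_cong_neutral) (auto simp: delta_def)
  then show ?thesis by (simp add: ell2_def)
qed

lemma ell2_inner_delta: "ell2_inner (delta n) f = f n"
proof -
  have "(\<Sum>\<^sub>\<infinity>x. cnj (delta n x) * f x) = (\<Sum>\<^sub>\<infinity>x\<in>{n}. cnj (delta n x) * f x)"
    by (rule infsum_cong_neutral) (auto simp: delta_def)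
  then show ?thesis by (simp add: ell2_inner_def delta_def)
qed

lemma coord_basis_vec: "coord (basis_vec n) = delta n"
  by (simp add: basis_vec_def vec_inverse delta_ell2)

lemma cinner_basis_vec: "cinner (basis_vec n) x = coord x n"
  by (simp add: cinner_def coord_basis_vec ell2_inner_delta)

lemma norm_basis_vec [simp]: "norm (basis_vec n) = 1"
proof -
  have "complex_of_real ((norm (basis_vec n))\<^sup>2) = 1"
    unfolding cinner_self[symmetric] by (simp add: cinner_basis_vec coord_basis_vec delta_def)
  then have "(norm (basis_vec n))\<^sup>2 = 1" by (metis of_real_eq_1_iff)
  then show ?thesis using norm_ge_zero[of "basis_vec n"] unfolding power2_eq_1_iff by linarith
qed

lemma sum_coord_le_norm:
  "finite F \<Longrightarrow> (\<Sum>n\<in>F. (cmod (coord x n))\<^sup>2) \<le> (norm x)\<^sup>2"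
proof -
  assume "finite F"
  have "(norm x)\<^sup>2 = (\<Sum>\<^sub>\<infinity>n. (cmod (coord x n))\<^sup>2)"
    by (simp add: norm_eq_ell2_norm ell2_norm_def infsum_nonneg)
  then show ?thesis
    using finite_sum_le_infsum[of "\<lambda>n. (cmod (coord x n))\<^sup>2" UNIV F] coord_ell2[of x] \<open>finite F\<close>
    by (simp add: ell2_def)
qed

lemma vec_norm_le:
  assumes "\<And>F. finite F \<Longrightarrow> (\<Sum>n\<in>F. (cmod (f n))\<^sup>2) \<le> B\<^sup>2" "B \<ge> 0"
  shows "f \<in> ell2" "norm (vec f) \<le> B"
proof -
  have sm: "(\<lambda>n. (cmod (f n))\<^sup>2) summable_on UNIV"
    using assms by (intro nonneg_bdd_above_summable_on) (auto simp: bdd_above_def)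
  then show e: "f \<in> ell2" by (simp add: ell2_def)
  have "(\<Sum>\<^sub>\<infinity>n. (cmod (f n))\<^sup>2) \<le> B\<^sup>2"
    by (rule infsum_le_finite_sums[OF sm]) (use assms in auto)
  then show "norm (vec f) \<le> B"
    using assms(2) by (simp add: norm_eq_ell2_norm ell2_norm_def vec_inverse e real_le_lsqrt infsum_nonneg)
qed

lemma cmod_coord_le: "cmod (coord x n) \<le> norm x"
  using cmod_cinner_le[of "basis_vec n" x] by (simp add: cinner_basis_vec)

instance l2 :: (type) complete_space
proof
  fix X :: "nat \<Rightarrow> 'a l2"
  assume X: "Cauchy X"
  have "Cauchy (\<lambda>i. coord (X i) n)" for n
  proof (rule CauchyI)
    fix e :: real assume "e > 0"
    then obtain M where M: "\<And>i j. i \<ge> M \<Longrightarrow> j \<ge> M \<Longrightarrow> norm (X i - X j) < e"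
      using X CauchyD by blast
    have "norm (coord (X i) n - coord (X j) n) < e" if "i \<ge> M" "j \<ge> M" for i j
      using M[OF that] cmod_coord_le[of "X i - X j" n] by (simp add: coord_minus)
    then show "\<exists>M. \<forall>i\<ge>M. \<forall>j\<ge>M. norm (coord (X i) n - coord (X j) n) < e" by blast
  qed
  then obtain l where l: "\<And>n. (\<lambda>i. coord (X i) n) \<longlonglongrightarrow> l n"
    unfolding Cauchy_convergent_iff convergent_def by metis
  \<comment> \<open>Finite partial sums are used because \<open>l\<close> is not yet known to be
    square-summable; letting \<open>j\<close> tend to infinity in them gives membership and the norm
    bound at once.\<close>
  have ev: "\<exists>M. \<forall>i\<ge>M. (\<lambda>n. coord (X i) n - l n) \<in> ell2 \<and> norm (vec (\<lambda>n. coord (X i) n - l n)) \<le> e"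
    if "e > 0" for e :: real
  proof -
    from that obtain M where M: "\<And>i j. i \<ge> M \<Longrightarrow> j \<ge> M \<Longrightarrow> norm (X i - X j) < e"
      using X CauchyD by blast
    have "(\<Sum>n\<in>F. (cmod (coord (X i) n - l n))\<^sup>2) \<le> e\<^sup>2" if "i \<ge> M" "finite F" for i F
    proof (rule LIMSEQ_le_const2)
      show "(\<lambda>j. \<Sum>n\<in>F. (cmod (coord (X i) n - coord (X j) n))\<^sup>2)
              \<longlonglongrightarrow> (\<Sum>n\<in>F. (cmod (coord (X i) n - l n))\<^sup>2)"
        by (intro tendsto_intros l)
      have "(\<Sum>n\<in>F. (cmod (coord (X i) n - coord (X j) n))\<^sup>2) \<le> e\<^sup>2" if "j \<ge> M" for j
      proof -
        have "(\<Sum>n\<in>F. (cmod (coord (X i) n - coord (X j) n))\<^sup>2) \<le> (norm (X i - X j))\<^sup>2"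
          using sum_coord_le_norm[OF \<open>finite F\<close>, of "X i - X j"] by (simp add: coord_minus)
        also have "\<dots> \<le> e\<^sup>2" using M[OF \<open>i \<ge> M\<close> that] by (intro power_mono) auto
        finally show ?thesis .
      qed
      then show "\<exists>N. \<forall>j\<ge>N. (\<Sum>n\<in>F. (cmod (coord (X i) n - coord (X j) n))\<^sup>2) \<le> e\<^sup>2" by blast
    qed
    then show ?thesis using vec_norm_le that by (metis less_imp_le)
  qed
  from ev[of 1] obtain M where "(\<lambda>n. coord (X M) n - l n) \<in> ell2" by auto
  from ell2_diff[OF coord_ell2[of "X M"] this] have "l \<in> ell2" by simp
  have "X \<longlonglongrightarrow> vec l"
  proof (rule LIMSEQ_I)
    fix r :: real assume "r > 0"
    then obtain M where M: "\<forall>i\<ge>M. norm (vec (\<lambda>n. coord (X i) n - l n)) \<le> r / 2"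
      using ev[of "r/2"] by auto
    have "X i - vec l = vec (\<lambda>n. coord (X i) n - l n)" for i
      using \<open>l \<in> ell2\<close> by (simp add: minus_l2_def vec_inverse)
    then show "\<exists>no. \<forall>n\<ge>no. norm (X n - vec l) < r"
      using M \<open>r > 0\<close> by (intro exI[of _ M]) force
  qed
  then show "convergent X" by (auto simp: convergent_def)
qed

instance l2 :: (type) banach ..

lemma bounded_bilinear_cinner: "bounded_bilinear (cinner :: 'a l2 \<Rightarrow> _)"
proof
  show "\<exists>K. \<forall>a b :: 'a l2. norm (cinner a b) \<le> norm a * norm b * K"
    using cmod_cinner_le by (intro exI[of _ 1]) auto
qed (simp_all add: cinner_simps scaleR_conv_of_real flip: scaleC_of_real)

lemmas tendsto_cinner [tendsto_intros] = bounded_bilinear.tendsto[OF bounded_bilinear_cinner]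

lemma bounded_linear_scaleC: "bounded_linear ((*\<^sub>C) c :: 'a l2 \<Rightarrow> _)"
proof
  show "\<exists>K. \<forall>x :: 'a l2. norm (c *\<^sub>C x) \<le> norm x * K"
    by (intro exI[of _ "cmod c"]) (simp add: mult.commute)
qed (simp_all add: scaleC_distrib flip: scaleC_of_real, simp add: mult.commute)

lemmas tendsto_scaleC [tendsto_intros] = bounded_linear.tendsto[OF bounded_linear_scaleC]

lemma eq_if_cinner_eq: "(\<And>g. cinner g x = cinner g y) \<Longrightarrow> x = y"
proof -
  assume "\<And>g. cinner g x = cinner g y"
  then have "cinner (x - y) (x - y) = 0" by (simp add: cinner_diff_right)
  then show "x = y" by (simp add: cinner_self)
qed

section \<open>Orthogonal projections and the Riesz representation theorem\<close>

definition csubspace :: "'a l2 set \<Rightarrow> bool"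
  where "csubspace M \<longleftrightarrow> 0 \<in> M \<and> (\<forall>x\<in>M. \<forall>y\<in>M. \<forall>c. x + c *\<^sub>C y \<in> M)"

lemma csubspaceD:
  assumes "csubspace M"
  shows "0 \<in> M" "x \<in> M \<Longrightarrow> y \<in> M \<Longrightarrow> x + c *\<^sub>C y \<in> M"
    "x \<in> M \<Longrightarrow> y \<in> M \<Longrightarrow> x + y \<in> M" "x \<in> M \<Longrightarrow> y \<in> M \<Longrightarrow> x - y \<in> M" "x \<in> M \<Longrightarrow> c *\<^sub>C x \<in> M"
proof -
  show *: "x + c *\<^sub>C y \<in> M" if "x \<in> M" "y \<in> M" for x y c using assms that by (auto simp: csubspace_def)
  show "0 \<in> M" using assms by (simp add: csubspace_def)
  then show "x \<in> M \<Longrightarrow> c *\<^sub>C x \<in> M" using *[of 0 x c] by simp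
  show "x \<in> M \<Longrightarrow> y \<in> M \<Longrightarrow> x + y \<in> M" using *[of x y 1] by simp
  show "x \<in> M \<Longrightarrow> y \<in> M \<Longrightarrow> x - y \<in> M" using *[of x y "-1"] by simp
qed

text \<open>Distance minimisation: by the parallelogram law a minimising sequence is Cauchy, and at
  the minimum no multiple of a vector of \<open>M\<close> can be subtracted profitably, which is
  orthogonality.\<close>

lemma orthogonal_projection_exists:
  assumes M: "csubspace M" "closed M"
  obtains p where "p \<in> M" "\<And>g. g \<in> M \<Longrightarrow> cinner g (f - p) = 0"
proof -
  define d where "d = (INF x\<in>M. (norm (f - x))\<^sup>2)"
  have bdd: "bdd_below ((\<lambda>x. (norm (f - x))\<^sup>2) ` M)" by (auto simp: bdd_below_def intro: exI[of _ 0])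
  have ne: "M \<noteq> {}" using csubspaceD(1)[OF M(1)] by auto
  have d_le: "d \<le> (norm (f - x))\<^sup>2" if "x \<in> M" for x
    unfolding d_def by (rule cINF_lower[OF bdd that])
  have "\<exists>x\<in>M. (norm (f - x))\<^sup>2 < d + 1 / Suc n" for n
    using cINF_less_iff[OF ne bdd, of "d + 1 / Suc n"] by (simp add: d_def)
  then obtain X where X: "\<And>n. X n \<in> M" "\<And>n. (norm (f - X n))\<^sup>2 < d + 1 / Suc n" by metis
  have par: "(norm (X i - X j))\<^sup>2 \<le> 2 * (1 / Suc i + 1 / Suc j)" for i j
  proof -
    \<comment> \<open>The midpoint of two near-minimisers lies in \<open>M\<close>, so its squared
      distance is at least \<open>d\<close>; inserted into the parallelogram law this bounds their
      difference.\<close>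
    have mid: "(1/2) *\<^sub>R (X i + X j) \<in> M"
      using csubspaceD(5)[OF M(1) csubspaceD(3)[OF M(1) X(1)[of i] X(1)[of j]], of "of_real (1/2)"]
      by (simp only: scaleC_of_real)
    define u where "u = f - X i"
    define v where "v = f - X j"
    have "(norm (u + v))\<^sup>2 + (norm (u - v))\<^sup>2 = 2 * (norm u)\<^sup>2 + 2 * (norm v)\<^sup>2"
      by (simp add: power2_norm_eq_inner inner_simps inner_commute)
    moreover have "u + v = 2 *\<^sub>R (f - (1/2) *\<^sub>R (X i + X j))"
      by (simp add: u_def v_def algebra_simps scaleR_2)
    then have "(norm (u + v))\<^sup>2 = 4 * (norm (f - (1/2) *\<^sub>R (X i + X j)))\<^sup>2"
      by (simp add: power_mult_distrib)
    moreover have "u - v = X j - X i" by (simp add: u_def v_def)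
    ultimately show ?thesis
      using d_le[OF mid] X(2)[of i] X(2)[of j] unfolding u_def v_def
      by (simp add: norm_minus_commute)
  qed
  have "Cauchy X"
  proof (rule CauchyI)
    fix e :: real assume e: "e > 0"
    obtain N where N: "1 / real (Suc N) < e\<^sup>2 / 4"
      using e nat_approx_posE[of "e\<^sup>2/4"] by auto
    have "norm (X i - X j) < e" if "i \<ge> N" "j \<ge> N" for i j
    proof -
      have "1 / real (Suc i) \<le> 1 / Suc N" "1 / real (Suc j) \<le> 1 / Suc N"
        using that by (auto simp: frac_le)
      then have "(norm (X i - X j))\<^sup>2 < e\<^sup>2" using par[of i j] N by argo
      then show ?thesis using e by (simp add: power_less_imp_less_base)
    qed
    then show "\<exists>M. \<forall>m\<ge>M. \<forall>n\<ge>M. norm (X m - X n) < e" by blast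
  qed
  then obtain p where p: "X \<longlonglongrightarrow> p" using Cauchy_convergent by (auto simp: convergent_def)
  have pM: "p \<in> M" using M(2) X(1) p by (metis closed_sequentially)
  have "(norm (f - p))\<^sup>2 \<le> d"
  proof (rule LIMSEQ_le)
    show "(\<lambda>n. (norm (f - X n))\<^sup>2) \<longlonglongrightarrow> (norm (f - p))\<^sup>2" by (intro tendsto_intros p)
    have "(\<lambda>n. 1 / real (Suc n)) \<longlonglongrightarrow> 0" using LIMSEQ_Suc lim_1_over_n by blast
    then show "(\<lambda>n. d + 1 / real (Suc n)) \<longlonglongrightarrow> d"
      using tendsto_add[OF tendsto_const[of d]] by fastforce
    show "\<exists>N. \<forall>n\<ge>N. (norm (f - X n))\<^sup>2 \<le> d + 1 / real (Suc n)" using X(2) less_imp_le by blast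
  qed
  then have pmin: "(norm (f - p))\<^sup>2 \<le> (norm (f - x))\<^sup>2" if "x \<in> M" for x
    using d_le[OF that] by linarith
  have "cinner g (f - p) = 0" if g: "g \<in> M" for g
  proof (rule ccontr)
    define c where "c = cinner g (f - p)"
    assume "cinner g (f - p) \<noteq> 0"
    then have c: "c \<noteq> 0" "g \<noteq> 0" by (auto simp: c_def)
    \<comment> \<open>\<open>t\<close> minimises the distance along the line \<open>p + t g\<close>
      and lowers its square by \<open>|c|^2 / (norm g)^2\<close>.\<close>
    define t where "t = c / complex_of_real ((norm g)\<^sup>2)"
    have "p + t *\<^sub>C g \<in> M" using csubspaceD(2)[OF M(1) pM g] .
    from pmin[OF this] have le: "(norm (f - p))\<^sup>2 \<le> (norm (f - p - t *\<^sub>C g))\<^sup>2" by (simp add: diff_diff_eq)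
    have "complex_of_real ((norm (f - p - t *\<^sub>C g))\<^sup>2)
        = complex_of_real ((norm (f - p))\<^sup>2) - cnj t * c - t * cnj c + t * cnj t * complex_of_real ((norm g)\<^sup>2)"
      unfolding cinner_self[symmetric] c_def cinner_commute[of "f - p" g, symmetric]
      by (simp add: cinner_simps algebra_simps)
    also have "\<dots> = complex_of_real ((norm (f - p))\<^sup>2 - (cmod c)\<^sup>2 / (norm g)\<^sup>2)"
      using c(2) unfolding t_def of_real_diff of_real_divide complex_norm_square
      by (simp add: field_simps power2_eq_square)
    finally have "(norm (f - p - t *\<^sub>C g))\<^sup>2 = (norm (f - p))\<^sup>2 - (cmod c)\<^sup>2 / (norm g)\<^sup>2"
      using of_real_eq_iff by blast
    moreover have "(cmod c)\<^sup>2 / (norm g)\<^sup>2 > 0" using c by simp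
    ultimately show False using le by linarith
  qed
  with pM that show thesis by blast
qed

text \<open>\<open>cinner\<close> is conjugate-linear in its first argument, hence so is
  \<open>L\<close>. The representing vector is a multiple of a normal to the closed kernel of
  \<open>L\<close>, which has codimension at most one.\<close>

lemma riesz_representation:
  fixes L :: "'a l2 \<Rightarrow> complex"
  assumes lin: "\<And>x y c. L (x + c *\<^sub>C y) = L x + cnj c * L y"
    and bdd: "\<And>x. cmod (L x) \<le> B * norm x"
  obtains v where "\<And>g. L g = cinner g v"
proof -
  define M where "M = {x. L x = 0}"
  have L0: "L 0 = 0" using bdd[of 0] by simp
  have sub: "csubspace M" by (auto simp: csubspace_def M_def lin L0)
  have Ldiff: "L (x - y) = L x - L y" for x y using lin[of x "-1" y] by simp
  have "closed M"
  proof (unfold closed_sequential_limits, intro allI impI, elim conjE)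
    fix X l assume X: "\<forall>n. X n \<in> M" "X \<longlonglongrightarrow> l"
    have "(\<lambda>n. B * norm (X n - l)) \<longlonglongrightarrow> B * norm (l - l)" by (intro tendsto_intros X)
    then have "(\<lambda>n. B * norm (X n - l)) \<longlonglongrightarrow> 0" by simp
    moreover have "cmod (L l) \<le> B * norm (X n - l)" for n
      using bdd[of "X n - l"] X(1) by (simp add: Ldiff M_def)
    ultimately have "cmod (L l) \<le> 0"
      by (intro LIMSEQ_le_const) auto
    then show "l \<in> M" by (simp add: M_def)
  qed
  show thesis
  proof (cases "M = UNIV")
    case True
    then show thesis using that[of 0] by (auto simp: M_def)
  next
    case False
    then obtain f where f: "f \<notin> M" by auto
    from orthogonal_projection_exists[OF sub \<open>closed M\<close>, of f]
    obtain p where p: "p \<in> M" "\<And>g. g \<in> M \<Longrightarrow> cinner g (f - p) = 0" by blast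
    define z where "z = f - p"
    have Lz: "L z \<noteq> 0" using f p(1) by (simp add: z_def Ldiff M_def)
    then have z0: "z \<noteq> 0" using L0 by auto
    have "L g = cinner g ((L z / complex_of_real ((norm z)\<^sup>2)) *\<^sub>C z)" for g
    proof -
      \<comment> \<open>Chosen so that \<open>g - c z\<close> lies in the kernel of
        \<open>L\<close>.\<close>
      define c where "c = cnj (L g / L z)"
      have "g + (- c) *\<^sub>C z \<in> M" unfolding M_def mem_Collect_eq lin using Lz by (simp add: c_def)
      then have "cinner (g + (- c) *\<^sub>C z) z = 0" using p(2) by (simp add: z_def)
      then have "cinner g z = cnj c * complex_of_real ((norm z)\<^sup>2)" by (simp add: cinner_simps cinner_self)
      then show ?thesis using Lz z0 by (simp add: cinner_simps c_def)
    qed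
    then show thesis using that by blast
  qed
qed

definition clinear :: "('a l2 \<Rightarrow> 'a l2) \<Rightarrow> bool"
  where "clinear T \<longleftrightarrow> (\<forall>x y c. T (x + c *\<^sub>C y) = T x + c *\<^sub>C T y)"

lemma clinearD:
  assumes "clinear T"
  shows "T (x + c *\<^sub>C y) = T x + c *\<^sub>C T y" "T 0 = 0" "T (x + y) = T x + T y" "T (x - y) = T x - T y"
    "T (c *\<^sub>C y) = c *\<^sub>C T y"
proof -
  show *: "T (x + c *\<^sub>C y) = T x + c *\<^sub>C T y" for x y c using assms by (simp add: clinear_def)
  have "T (0 + (-1) *\<^sub>C 0) = T 0 + (-1) *\<^sub>C T 0" by (rule *)
  then show "T 0 = 0" by simp
  then show "T (c *\<^sub>C y) = c *\<^sub>C T y" using *[of 0 c y] by simp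
  show "T (x + y) = T x + T y" using *[of x 1 y] by simp
  show "T (x - y) = T x - T y" using *[of x "-1" y] by simp
qed

section \<open>Functional calculus of a spectral family\<close>

definition bounded_borel :: "(real \<Rightarrow> complex) \<Rightarrow> bool"
  where "bounded_borel \<phi> \<longleftrightarrow> \<phi> \<in> borel_measurable borel \<and> (\<exists>B. \<forall>x. cmod (\<phi> x) \<le> B)"

lemma bounded_borelI: "\<phi> \<in> borel_measurable borel \<Longrightarrow> (\<And>x. cmod (\<phi> x) \<le> B) \<Longrightarrow> bounded_borel \<phi>"
  by (auto simp: bounded_borel_def)

lemma bounded_borel_measurable [measurable_dest]: "bounded_borel \<phi> \<Longrightarrow> \<phi> \<in> borel_measurable borel"
  by (simp add: bounded_borel_def)

lemma bounded_borel_bound: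
  assumes "bounded_borel \<phi>" obtains B where "B \<ge> 0" "\<And>x. cmod (\<phi> x) \<le> B"
proof -
  obtain B where B: "\<And>x. cmod (\<phi> x) \<le> B" using assms by (auto simp: bounded_borel_def)
  have "B \<ge> 0" using order_trans[OF norm_ge_zero B[of 0]] .
  with B that show thesis by blast
qed

lemma bounded_borel_const: "bounded_borel (\<lambda>_. c)"
  by (rule bounded_borelI[where B = "cmod c"]) auto

lemma bounded_borel_mult: assumes "bounded_borel \<phi>" "bounded_borel \<eta>" shows "bounded_borel (\<lambda>x. \<phi> x * \<eta> x)"
proof -
  obtain B C where "B \<ge> 0" "\<And>x. cmod (\<phi> x) \<le> B" "C \<ge> 0" "\<And>x. cmod (\<eta> x) \<le> C"
    using assms bounded_borel_bound by metis
  then have "\<And>x. cmod (\<phi> x * \<eta> x) \<le> B * C" by (simp add: norm_mult mult_mono)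
  then show ?thesis using assms by (intro bounded_borelI) auto
qed

lemma bounded_borel_add: assumes "bounded_borel \<phi>" "bounded_borel \<eta>" shows "bounded_borel (\<lambda>x. \<phi> x + \<eta> x)"
proof -
  obtain B C where "\<And>x. cmod (\<phi> x) \<le> B" "\<And>x. cmod (\<eta> x) \<le> C"
    using assms bounded_borel_bound by metis
  then have "\<And>x. cmod (\<phi> x + \<eta> x) \<le> B + C" by (metis add_mono norm_triangle_le)
  then show ?thesis using assms by (intro bounded_borelI) auto
qed

lemma bounded_borel_add_cmult: "bounded_borel \<phi> \<Longrightarrow> bounded_borel \<eta> \<Longrightarrow> bounded_borel (\<lambda>x. \<phi> x + c * \<eta> x)"
  by (intro bounded_borel_add bounded_borel_mult bounded_borel_const)

lemma bounded_borel_cnj: assumes "bounded_borel \<phi>" shows "bounded_borel (\<lambda>x. cnj (\<phi> x))"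
  using assms borel_measurable_continuous_on[of cnj \<phi> borel]
  by (auto simp: bounded_borel_def intro!: continuous_intros)

lemma bounded_borel_indicator: "S \<in> sets borel \<Longrightarrow> bounded_borel (indicator S)"
  by (rule bounded_borelI[where B = 1]) (auto simp: indicator_def)

lemma bounded_borel_of_real: assumes "f \<in> borel_measurable borel" "\<And>x. \<bar>f x\<bar> \<le> B" shows "bounded_borel (\<lambda>x. complex_of_real (f x))"
  using assms by (intro bounded_borelI[where B = B]) auto

text \<open>Below, \<open>bp\<close> stands for bounded pointwise convergence of sequences.\<close>

definition bp_functional :: "((real \<Rightarrow> complex) \<Rightarrow> complex) \<Rightarrow> bool" where
  "bp_functional L \<longleftrightarrow>
    (\<forall>\<phi> \<eta> c. bounded_borel \<phi> \<longrightarrow> bounded_borel \<eta> \<longrightarrow> L (\<lambda>x. \<phi> x + c * \<eta> x) = L \<phi> + c * L \<eta>) \<and>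
    (\<forall>F \<phi> B. (\<forall>n::nat. F n \<in> borel_measurable borel) \<longrightarrow> (\<forall>n x. cmod (F n x) \<le> B) \<longrightarrow>
       (\<forall>x. (\<lambda>n. F n x) \<longlonglongrightarrow> \<phi> x) \<longrightarrow> (\<lambda>n. L (F n)) \<longlonglongrightarrow> L \<phi>)"

definition bp_closed :: "((real \<Rightarrow> complex) \<Rightarrow> bool) \<Rightarrow> bool" where
  "bp_closed P \<longleftrightarrow>
    (\<forall>\<phi> \<eta> c. bounded_borel \<phi> \<longrightarrow> bounded_borel \<eta> \<longrightarrow> P \<phi> \<longrightarrow> P \<eta> \<longrightarrow> P (\<lambda>x. \<phi> x + c * \<eta> x)) \<and>
    (\<forall>F \<phi> B. (\<forall>n::nat. F n \<in> borel_measurable borel \<and> P (F n)) \<longrightarrow> (\<forall>n x. cmod (F n x) \<le> B) \<longrightarrow>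
       (\<forall>x. (\<lambda>n. F n x) \<longlonglongrightarrow> \<phi> x) \<longrightarrow> P \<phi>)"

text \<open>The conclusion of a functional monotone class theorem, turned into a property of the
  class \<open>G\<close>. It replaces uniqueness arguments for complex measures, so that complex
  measures need not be introduced as objects.\<close>

definition bp_generating :: "(real \<Rightarrow> complex) set \<Rightarrow> bool" where
  "bp_generating G \<longleftrightarrow> (\<forall>P. bp_closed P \<longrightarrow> (\<forall>\<phi>\<in>G. P \<phi>) \<longrightarrow> (\<forall>\<phi>. bounded_borel \<phi> \<longrightarrow> P \<phi>))"

text \<open>Agreement of two such functionals is itself a \<open>bp_closed\<close> property. The
  identities of the functional calculus below are reduced to \<open>G\<close> in this way.\<close>

lemma bp_functional_eqI:
  assumes G: "bp_generating G" and L: "bp_functional L" "bp_functional L'"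
    and eq: "\<And>\<gamma>. \<gamma> \<in> G \<Longrightarrow> L \<gamma> = L' \<gamma>" and \<phi>: "bounded_borel \<phi>"
  shows "L \<phi> = L' \<phi>"
proof -
  have "bp_closed (\<lambda>\<phi>. L \<phi> = L' \<phi>)"
    unfolding bp_closed_def
  proof (intro conjI allI impI)
    fix F :: "nat \<Rightarrow> real \<Rightarrow> complex" and \<phi> B
    assume F: "\<forall>n. F n \<in> borel_measurable borel \<and> L (F n) = L' (F n)" "\<forall>n x. cmod (F n x) \<le> B"
      "\<forall>x. (\<lambda>n. F n x) \<longlonglongrightarrow> \<phi> x"
    have "(\<lambda>n. L (F n)) \<longlonglongrightarrow> L \<phi>" "(\<lambda>n. L' (F n)) \<longlonglongrightarrow> L' \<phi>"
      using L F unfolding bp_functional_def by blast+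
    then show "L \<phi> = L' \<phi>" using F(1) LIMSEQ_unique by simp
  qed (use L in \<open>simp add: bp_functional_def\<close>)
  then show ?thesis using G eq \<phi> unfolding bp_generating_def by blast
qed

lemma bp_functional_0: "bp_functional (\<lambda>_. 0)"
  by (simp add: bp_functional_def)

lemma bp_functional_add:
  "bp_functional L \<Longrightarrow> bp_functional L' \<Longrightarrow> bp_functional (\<lambda>\<phi>. L \<phi> + L' \<phi>)"
  unfolding bp_functional_def by (auto simp: algebra_simps intro!: tendsto_add) blast+

lemma bp_functional_cmult:
  assumes "bp_functional L" shows "bp_functional (\<lambda>\<phi>. c * L \<phi>)"
  unfolding bp_functional_def
proof (intro conjI allI impI)
  fix F :: "nat \<Rightarrow> real \<Rightarrow> complex" and \<phi> B
  assume F: "\<forall>n. F n \<in> borel_measurable borel" "\<forall>n x. cmod (F n x) \<le> B"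
      "\<forall>x. (\<lambda>n. F n x) \<longlonglongrightarrow> \<phi> x"
  then have "(\<lambda>n. L (F n)) \<longlonglongrightarrow> L \<phi>" using assms unfolding bp_functional_def by blast
  then show "(\<lambda>n. c * L (F n)) \<longlonglongrightarrow> c * L \<phi>" by (intro tendsto_intros)
qed (use assms in \<open>simp add: bp_functional_def algebra_simps\<close>)

lemma bp_functional_sum:
  "(\<And>i. i \<in> A \<Longrightarrow> bp_functional (L i)) \<Longrightarrow> bp_functional (\<lambda>\<phi>. \<Sum>i\<in>A. L i \<phi>)"
  by (induction A rule: infinite_finite_induct) (simp_all add: bp_functional_0 bp_functional_add)

text \<open>Freezing one factor of a product allows multiplicativity to be proved one factor at a
  time.\<close>

lemma bp_functional_times:
  assumes L: "bp_functional L" and \<eta>: "bounded_borel \<eta>" shows "bp_functional (\<lambda>\<phi>. L (\<lambda>x. \<phi> x * \<eta> x))"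
  unfolding bp_functional_def
proof (intro conjI allI impI)
  fix \<phi> \<phi>' c assume *: "bounded_borel \<phi>" "bounded_borel \<phi>'"
  have "L (\<lambda>x. \<phi> x * \<eta> x + c * (\<phi>' x * \<eta> x)) = L (\<lambda>x. \<phi> x * \<eta> x) + c * L (\<lambda>x. \<phi>' x * \<eta> x)"
    using L bounded_borel_mult[OF *(1) \<eta>] bounded_borel_mult[OF *(2) \<eta>] unfolding bp_functional_def by blast
  then show "L (\<lambda>x. (\<phi> x + c * \<phi>' x) * \<eta> x) = L (\<lambda>x. \<phi> x * \<eta> x) + c * L (\<lambda>x. \<phi>' x * \<eta> x)"
    by (simp add: algebra_simps)
next
  fix F :: "nat \<Rightarrow> real \<Rightarrow> complex" and \<phi> B
  assume F: "\<forall>n. F n \<in> borel_measurable borel" "\<forall>n x. cmod (F n x) \<le> B"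
      "\<forall>x. (\<lambda>n. F n x) \<longlonglongrightarrow> \<phi> x"
  obtain C where C: "C \<ge> 0" "\<And>x. cmod (\<eta> x) \<le> C" using bounded_borel_bound[OF \<eta>] by blast
  have [measurable]: "\<eta> \<in> borel_measurable borel" using \<eta> by (rule bounded_borel_measurable)
  have 1: "\<forall>n. (\<lambda>x. F n x * \<eta> x) \<in> borel_measurable borel"
    using F(1) by (intro allI borel_measurable_times) auto
  have "cmod (F n x * \<eta> x) \<le> B * C" for n x
    unfolding norm_mult by (rule mult_mono) (use F(2) C order_trans[OF norm_ge_zero F(2)[rule_format]] in auto)
  moreover have "(\<lambda>n. F n x * \<eta> x) \<longlonglongrightarrow> \<phi> x * \<eta> x" for x using F(3) by (intro tendsto_intros) simp
  ultimately show "(\<lambda>n. L (\<lambda>x. F n x * \<eta> x)) \<longlonglongrightarrow> L (\<lambda>x. \<phi> x * \<eta> x)"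
    by (intro L[unfolded bp_functional_def, THEN conjunct2, rule_format, where B = "B * C"])
      (use 1 in auto)
qed

section \<open>Finite Borel measures and polarization\<close>

definition finite_borel :: "real measure \<Rightarrow> bool"
  where "finite_borel M \<longleftrightarrow> finite_measure M \<and> sets M = sets borel"

lemma finite_borel_finite: "finite_borel M \<Longrightarrow> finite_measure M" and finite_borel_sets: "finite_borel M \<Longrightarrow> sets M = sets borel"
  by (auto simp: finite_borel_def)

lemma finite_borel_space: "finite_borel M \<Longrightarrow> space M = UNIV"
  using sets_eq_imp_space_eq[of M borel] by (simp add: finite_borel_def)

lemma finite_borel_integrable:
  fixes \<phi> :: "real \<Rightarrow> 'b :: {banach, second_countable_topology}"
  assumes "finite_borel M" "\<phi> \<in> borel_measurable borel" "\<And>x. norm (\<phi> x) \<le> B"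
  shows "integrable M \<phi>"
proof -
  interpret finite_measure M by (rule finite_borel_finite[OF assms(1)])
  show ?thesis
    by (rule integrable_const_bound[where B = B])
      (use assms in \<open>auto simp: finite_borel_sets cong: measurable_cong_sets\<close>)
qed

lemma bounded_borel_integrable: "finite_borel M \<Longrightarrow> bounded_borel \<phi> \<Longrightarrow> integrable M \<phi>"
  by (meson bounded_borel_def finite_borel_integrable)

lemma finite_borel_integral_tendsto:
  fixes F :: "nat \<Rightarrow> real \<Rightarrow> 'b :: {banach, second_countable_topology}"
  assumes M: "finite_borel M" and F: "\<And>n. F n \<in> borel_measurable borel" "\<And>n x. norm (F n x) \<le> B"
    "\<And>x. (\<lambda>n. F n x) \<longlonglongrightarrow> \<phi> x"
  shows "(\<lambda>n. \<integral>x. F n x \<partial>M) \<longlonglongrightarrow> (\<integral>x. \<phi> x \<partial>M)"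
proof (rule integral_dominated_convergence[where w = "\<lambda>_. B"])
  have "\<phi> \<in> borel_measurable borel"
    by (rule borel_measurable_LIMSEQ_metric[where f = F]) (use F in auto)
  then show "\<phi> \<in> borel_measurable M" "\<And>n. F n \<in> borel_measurable M"
    using F(1) by (simp_all add: finite_borel_sets[OF M] cong: measurable_cong_sets)
  show "integrable M (\<lambda>_. B)" by (rule finite_borel_integrable[OF M]) auto
qed (use F in auto)

lemma bp_functional_integral:
  assumes M: "finite_borel M" shows "bp_functional (\<lambda>\<phi>. \<integral>x. \<phi> x \<partial>M)"
  unfolding bp_functional_def
proof (intro conjI allI impI)
  fix \<phi> \<eta> c assume "bounded_borel \<phi>" "bounded_borel \<eta>"
  then show "(\<integral>x. \<phi> x + c * \<eta> x \<partial>M) = (\<integral>x. \<phi> x \<partial>M) + c * (\<integral>x. \<eta> x \<partial>M)"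
    using bounded_borel_integrable[OF M] by simp
next
  fix F :: "nat \<Rightarrow> real \<Rightarrow> complex" and \<phi> B
  assume "\<forall>n. F n \<in> borel_measurable borel" "\<forall>n x. cmod (F n x) \<le> B"
    "\<forall>x. (\<lambda>n. F n x) \<longlonglongrightarrow> \<phi> x"
  then show "(\<lambda>n. \<integral>x. F n x \<partial>M) \<longlonglongrightarrow> (\<integral>x. \<phi> x \<partial>M)"
    by (intro finite_borel_integral_tendsto[OF M, where B = B]) auto
qed

lemma cmod_integral_le:
  assumes "finite_borel M" "bounded_borel \<phi>" "\<And>x. cmod (\<phi> x) \<le> B"
  shows "cmod (\<integral>x. \<phi> x \<partial>M) \<le> B * measure M UNIV"
proof -
  have "cmod (\<integral>x. \<phi> x \<partial>M) \<le> (\<integral>x. cmod (\<phi> x) \<partial>M)" by simp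
  also have "\<dots> \<le> (\<integral>x. B \<partial>M)"
    by (rule integral_mono) (use assms bounded_borel_integrable finite_borel_integrable[of M "\<lambda>_. B"] in auto)
  finally show ?thesis by (simp add: finite_borel_space[OF assms(1)] mult.commute)
qed

lemma sum_lessThan_4: "(\<Sum>k<4::nat. h k) = h 0 + h 1 + h 2 + h 3" for h :: "nat \<Rightarrow> 'b :: comm_monoid_add"
  by (simp add: numeral_eq_Suc)

lemma imaginary_unit_powers: "\<i> ^ 0 = 1" "\<i> ^ 1 = \<i>" "\<i> ^ 2 = -1" "\<i> ^ 3 = - \<i>"
  by (simp_all add: power3_eq_cube)

definition sesquilinear :: "('a l2 \<Rightarrow> 'a l2 \<Rightarrow> complex) \<Rightarrow> bool" where
  "sesquilinear s \<longleftrightarrow> (\<forall>x y z c. s z (x + c *\<^sub>C y) = s z x + c * s z y) \<and>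
     (\<forall>x y z c. s (x + c *\<^sub>C y) z = s x z + cnj c * s y z)"

text \<open>With \<open>c = \<i> ^ k\<close> the terms in \<open>s f f\<close>, \<open>s f g\<close>
  and \<open>s g g\<close> carry the sums of \<open>\<i> ^ k\<close> or \<open>(-1) ^ k\<close> over
  four consecutive \<open>k\<close>, which vanish. The sign convention is that of
  \<open>spectral_integral\<close>.\<close>

lemma sesquilinear_polarization:
  assumes "sesquilinear s"
  shows "(1/4) * (\<Sum>k<4::nat. \<i> ^ k * s (f + \<i> ^ k *\<^sub>C g) (f + \<i> ^ k *\<^sub>C g)) = s g f"
proof -
  have e: "s (f + c *\<^sub>C g) (f + c *\<^sub>C g) = s f f + c * s f g + cnj c * (s g f + c * s g g)" for c
    using assms unfolding sesquilinear_def by metis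
  then show ?thesis
    unfolding sum_lessThan_4 imaginary_unit_powers by (simp only: e) (simp add: algebra_simps)
qed

lemma sesquilinear_diag_eqI:
  assumes "sesquilinear s" "sesquilinear s'" "\<And>f. s f f = s' f f"
  shows "s g f = s' g f"
  using sesquilinear_polarization[OF assms(1), of f g] sesquilinear_polarization[OF assms(2), of f g]
  by (simp add: assms(3))

lemma sesquilinear_cinner:
  assumes "clinear A" "clinear B" shows "sesquilinear (\<lambda>g f. cinner (A g) (B f))"
  by (simp add: sesquilinear_def clinearD[OF assms(1)] clinearD[OF assms(2)] cinner_simps)

lemma clinear_id: "clinear (\<lambda>x. x)"
  by (simp add: clinear_def)

text \<open>Mirrors \<open>spectral_integral\<close> term by term, so that \<open>evolution\<close>
  unfolds to it.\<close>

definition polar_integral ::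
  "('a l2 \<Rightarrow> real measure) \<Rightarrow> (real \<Rightarrow> complex) \<Rightarrow> 'a l2 \<Rightarrow> 'a l2 \<Rightarrow> complex" where
  "polar_integral \<mu> \<phi> g f = (1/4) * (\<Sum>k<4::nat. \<i> ^ k * (\<integral>x. \<phi> x \<partial>\<mu> (f + \<i> ^ k *\<^sub>C g)))"

text \<open>The scalar measures \<open>\<mu> f\<close> are only assumed to represent the operators \<open>T \<gamma>\<close> for a generating
  class \<open>G\<close> of functions. This covers projection-valued measures (\<open>G\<close> consists of indicator
  functions) as well as unitary operators (\<open>G\<close> consists of the integer powers of a function).\<close>

locale spectral_family =
  fixes \<mu> :: "'a l2 \<Rightarrow> real measure"
    and G :: "(real \<Rightarrow> complex) set"
    and T :: "(real \<Rightarrow> complex) \<Rightarrow> 'a l2 \<Rightarrow> 'a l2"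
  assumes \<mu>: "finite_borel (\<mu> f)"
    and generating: "bp_generating G"
    and gen_bounded_borel: "\<gamma> \<in> G \<Longrightarrow> bounded_borel \<gamma>"
    and gen_1: "(\<lambda>_. 1) \<in> G" and T_1: "T (\<lambda>_. 1) f = f"
    and T_linear: "\<gamma> \<in> G \<Longrightarrow> clinear (T \<gamma>)"
    and T_integral: "\<gamma> \<in> G \<Longrightarrow> cinner f (T \<gamma> f) = (\<integral>x. \<gamma> x \<partial>\<mu> f)"
    and gen_mult: "\<gamma> \<in> G \<Longrightarrow> \<gamma>' \<in> G \<Longrightarrow> (\<lambda>x. \<gamma> x * \<gamma>' x) \<in> G"
    and T_mult: "\<gamma> \<in> G \<Longrightarrow> \<gamma>' \<in> G \<Longrightarrow> T (\<lambda>x. \<gamma> x * \<gamma>' x) f = T \<gamma> (T \<gamma>' f)"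
begin

abbreviation I where "I \<equiv> polar_integral \<mu>"

lemma bp_functional_I: "bp_functional (\<lambda>\<phi>. I \<phi> g f)"
  unfolding polar_integral_def
  by (intro bp_functional_cmult bp_functional_sum bp_functional_integral \<mu>)

lemma I_gen: "\<gamma> \<in> G \<Longrightarrow> I \<gamma> g f = cinner g (T \<gamma> f)"
  using sesquilinear_polarization[OF sesquilinear_cinner[OF clinear_id T_linear], of \<gamma> f g]
  by (simp add: polar_integral_def T_integral)

text \<open>The measures of the vectors \<open>f + \<i> ^ k f\<close> have no assumed relation to
  \<open>\<mu> f\<close>; the two sides are compared on \<open>G\<close>, where both equal
  \<open>cinner f (T \<gamma> f)\<close>.\<close>

lemma I_diag: "bounded_borel \<phi> \<Longrightarrow> I \<phi> f f = (\<integral>x. \<phi> x \<partial>\<mu> f)"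
  by (rule bp_functional_eqI[OF generating bp_functional_I bp_functional_integral[OF \<mu>]])
    (simp_all add: I_gen T_integral)

text \<open>For fixed vectors both sides are functionals of \<open>\<phi>\<close>. On
  \<open>G\<close> they are matrix elements of the linear operator \<open>T \<gamma>\<close>, where
  the identity is clear.\<close>

lemma sesquilinear_I:
  assumes "bounded_borel \<phi>" shows "sesquilinear (I \<phi>)"
  unfolding sesquilinear_def
proof (intro conjI allI)
  fix x y z c
  show "I \<phi> z (x + c *\<^sub>C y) = I \<phi> z x + c * I \<phi> z y"
    by (rule bp_functional_eqI[OF generating bp_functional_I _ _ assms])
      (simp_all add: bp_functional_add bp_functional_I bp_functional_cmult I_gen clinearD[OF T_linear] cinner_simps)
  show "I \<phi> (x + c *\<^sub>C y) z = I \<phi> x z + cnj c * I \<phi> y z"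
    by (rule bp_functional_eqI[OF generating bp_functional_I _ _ assms])
      (simp_all add: bp_functional_add bp_functional_I bp_functional_cmult I_gen cinner_simps)
qed

lemma measure_UNIV: "measure (\<mu> f) UNIV = (norm f)\<^sup>2"
proof -
  have "complex_of_real ((norm f)\<^sup>2) = (\<integral>x. 1 \<partial>\<mu> f)"
    using T_integral[OF gen_1, of f] by (simp add: T_1 cinner_self)
  also have "\<dots> = complex_of_real (measure (\<mu> f) UNIV)"
    by (simp add: finite_borel_space[OF \<mu>] scaleR_conv_of_real)
  finally show ?thesis using of_real_eq_iff by metis
qed

text \<open>Boundedness is what Riesz representation asks for, and a crude constant will do. For
  vectors of norm at most 1 each \<open>f + \<i> ^ k g\<close> has total mass at most 4; four such
  terms with the prefactor 1/4 give \<open>4 * B\<close>, and scaling does the rest.\<close>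

lemma I_bound:
  assumes "bounded_borel \<phi>" "\<And>x. cmod (\<phi> x) \<le> B"
  shows "cmod (I \<phi> g f) \<le> 4 * B * norm f * norm g"
proof -
  have B0: "B \<ge> 0" using order_trans[OF norm_ge_zero assms(2)] .
  have unit: "cmod (I \<phi> g f) \<le> 4 * B" if "norm f \<le> 1" "norm g \<le> 1" for g f
  proof -
    have "cmod (\<i> ^ k * (\<integral>x. \<phi> x \<partial>\<mu> (f + \<i> ^ k *\<^sub>C g))) \<le> B * 4" for k :: nat
    proof -
      have "cmod (\<integral>x. \<phi> x \<partial>\<mu> (f + \<i> ^ k *\<^sub>C g)) \<le> B * (norm (f + \<i> ^ k *\<^sub>C g))\<^sup>2"
        using cmod_integral_le[OF \<mu> assms] by (simp add: measure_UNIV)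
      moreover have "norm (f + \<i> ^ k *\<^sub>C g) \<le> 2"
        by (rule order_trans[OF norm_triangle_ineq]) (use that in \<open>simp add: norm_power\<close>)
      then have "(norm (f + \<i> ^ k *\<^sub>C g))\<^sup>2 \<le> 2\<^sup>2" by (rule power_mono) simp
      ultimately have "cmod (\<integral>x. \<phi> x \<partial>\<mu> (f + \<i> ^ k *\<^sub>C g)) \<le> B * 4"
        using mult_left_mono[OF _ B0, of "(norm (f + \<i> ^ k *\<^sub>C g))\<^sup>2" 4] by simp
      then show ?thesis by (simp add: norm_mult norm_power)
    qed
    then have "cmod (\<Sum>k<4::nat. \<i> ^ k * (\<integral>x. \<phi> x \<partial>\<mu> (f + \<i> ^ k *\<^sub>C g))) \<le> (\<Sum>k<4::nat. B * 4)"
      by (intro sum_norm_le) auto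
    then show ?thesis unfolding polar_integral_def norm_mult by simp
  qed
  have sc: "I \<phi> (complex_of_real b *\<^sub>C g) (complex_of_real a *\<^sub>C f) = of_real (a * b) * I \<phi> g f" for a b :: real and f g
  proof -
    have s: "I \<phi> z (x + c *\<^sub>C y) = I \<phi> z x + c * I \<phi> z y" "I \<phi> (x + c *\<^sub>C y) z = I \<phi> x z + cnj c * I \<phi> y z" for x y z c
      using sesquilinear_I[OF assms(1)] by (auto simp: sesquilinear_def)
    have "I \<phi> z 0 = 0" "I \<phi> 0 z = 0" for z
      using s(1)[of z 0 1 0] s(2)[of 0 1 0 z] by simp_all
    then have "I \<phi> z (c *\<^sub>C y) = c * I \<phi> z y" "I \<phi> (c *\<^sub>C y) z = cnj c * I \<phi> y z" for z y c
      using s(1)[of z 0 c y] s(2)[of 0 c y z] by simp_all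
    then show ?thesis by simp
  qed
  define f' where "f' = complex_of_real (inverse (norm f)) *\<^sub>C f"
  define g' where "g' = complex_of_real (inverse (norm g)) *\<^sub>C g"
  have "norm f' \<le> 1" unfolding f'_def scaleC_of_real by (cases "f = 0") simp_all
  moreover have "norm g' \<le> 1" unfolding g'_def scaleC_of_real by (cases "g = 0") simp_all
  ultimately have "norm f * norm g * cmod (I \<phi> g' f') \<le> norm f * norm g * (4 * B)"
    by (intro mult_left_mono unit) auto
  moreover have f: "f = complex_of_real (norm f) *\<^sub>C f'" unfolding f'_def by (cases "f = 0") simp_all
  have g: "g = complex_of_real (norm g) *\<^sub>C g'" unfolding g'_def by (cases "g = 0") simp_all
  have "I \<phi> g f = of_real (norm f * norm g) * I \<phi> g' f'"
    using sc[of "norm g" g' "norm f" f'] f g by metis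
  then have "cmod (I \<phi> g f) = norm f * norm g * cmod (I \<phi> g' f')" by (simp add: norm_mult)
  ultimately show ?thesis by (simp add: mult_ac)
qed

text \<open>The bounded Borel functional calculus. The choice picks a Riesz vector, and there is
  only one, by \<open>eq_if_cinner_eq\<close>.\<close>

definition op :: "(real \<Rightarrow> complex) \<Rightarrow> 'a l2 \<Rightarrow> 'a l2"
  where "op \<phi> f = (SOME v. \<forall>g. I \<phi> g f = cinner g v)"

lemma cinner_op:
  assumes "bounded_borel \<phi>" shows "cinner g (op \<phi> f) = I \<phi> g f"
proof -
  obtain B where B: "\<And>x. cmod (\<phi> x) \<le> B" using bounded_borel_bound[OF assms] by blast
  have "\<exists>v. \<forall>g. I \<phi> g f = cinner g v"
  proof (rule riesz_representation[of "\<lambda>g. I \<phi> g f" "4 * B * norm f"])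
    show "I \<phi> (x + c *\<^sub>C y) f = I \<phi> x f + cnj c * I \<phi> y f" for x y c
      using sesquilinear_I[OF assms] by (simp add: sesquilinear_def)
    show "cmod (I \<phi> x f) \<le> 4 * B * norm f * norm x" for x by (rule I_bound[OF assms B])
  qed blast
  then have "\<forall>g. I \<phi> g f = cinner g (op \<phi> f)" unfolding op_def by (rule someI_ex)
  then show ?thesis by simp
qed

lemma op_eqI: "bounded_borel \<phi> \<Longrightarrow> (\<And>g. I \<phi> g f = cinner g v) \<Longrightarrow> op \<phi> f = v"
  by (rule eq_if_cinner_eq) (simp add: cinner_op)

lemma clinear_op: "bounded_borel \<phi> \<Longrightarrow> clinear (op \<phi>)"
  unfolding clinear_def using sesquilinear_I[of \<phi>]
  by (auto intro!: op_eqI simp: cinner_simps cinner_op sesquilinear_def)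

lemma op_gen: "\<gamma> \<in> G \<Longrightarrow> op \<gamma> f = T \<gamma> f"
  by (simp add: op_eqI gen_bounded_borel I_gen)

lemma op_add_cmult:
  assumes "bounded_borel \<phi>" "bounded_borel \<eta>"
  shows "op (\<lambda>x. \<phi> x + c * \<eta> x) f = op \<phi> f + c *\<^sub>C op \<eta> f"
  using bp_functional_I[unfolded bp_functional_def] assms
  by (intro op_eqI) (simp_all add: bounded_borel_add_cmult cinner_simps cinner_op)

lemma op_diff:
  assumes "bounded_borel \<phi>" "bounded_borel \<eta>"
  shows "op (\<lambda>x. \<phi> x - \<eta> x) f = op \<phi> f - op \<eta> f"
  using op_add_cmult[OF assms, of "-1"] by simp

lemma cinner_op_diag: "bounded_borel \<phi> \<Longrightarrow> cinner f (op \<phi> f) = (\<integral>x. \<phi> x \<partial>\<mu> f)"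
  by (simp add: cinner_op I_diag)

text \<open>By polarization only diagonal elements matter, and there the claim is that conjugating
  \<open>\<phi>\<close> conjugates its integral.\<close>

lemma op_adjoint:
  assumes "bounded_borel \<phi>" shows "cinner (op \<phi> g) f = cinner g (op (\<lambda>x. cnj (\<phi> x)) f)"
proof (rule sesquilinear_diag_eqI[of "\<lambda>g f. cinner (op \<phi> g) f" "\<lambda>g f. cinner g (op (\<lambda>x. cnj (\<phi> x)) f)"])
  show "cinner (op \<phi> f) f = cinner f (op (\<lambda>x. cnj (\<phi> x)) f)" for f
    using assms unfolding cinner_commute[of "op \<phi> f" f]
    by (simp add: cinner_op_diag bounded_borel_cnj)
qed (intro sesquilinear_cinner clinear_op clinear_id assms bounded_borel_cnj)+

text \<open>Two extensions from \<open>G\<close>: first \<open>\<phi>\<close> becomes arbitrary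
  against a generator, then the generator becomes arbitrary. For the second, \<open>\<phi>\<close>
  stays fixed and is moved to the other argument as its adjoint.\<close>

lemma op_mult:
  assumes "bounded_borel \<phi>" "bounded_borel \<eta>" shows "op (\<lambda>x. \<phi> x * \<eta> x) f = op \<phi> (op \<eta> f)"
proof (rule op_eqI[OF bounded_borel_mult[OF assms]])
  fix g
  have 1: "I (\<lambda>x. \<phi> x * \<gamma> x) g f = I \<phi> g (T \<gamma> f)" if "\<gamma> \<in> G" for \<gamma>
    by (rule bp_functional_eqI[OF generating bp_functional_times[OF bp_functional_I gen_bounded_borel] bp_functional_I _ assms(1)])
      (use that in \<open>simp_all add: I_gen gen_mult T_mult\<close>)
  have "I (\<lambda>x. \<eta> x * \<phi> x) g f = I \<eta> (op (\<lambda>x. cnj (\<phi> x)) g) f"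
  proof (rule bp_functional_eqI[OF generating bp_functional_times[OF bp_functional_I assms(1)] bp_functional_I _ assms(2)])
    fix \<gamma> assume "\<gamma> \<in> G"
    then show "I (\<lambda>x. \<gamma> x * \<phi> x) g f = I \<gamma> (op (\<lambda>x. cnj (\<phi> x)) g) f"
      using 1[of \<gamma>] assms(1) by (simp add: mult.commute I_gen op_adjoint bounded_borel_cnj cinner_op)
  qed
  also have "\<dots> = cinner g (op \<phi> (op \<eta> f))"
    using assms by (simp add: cinner_op[symmetric] op_adjoint bounded_borel_cnj)
  finally show "I (\<lambda>x. \<phi> x * \<eta> x) g f = cinner g (op \<phi> (op \<eta> f))"
    by (simp add: mult.commute)
qed

text \<open>Moving \<open>op \<phi>\<close> across as its adjoint collects the factor
  \<open>cnj (\<phi> x) * \<phi> x\<close>. This is what turns norms, differences and limits of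
  vectors into integrals.\<close>

lemma integral_op:
  assumes "bounded_borel \<phi>" "bounded_borel \<eta>"
  shows "(\<integral>x. \<eta> x \<partial>\<mu> (op \<phi> f)) = (\<integral>x. \<eta> x * of_real ((cmod (\<phi> x))\<^sup>2) \<partial>\<mu> f)"
proof -
  note b = assms bounded_borel_cnj[OF assms(1)] bounded_borel_mult
  have "(\<integral>x. \<eta> x \<partial>\<mu> (op \<phi> f)) = cinner f (op (\<lambda>x. cnj (\<phi> x)) (op \<eta> (op \<phi> f)))"
    using b by (simp add: cinner_op_diag[symmetric] op_adjoint)
  also have "\<dots> = cinner f (op (\<lambda>x. cnj (\<phi> x) * (\<eta> x * \<phi> x)) f)"
    using b by (simp add: op_mult)
  also have "\<dots> = (\<integral>x. cnj (\<phi> x) * (\<eta> x * \<phi> x) \<partial>\<mu> f)"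
    using b by (intro cinner_op_diag) auto
  finally show ?thesis unfolding complex_norm_square by (simp add: mult_ac)
qed

lemma norm_op:
  assumes "bounded_borel \<phi>" shows "(norm (op \<phi> f))\<^sup>2 = (\<integral>x. (cmod (\<phi> x))\<^sup>2 \<partial>\<mu> f)"
proof -
  have "complex_of_real ((norm (op \<phi> f))\<^sup>2) = (\<integral>x. 1 \<partial>\<mu> (op \<phi> f))"
    by (simp add: finite_borel_space[OF \<mu>] measure_UNIV scaleR_conv_of_real)
  also have "\<dots> = (\<integral>x. of_real ((cmod (\<phi> x))\<^sup>2) \<partial>\<mu> f)"
    using integral_op[OF assms bounded_borel_const[of 1]] by simp
  also have "\<dots> = complex_of_real (\<integral>x. (cmod (\<phi> x))\<^sup>2 \<partial>\<mu> f)"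
    by (rule integral_complex_of_real)
  finally show ?thesis by (simp only: of_real_eq_iff)
qed

lemma norm_op_diff:
  assumes "bounded_borel \<phi>" "bounded_borel \<eta>"
  shows "(norm (op \<phi> f - op \<eta> f))\<^sup>2 = (\<integral>x. (cmod (\<phi> x - \<eta> x))\<^sup>2 \<partial>\<mu> f)"
  using norm_op[of "\<lambda>x. \<phi> x - \<eta> x" f] bounded_borel_add_cmult[OF assms, of "-1"] op_diff[OF assms] by simp

text \<open>The squared norm of the difference is the integral of \<open>|F n - \<phi>|^2\<close>
  against one finite measure, so dominated convergence gives convergence in norm.\<close>

lemma op_tendsto:
  assumes F: "\<And>n. F n \<in> borel_measurable borel" "\<And>n x. cmod (F n x) \<le> B" "\<And>x. (\<lambda>n. F n x) \<longlonglongrightarrow> \<phi> x"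
  shows "(\<lambda>n. op (F n) f) \<longlonglongrightarrow> op \<phi> f"
proof -
  have bF: "bounded_borel (F n)" for n by (rule bounded_borelI[OF F(1,2)])
  have [measurable]: "\<phi> \<in> borel_measurable borel"
    by (rule borel_measurable_LIMSEQ_metric[where f = F]) (use F in auto)
  have B: "cmod (\<phi> x) \<le> B" for x
    by (rule LIMSEQ_le_const2[OF tendsto_norm[OF F(3)]]) (use F(2) in auto)
  have b: "bounded_borel \<phi>" by (rule bounded_borelI[OF _ B]) simp
  have "(\<lambda>n. \<integral>x. (cmod (F n x - \<phi> x))\<^sup>2 \<partial>\<mu> f) \<longlonglongrightarrow> (\<integral>x. 0 \<partial>\<mu> f)"
  proof (rule finite_borel_integral_tendsto[OF \<mu>, where B = "(2 * B)\<^sup>2"])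
    show "(\<lambda>x. (cmod (F n x - \<phi> x))\<^sup>2) \<in> borel_measurable borel" for n using F(1) by measurable
    show "norm ((cmod (F n x - \<phi> x))\<^sup>2) \<le> (2 * B)\<^sup>2" for n x
    proof -
      have "cmod (F n x - \<phi> x) \<le> 2 * B"
        using norm_triangle_ineq4[of "F n x" "\<phi> x"] F(2)[of n x] B[of x] by linarith
      from power_mono[OF this norm_ge_zero, of 2] show ?thesis by simp
    qed
    have "(\<lambda>n. (cmod (F n x - \<phi> x))\<^sup>2) \<longlonglongrightarrow> (cmod (\<phi> x - \<phi> x))\<^sup>2" for x by (intro tendsto_intros F)
    then show "(\<lambda>n. (cmod (F n x - \<phi> x))\<^sup>2) \<longlonglongrightarrow> 0" for x by simp
  qed
  then have "(\<lambda>n. (norm (op (F n) f - op \<phi> f))\<^sup>2) \<longlonglongrightarrow> 0" by (simp add: norm_op_diff bF b)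
  then have "(\<lambda>n. sqrt ((norm (op (F n) f - op \<phi> f))\<^sup>2)) \<longlonglongrightarrow> sqrt 0" by (rule tendsto_real_sqrt)
  then show ?thesis by (simp add: tendsto_norm_zero_iff LIM_zero_iff)
qed

lemma measure_eq_norm_op:
  assumes "S \<in> sets borel" shows "measure (\<mu> f) S = (norm (op (indicator S) f))\<^sup>2"
proof -
  have "(norm (op (indicator S) f))\<^sup>2 = (\<integral>x. indicator S x \<partial>\<mu> f)"
    unfolding norm_op[OF bounded_borel_indicator[OF assms]]
    by (rule Bochner_Integration.integral_cong) (auto simp: indicator_def)
  then show ?thesis using assms by (simp add: finite_borel_sets[OF \<mu>])
qed

end

text \<open>Simple functions are combinations of indicators, and every bounded Borel function is a
  bounded pointwise limit of simple ones.\<close>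

lemma bp_generating_indicators: "bp_generating {indicator S | S. S \<in> sets (borel :: real measure)}"
  unfolding bp_generating_def
proof (intro allI impI)
  fix P and \<phi> :: "real \<Rightarrow> complex"
  assume P: "bp_closed P" "\<forall>\<phi>\<in>{indicator S | S. S \<in> sets borel}. P \<phi>" and \<phi>: "bounded_borel \<phi>"
  have lin: "P (\<lambda>x. \<phi> x + c * \<eta> x)" if "bounded_borel \<phi>" "bounded_borel \<eta>" "P \<phi>" "P \<eta>" for \<phi> \<eta> c
    using P(1) that unfolding bp_closed_def by blast
  have ind: "P (indicator S)" if "S \<in> sets borel" for S using P(2) that by auto
  have Psum: "bounded_borel (\<lambda>x. \<Sum>i\<in>A. c i * indicator (S i) x) \<and> P (\<lambda>x. \<Sum>i\<in>A. c i * indicator (S i) x)"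
    if "finite A" "\<And>i. i \<in> A \<Longrightarrow> S i \<in> sets borel" for A and c :: "'x \<Rightarrow> complex" and S
    using that
  proof (induction A rule: finite_induct)
    case empty
    have "P (\<lambda>x. indicator {} x + (-1) * indicator {} x)"
      by (intro lin ind bounded_borel_indicator) auto
    then show ?case by (simp add: bounded_borel_const)
  next
    case (insert i A)
    moreover have "(\<lambda>x. \<Sum>i\<in>insert i A. c i * indicator (S i) x)
        = (\<lambda>x. (\<Sum>i\<in>A. c i * indicator (S i) x) + c i * indicator (S i) x)"
      by (rule ext) (simp only: sum.insert[OF insert.hyps] add.commute)
    ultimately show ?case
      using lin[of "\<lambda>x. \<Sum>i\<in>A. c i * indicator (S i) x" "indicator (S i)" "c i"]
        bounded_borel_add_cmult[of "\<lambda>x. \<Sum>i\<in>A. c i * indicator (S i) x" "indicator (S i)" "c i"]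
      by (simp add: ind bounded_borel_indicator)
  qed
  obtain B where B: "B \<ge> 0" "\<And>x. cmod (\<phi> x) \<le> B" using bounded_borel_bound[OF \<phi>] by blast
  \<comment> \<open>The factor 2 in the last property of the approximants yields the common bound
    \<open>2 * B\<close> that \<open>bp_closed\<close> asks for.\<close>
  obtain F where F: "\<And>i. simple_function borel (F i)" "\<And>x. (\<lambda>i. F i x) \<longlonglongrightarrow> \<phi> x"
      "\<And>i x. dist (F i x) 0 \<le> 2 * dist (\<phi> x) 0"
    using borel_measurable_implies_sequence_metric[OF bounded_borel_measurable[OF \<phi>], of 0] by auto
  have "P (F i)" for i
  proof -
    have fin: "finite (range (F i))" using F(1)[of i] by (simp add: simple_function_def)
    have "F i -` {z} \<in> sets borel" for z
      using simple_functionD(2)[OF F(1), of i "{z}"] by simp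
    then have "P (\<lambda>x. \<Sum>z\<in>range (F i). z * indicator (F i -` {z}) x)"
      using Psum[OF fin, of "\<lambda>z. F i -` {z}" "\<lambda>z. z"] by simp
    moreover have "(\<Sum>z\<in>range (F i). z * indicator (F i -` {z}) x) = F i x" for x
      using fin by (subst sum.remove[of _ "F i x"]) (auto simp: indicator_def)
    ultimately show ?thesis by simp
  qed
  moreover have "cmod (F i x) \<le> 2 * B" for i x
    using F(3)[of i x] B(2)[of x] by simp
  moreover have "F i \<in> borel_measurable borel" for i by (rule borel_measurable_simple_function[OF F(1)])
  ultimately show "P \<phi>" using P(1) F(2) unfolding bp_closed_def by blast
qed

section \<open>The Cayley transform\<close>

text \<open>The last assumption identifies the graph of the adjoint with the graph of
  \<open>A\<close>: read forwards it is symmetry, read backwards it puts into \<open>Dom\<close>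
  every vector on which the adjoint is defined.\<close>

locale self_adjoint_operator =
  fixes Dom :: "'a l2 set" and A :: "'a l2 \<Rightarrow> 'a l2"
  assumes subspace_Dom: "csubspace Dom"
    and A_linear: "x \<in> Dom \<Longrightarrow> y \<in> Dom \<Longrightarrow> A (x + c *\<^sub>C y) = A x + c *\<^sub>C A y"
    and Dom_dense: "e > 0 \<Longrightarrow> \<exists>y\<in>Dom. norm (x - y) < e"
    and adjoint_iff: "f \<in> Dom \<and> h = A f \<longleftrightarrow> (\<forall>g\<in>Dom. cinner f (A g) = cinner h g)"
begin

lemma symmetric: "f \<in> Dom \<Longrightarrow> g \<in> Dom \<Longrightarrow> cinner f (A g) = cinner (A f) g"
  using adjoint_iff[of f "A f"] by blast

lemma A_0: "A 0 = 0"
  using A_linear[of 0 0 1] subspace_Dom by (simp add: csubspaceD)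

lemma A_scaleC: "y \<in> Dom \<Longrightarrow> A (c *\<^sub>C y) = c *\<^sub>C A y"
  using A_linear[of 0 y c] subspace_Dom by (simp add: csubspaceD A_0)

lemma A_diff: "x \<in> Dom \<Longrightarrow> y \<in> Dom \<Longrightarrow> A (x - y) = A x - A y"
  using A_linear[of x y "-1"] by simp

text \<open>\<open>cinner f (A f)\<close> is real by symmetry, so the cross terms cancel.
  Consequently \<open>A + c\<close> is bounded below, and the two signs give equal norms, which
  later makes the Cayley transform isometric.\<close>

lemma norm_A_plus:
  assumes "f \<in> Dom" "c = \<i> \<or> c = - \<i>"
  shows "(norm (A f + c *\<^sub>C f))\<^sup>2 = (norm (A f))\<^sup>2 + (norm f)\<^sup>2"
proof -
  have "complex_of_real ((norm (A f + c *\<^sub>C f))\<^sup>2) = complex_of_real ((norm (A f))\<^sup>2 + (norm f)\<^sup>2)"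
    unfolding of_real_add cinner_self[symmetric]
    using assms symmetric[OF assms(1,1)] by (auto simp: cinner_simps algebra_simps)
  then show ?thesis by (simp only: of_real_eq_iff)
qed

lemma norm_le_A_plus:
  assumes "f \<in> Dom" "c = \<i> \<or> c = - \<i>" shows "norm f \<le> norm (A f + c *\<^sub>C f)"
proof (rule power2_le_imp_le)
  show "(norm f)\<^sup>2 \<le> (norm (A f + c *\<^sub>C f))\<^sup>2" unfolding norm_A_plus[OF assms] by simp
qed simp

text \<open>Adjoints are closed: the defining identity passes to the limit in both slots.\<close>

lemma A_closed:
  assumes X: "\<And>n. X n \<in> Dom" "X \<longlonglongrightarrow> f" "(\<lambda>n. A (X n)) \<longlonglongrightarrow> h"
  shows "f \<in> Dom \<and> h = A f"
proof -
  have "cinner f (A g) = cinner h g" if "g \<in> Dom" for g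
  proof (rule LIMSEQ_unique)
    show "(\<lambda>n. cinner (X n) (A g)) \<longlonglongrightarrow> cinner f (A g)" by (intro tendsto_intros X)
    have "(\<lambda>n. cinner (A (X n)) g) \<longlonglongrightarrow> cinner h g" by (intro tendsto_intros X)
    then show "(\<lambda>n. cinner (X n) (A g)) \<longlonglongrightarrow> cinner h g" using X(1) that by (simp add: symmetric)
  qed
  then show ?thesis using adjoint_iff by blast
qed

text \<open>The range is closed because \<open>A\<close> is closed and \<open>A + c\<close> is
  bounded below. A vector \<open>z\<close> orthogonal to it lies in the domain of the adjoint with
  \<open>A z = c z\<close>, so it is killed by \<open>A - c\<close>, which is also bounded
  below.\<close>

lemma A_plus_surj:
  assumes c: "c = \<i> \<or> c = - \<i>" shows "\<exists>f\<in>Dom. A f + c *\<^sub>C f = y"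
proof -
  define R where "R = (\<lambda>f. A f + c *\<^sub>C f) ` Dom"
  have R: "csubspace R"
    unfolding csubspace_def
  proof (intro conjI ballI allI)
    show "0 \<in> R" unfolding R_def using csubspaceD(1)[OF subspace_Dom] A_0 by (intro image_eqI[of _ _ 0]) auto
    fix x y b assume "x \<in> R" "y \<in> R"
    then obtain u v where "u \<in> Dom" "v \<in> Dom" "x = A u + c *\<^sub>C u" "y = A v + c *\<^sub>C v" by (auto simp: R_def)
    then show "x + b *\<^sub>C y \<in> R" unfolding R_def
      by (intro image_eqI[of _ _ "u + b *\<^sub>C v"])
        (simp_all add: A_linear csubspaceD(2)[OF subspace_Dom] scaleC_distrib mult.commute)
  qed
  have "closed R"
    unfolding closed_sequential_limits
  proof (intro allI impI, elim conjE)
    fix Y l assume Y: "\<forall>n. Y n \<in> R" "Y \<longlonglongrightarrow> l"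
    then have "\<forall>n. \<exists>f\<in>Dom. Y n = A f + c *\<^sub>C f" by (auto simp: R_def)
    then obtain X where X: "\<And>n. X n \<in> Dom" "\<And>n. Y n = A (X n) + c *\<^sub>C X n" by metis
    have le: "norm (X m - X n) \<le> norm (Y m - Y n)" for m n
    proof -
      have "Y m - Y n = A (X m - X n) + c *\<^sub>C (X m - X n)"
        by (simp add: X A_diff scaleC_distrib)
      then show ?thesis using norm_le_A_plus[OF _ c, of "X m - X n"] csubspaceD(4)[OF subspace_Dom X(1) X(1)] by simp
    qed
    have "Cauchy X"
      using LIMSEQ_imp_Cauchy[OF Y(2)] le unfolding Cauchy_iff by (meson le_less_trans)
    then obtain f where f: "X \<longlonglongrightarrow> f" using Cauchy_convergent by (auto simp: convergent_def)
    have "(\<lambda>n. Y n - c *\<^sub>C X n) \<longlonglongrightarrow> l - c *\<^sub>C f" by (intro tendsto_intros Y f)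
    then have "(\<lambda>n. A (X n)) \<longlonglongrightarrow> l - c *\<^sub>C f" by (simp add: X(2))
    from A_closed[OF X(1) f this] have "f \<in> Dom" "l = A f + c *\<^sub>C f" by (auto simp: diff_eq_eq)
    then show "l \<in> R" by (auto simp: R_def)
  qed
  obtain p where p: "p \<in> R" "\<And>g. g \<in> R \<Longrightarrow> cinner g (y - p) = 0"
    using orthogonal_projection_exists[OF R \<open>closed R\<close>, of y] by blast
  define z where "z = y - p"
  have "cinner z (A g) = cinner (c *\<^sub>C z) g" if "g \<in> Dom" for g
  proof -
    have "cinner (A g + c *\<^sub>C g) z = 0" using p(2)[of "A g + c *\<^sub>C g"] that by (simp add: R_def z_def)
    then have "cnj (cinner z (A g)) + cnj c * cnj (cinner z g) = 0"
      by (simp add: cinner_simps flip: cinner_commute[of _ z])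
    then have "cinner z (A g) + c * cinner z g = 0"
      by (metis complex_cnj_add complex_cnj_mult complex_cnj_zero_iff)
    then have "cinner z (A g) = - c * cinner z g" by (simp add: eq_neg_iff_add_eq_0)
    moreover have "cnj c = - c" using c by auto
    ultimately show ?thesis by (simp add: cinner_simps)
  qed
  then have z: "z \<in> Dom" "A z = c *\<^sub>C z" using adjoint_iff[of z "c *\<^sub>C z"] by auto
  have "A z + (- c) *\<^sub>C z = 0" by (simp add: z scaleC_distrib)
  then have "norm z \<le> 0" using norm_le_A_plus[OF z(1), of "- c"] c by (metis minus_minus norm_zero)
  then have "y = p" by (simp add: z_def)
  then show ?thesis using p(1) by (auto simp: R_def)
qed

lemma A_plus_inj:
  assumes c: "c = \<i> \<or> c = - \<i>" and "f \<in> Dom" "g \<in> Dom" "A f + c *\<^sub>C f = A g + c *\<^sub>C g"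
  shows "f = g"
proof -
  have "A (f - g) + c *\<^sub>C (f - g) = (A f + c *\<^sub>C f) - (A g + c *\<^sub>C g)"
    unfolding A_diff[OF assms(2,3)] scaleC_distrib by simp
  then have "A (f - g) + c *\<^sub>C (f - g) = 0" using assms by simp
  then have "norm (f - g) \<le> 0"
    using norm_le_A_plus[OF csubspaceD(4)[OF subspace_Dom assms(2,3)] c] by simp
  then show ?thesis by simp
qed

text \<open>The resolvent \<open>(A + c)^{-1}\<close>, meaningful for \<open>c = \<i>\<close> and
  \<open>c = - \<i>\<close>.\<close>

definition res :: "complex \<Rightarrow> 'a l2 \<Rightarrow> 'a l2"
  where "res c y = (THE f. f \<in> Dom \<and> A f + c *\<^sub>C f = y)"

lemma res:
  assumes c: "c = \<i> \<or> c = - \<i>" shows "res c y \<in> Dom" "A (res c y) + c *\<^sub>C res c y = y"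
proof -
  have "\<exists>!f. f \<in> Dom \<and> A f + c *\<^sub>C f = y"
    using A_plus_surj[OF c] A_plus_inj[OF c] by metis
  from theI'[OF this] show "res c y \<in> Dom" "A (res c y) + c *\<^sub>C res c y = y" unfolding res_def by auto
qed

lemma res_A_plus: "c = \<i> \<or> c = - \<i> \<Longrightarrow> f \<in> Dom \<Longrightarrow> res c (A f + c *\<^sub>C f) = f"
  using A_plus_inj res by metis

lemma clinear_res: assumes c: "c = \<i> \<or> c = - \<i>" shows "clinear (res c)"
  unfolding clinear_def
proof (intro allI)
  fix x y b
  let ?f = "res c x + b *\<^sub>C res c y"
  have "?f \<in> Dom" using csubspaceD(2)[OF subspace_Dom res(1)[OF c] res(1)[OF c]] .
  moreover have "A ?f + c *\<^sub>C ?f = (A (res c x) + c *\<^sub>C res c x) + b *\<^sub>C (A (res c y) + c *\<^sub>C res c y)"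
    by (simp add: A_linear res(1)[OF c] scaleC_distrib mult.commute)
  ultimately show "res c (x + b *\<^sub>C y) = ?f" using res_A_plus[OF c, of ?f] by (simp add: res(2)[OF c])
qed

definition cayley :: "'a l2 \<Rightarrow> 'a l2" where "cayley y = A (res \<i> y) + (- \<i>) *\<^sub>C res \<i> y"
definition cayley_inv :: "'a l2 \<Rightarrow> 'a l2" where "cayley_inv y = A (res (- \<i>) y) + \<i> *\<^sub>C res (- \<i>) y"

lemma cayley_cayley_inv: "cayley (cayley_inv y) = y" "cayley_inv (cayley y) = y"
  unfolding cayley_def cayley_inv_def by (simp_all add: res_A_plus res)

lemma cayley_eq: "cayley y = y - (2 * \<i>) *\<^sub>C res \<i> y"
proof -
  have *: "A (res \<i> y) = y - \<i> *\<^sub>C res \<i> y" using res(2)[of \<i> y] by (simp add: eq_diff_eq)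
  show ?thesis unfolding cayley_def * by (rule l2_eqI) (simp add: coord_simps algebra_simps)
qed

lemma cayley_inv_eq: "cayley_inv y = y + (2 * \<i>) *\<^sub>C res (- \<i>) y"
proof -
  have *: "A (res (- \<i>) y) = y - (- \<i>) *\<^sub>C res (- \<i>) y" using res(2)[of "- \<i>" y] by (simp add: eq_diff_eq)
  show ?thesis unfolding cayley_inv_def * by (rule l2_eqI) (simp add: coord_simps algebra_simps)
qed

lemma clinear_cayley: "clinear cayley" "clinear cayley_inv"
  unfolding clinear_def cayley_eq cayley_inv_eq
  by (simp_all add: clinearD(1)[OF clinear_res] scaleC_distrib mult.commute)

lemma norm_cayley: "norm (cayley y) = norm y"
proof -
  have "(norm (cayley y))\<^sup>2 = (norm y)\<^sup>2"
    using norm_A_plus[OF res(1), of \<i> "- \<i>" y] norm_A_plus[OF res(1), of \<i> \<i> y]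
    unfolding cayley_def by (simp add: res)
  then show ?thesis by (simp add: power2_eq_iff_nonneg)
qed

text \<open>\<open>1 - U = 2 \<i> (A + \<i>)^{-1}\<close>, and the resolvent maps onto the
  domain.\<close>

lemma Dom_iff_cayley: "f \<in> Dom \<longleftrightarrow> (\<exists>y. f = y - cayley y)"
proof
  assume f: "f \<in> Dom"
  define y where "y = (1 / (2 * \<i>)) *\<^sub>C (A f + \<i> *\<^sub>C f)"
  have "y - cayley y = (2 * \<i>) *\<^sub>C res \<i> y" by (simp add: cayley_eq)
  also have "\<dots> = f" using f by (simp add: y_def clinearD(5)[OF clinear_res] res_A_plus)
  finally show "\<exists>y. f = y - cayley y" by metis
next
  assume "\<exists>y. f = y - cayley y"
  then show "f \<in> Dom" using res(1) csubspaceD(5)[OF subspace_Dom] by (auto simp: cayley_eq)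
qed

text \<open>With \<open>Dom_iff_cayley\<close> this recovers \<open>A\<close> from its Cayley
  transform \<open>U\<close> as \<open>\<i> (1 + U) (1 - U)^{-1}\<close>.\<close>

lemma A_cayley: "A (y - cayley y) = \<i> *\<^sub>C (y + cayley y)"
proof -
  have "A (y - cayley y) = (2 * \<i>) *\<^sub>C A (res \<i> y)" by (simp add: cayley_eq A_scaleC res)
  moreover have *: "A (res \<i> y) = y - \<i> *\<^sub>C res \<i> y" using res(2)[of \<i> y] by (simp add: eq_diff_eq)
  have "y + cayley y = 2 *\<^sub>C A (res \<i> y)"
    unfolding cayley_eq * by (rule l2_eqI) (simp add: coord_simps algebra_simps)
  ultimately show ?thesis by (simp add: mult.commute)
qed

end

section \<open>Scalar spectral measures of a unitary operator\<close>

locale unitary_operator =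
  fixes U V :: "'a l2 \<Rightarrow> 'a l2"
  assumes clinear_U: "clinear U" and clinear_V: "clinear V"
    and UV: "U (V x) = x" and VU: "V (U x) = x" and norm_U: "norm (U x) = norm x"
begin

definition upow :: "int \<Rightarrow> 'a l2 \<Rightarrow> 'a l2"
  where "upow k = (if k \<ge> 0 then U ^^ nat k else V ^^ nat (- k))"

lemma upow_0: "upow 0 x = x"
  by (simp add: upow_def)

lemma upow_1: "upow 1 x = U x"
  by (simp add: upow_def)

lemma upow_Suc: "upow (k + 1) x = U (upow k x)"
proof (cases "k \<ge> 0")
  case True
  then show ?thesis by (simp add: upow_def nat_add_distrib)
next
  case False
  then have "nat (- k) = Suc (nat (- (k + 1)))" by simp
  then have "upow k x = V (upow (k + 1) x)" using False by (cases "k = -1") (simp_all add: upow_def)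
  then show ?thesis by (simp add: UV)
qed

lemma upow_pred: "upow (k - 1) x = V (upow k x)"
  using upow_Suc[of "k - 1" x] VU by simp

lemma upow_add: "upow (j + k) x = upow j (upow k x)"
proof (induction j rule: int_induct[where k = 0])
  case base show ?case by (simp add: upow_0)
next
  case (step1 i)
  have "i + 1 + k = (i + k) + 1" by simp
  then show ?case using step1 by (simp only: upow_Suc)
next
  case (step2 i)
  have "i - 1 + k = (i + k) - 1" by simp
  then show ?case using step2 by (simp only: upow_pred)
qed

lemma clinear_upow: "clinear (upow k)"
proof (induction k rule: int_induct[where k = 0])
  case base show ?case by (simp add: clinear_def upow_0)
next
  case (step1 i) then show ?case by (simp add: clinear_def upow_Suc clinearD(1)[OF clinear_U])
next
  case (step2 i) then show ?case by (simp add: clinear_def upow_pred clinearD(1)[OF clinear_V])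
qed

lemma cinner_U: "cinner (U x) (U y) = cinner x y"
  by (rule sesquilinear_diag_eqI[OF sesquilinear_cinner[OF clinear_U clinear_U] sesquilinear_cinner[OF clinear_id clinear_id]])
    (simp add: cinner_self norm_U)

lemma cinner_V: "cinner (V x) (V y) = cinner x y"
  using cinner_U[of "V x" "V y"] by (simp add: UV)

lemma cinner_upow: "cinner (upow k x) (upow k y) = cinner x y"
proof (induction k rule: int_induct[where k = 0])
  case base show ?case by (simp add: upow_0)
next
  case (step1 i) then show ?case by (simp add: upow_Suc cinner_U)
next
  case (step2 i) then show ?case by (simp add: upow_pred cinner_V)
qed

lemma cinner_upow_upow: "cinner (upow k f) (upow l f) = cinner f (upow (l - k) f)"
  using cinner_upow[of k f "upow (l - k) f"] by (simp flip: upow_add)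

lemma norm_upow: "norm (upow k x) = norm x"
  using cinner_upow[of k x x] unfolding cinner_self of_real_eq_iff by (simp add: power2_eq_iff_nonneg)

end

section \<open>Fejer densities and the Herglotz theorem\<close>

lemma norm_sum_square:
  fixes v :: "nat \<Rightarrow> 'a l2"
  shows "complex_of_real ((norm (\<Sum>k<N. v k))\<^sup>2) = (\<Sum>k<N. \<Sum>l<N. cinner (v k) (v l))"
proof -
  have 1: "cinner x (\<Sum>l<N. v l) = (\<Sum>l<N. cinner x (v l))" for x N
    by (induction N) (simp_all add: cinner_simps)
  have 2: "cinner (\<Sum>k<N. v k) x = (\<Sum>k<N. cinner (v k) x)" for x N
    by (induction N) (simp_all add: cinner_simps)
  show ?thesis unfolding cinner_self[symmetric] by (simp only: 2) (simp only: 1)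
qed

lemma integral_exp_period:
  fixes j :: int
  shows "(\<integral>x. indicator {0..2*pi} x *\<^sub>R cis (of_int j * x) \<partial>lborel) = (if j = 0 then 2 * pi else 0)"
proof (cases "j = 0")
  case True
  then show ?thesis by (simp add: scaleR_conv_of_real)
next
  case False
  have "(\<integral>x. indicator {0..2*pi} x *\<^sub>R cis (of_int j * x) \<partial>lborel)
      = cis (of_int j * (2*pi)) / (\<i> * of_int j) - cis (of_int j * 0) / (\<i> * of_int j)"
  proof (rule integral_FTC_atLeastAtMost)
    fix x :: real
    have "((\<lambda>z. exp (\<i> * of_int j * z) / (\<i> * of_int j)) has_field_derivative exp (\<i> * of_int j * of_real x)) (at (of_real x))"
      using False by (auto intro!: derivative_eq_intros)
    from has_vector_derivative_real_field[OF this]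
    show "((\<lambda>x. cis (of_int j * x) / (\<i> * of_int j)) has_vector_derivative cis (of_int j * x)) (at x within {0..2*pi})"
      by (simp add: cis_conv_exp mult.assoc)
  next
    show "continuous_on {0..2 * pi} (\<lambda>x. cis (of_int j * x))" by (intro continuous_intros)
  qed simp
  moreover have "cis (of_int j * (2*pi)) = 1"
    using cis_multiple_2pi[of "of_int j"] by (simp add: mult.commute mult.left_commute)
  ultimately show ?thesis using False by simp
qed

text \<open>Counts the index pairs on one off-diagonal of a square; truncated subtraction covers the
  offsets that lie beyond the square.\<close>

lemma count_diagonal:
  "(\<Sum>k<M. \<Sum>l<M. if m + int k - int l = 0 then (1::complex) else 0) = of_nat (M - nat \<bar>m\<bar>)"
proof -
  have "(\<Sum>l<M. if m + int k - int l = 0 then (1::complex) else 0) = (if m + int k \<in> {0..<int M} then 1 else 0)" for k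
  proof -
    have "(\<Sum>l<M. if m + int k - int l = 0 then (1::complex) else 0)
        = (\<Sum>l<M. if l = nat (m + int k) \<and> m + int k \<ge> 0 then 1 else 0)"
      by (intro sum.cong) auto
    then show ?thesis by (cases "m + int k \<ge> 0") auto
  qed
  then have "(\<Sum>k<M. \<Sum>l<M. if m + int k - int l = 0 then (1::complex) else 0)
      = of_nat (card {k\<in>{..<M}. m + int k \<in> {0..<int M}})"
    by (simp add: sum.If_cases Int_def conj_commute)
  also have "{k\<in>{..<M}. m + int k \<in> {0..<int M}} = {nat (- m)..<M - nat m}"
    by auto
  finally show ?thesis by (cases "m \<ge> 0") auto
qed

context unitary_operator begin

text \<open>The Fejer mean of the Fourier series with coefficients
  \<open>cinner f (upow k f)\<close>. As a squared norm it is evidently non-negative; positive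
  definiteness of the coefficients enters here. Taking \<open>Suc N\<close> terms keeps the
  denominator nonzero.\<close>

definition fejer :: "'a l2 \<Rightarrow> nat \<Rightarrow> real \<Rightarrow> real" where
  "fejer f N x = (norm (\<Sum>k<Suc N. cis (- (real k * x)) *\<^sub>C upow (int k) f))\<^sup>2 / (2 * pi * Suc N)"

lemma fejer_nonneg: "fejer f N x \<ge> 0"
  by (simp add: fejer_def)

lemma fejer_eq:
  "complex_of_real (fejer f N x)
    = (\<Sum>k<Suc N. \<Sum>l<Suc N. cis (of_int (int k - int l) * x) * cinner f (upow (int l - int k) f)) / (2 * pi * Suc N)"
proof -
  have "cinner (cis (- (real k * x)) *\<^sub>C upow (int k) f) (cis (- (real l * x)) *\<^sub>C upow (int l) f)
      = cis (of_int (int k - int l) * x) * cinner f (upow (int l - int k) f)" for k l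
    by (simp add: cinner_simps cinner_upow_upow cis_cnj cis_mult algebra_simps)
  then show ?thesis
    unfolding fejer_def of_real_divide norm_sum_square by simp
qed

lemma fejer_measurable [measurable]: "fejer f N \<in> borel_measurable borel"
proof -
  have "continuous_on UNIV (\<lambda>x. Re (complex_of_real (fejer f N x)))"
    unfolding fejer_eq by (intro continuous_intros) (simp del: of_nat_Suc of_real_mult)
  then show ?thesis by (intro borel_measurable_continuous_onI) simp
qed

text \<open>Orthogonality of exponentials keeps only the index pairs with \<open>l - k = m\<close>,
  which gives the triangular Fejer weight; it tends to 1 for fixed \<open>m\<close>.\<close>

lemma fejer_moment:
  "(\<integral>x. indicator {0..2*pi} x *\<^sub>R (cis (of_int m * x) * complex_of_real (fejer f N x)) \<partial>lborel)
     = of_nat (Suc N - nat \<bar>m\<bar>) / of_nat (Suc N) * cinner f (upow m f)"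
proof -
  let ?c = "\<lambda>j. cinner f (upow j f)"
  have integrable: "integrable lborel (\<lambda>x. indicator {0..2*pi} x *\<^sub>R cis (of_int j * x))" for j :: int
    by (rule borel_integrable_atLeastAtMost'[unfolded set_integrable_def]) (intro continuous_intros)
  have eq: "indicator {0..2*pi} x *\<^sub>R (cis (of_int m * x) * complex_of_real (fejer f N x))
      = (\<Sum>k<Suc N. \<Sum>l<Suc N. (?c (int l - int k) / (2 * pi * Suc N)) *
          (indicator {0..2*pi} x *\<^sub>R cis (of_int (m + int k - int l) * x)))" for x
  proof -
    have "cis (of_int m * x) * cis (of_int (int k - int l) * x) = cis (of_int (m + int k - int l) * x)" for k l
      by (simp add: cis_mult algebra_simps)
    then show ?thesis
      unfolding fejer_eq sum_divide_distrib sum_distrib_left scaleR_sum_right scaleR_conv_of_real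
      by (intro sum.cong refl) (simp add: field_simps)
  qed
  have "(\<integral>x. indicator {0..2*pi} x *\<^sub>R (cis (of_int m * x) * complex_of_real (fejer f N x)) \<partial>lborel)
      = (\<Sum>k<Suc N. \<Sum>l<Suc N. (?c (int l - int k) / (2 * pi * Suc N)) *
          (if m + int k - int l = 0 then 2 * pi else 0))"
    unfolding eq by (subst Bochner_Integration.integral_sum; (intro Bochner_Integration.integrable_sum integrable_mult_right integrable)?)
      (subst Bochner_Integration.integral_sum, intro integrable_mult_right integrable, 
       simp only: integral_mult_right_zero integral_exp_period)
  also have "\<dots> = (\<Sum>k<Suc N. \<Sum>l<Suc N. (?c m / of_nat (Suc N)) * (if m + int k - int l = 0 then 1 else 0))"
  proof (intro sum.cong refl)
    fix k l
    show "(?c (int l - int k) / (2 * pi * Suc N)) * complex_of_real (if m + int k - int l = 0 then 2 * pi else 0)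
        = (?c m / of_nat (Suc N)) * (if m + int k - int l = 0 then 1 else 0)"
    proof (cases "m + int k - int l = 0")
      case True
      then have *: "int l - int k = m" by simp
      show ?thesis unfolding * using True by (simp del: of_nat_Suc)
    qed simp
  qed
  also have "\<dots> = (?c m / of_nat (Suc N)) * of_nat (Suc N - nat \<bar>m\<bar>)"
    unfolding count_diagonal[symmetric] sum_distrib_left ..
  finally show ?thesis by simp
qed

text \<open>Unit norm makes the zeroth moment 1, so the densities give probability measures on one
  compact interval. They are tight, and the weak limit of a subsequence inherits the limits of all
  trigonometric moments.\<close>

lemma herglotz:
  assumes f: "norm f = 1"
  shows "\<exists>M. real_distribution M \<and> (\<forall>k::int. (\<integral>x. cis (of_int k * x) \<partial>M) = cinner f (upow k f))"
proof -
  define M where "M N = density lborel (\<lambda>x. ennreal (indicator {0..2*pi} x * fejer f N x))" for N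
  have int: "(\<integral>x. cis (of_int m * x) \<partial>M N) = of_nat (Suc N - nat \<bar>m\<bar>) / of_nat (Suc N) * cinner f (upow m f)" for m N
  proof -
    have "(\<integral>x. cis (of_int m * x) \<partial>M N)
        = (\<integral>x. (indicator {0..2*pi} x * fejer f N x) *\<^sub>R cis (of_int m * x) \<partial>lborel)"
      unfolding M_def by (intro integral_density) (auto simp: fejer_nonneg intro!: borel_measurable_continuous_onI continuous_intros)
    also have "\<dots> = (\<integral>x. indicator {0..2*pi} x *\<^sub>R (cis (of_int m * x) * complex_of_real (fejer f N x)) \<partial>lborel)"
      by (intro Bochner_Integration.integral_cong) (auto simp: scaleR_conv_of_real)
    finally show ?thesis by (simp add: fejer_moment)
  qed
  have "emeasure (M N) (space (M N)) = 1" for N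
  proof -
    have eq: "complex_of_real (indicator {0..2*pi} x * fejer f N x)
        = indicator {0..2*pi} x *\<^sub>R (cis (of_int 0 * x) * complex_of_real (fejer f N x))" for x
      by (simp add: scaleR_conv_of_real)
    have "complex_of_real (\<integral>x. indicator {0..2*pi} x * fejer f N x \<partial>lborel) = 1"
      unfolding integral_complex_of_real[symmetric] eq fejer_moment using f by (simp add: upow_0 cinner_self del: of_nat_Suc)
    then have 1: "(\<integral>x. indicator {0..2*pi} x * fejer f N x \<partial>lborel) = 1" by (simp only: of_real_eq_1_iff)
    then have "integrable lborel (\<lambda>x. indicator {0..2*pi} x * fejer f N x)"
      using not_integrable_integral_eq by fastforce
    then show ?thesis unfolding M_def
      by (simp add: emeasure_density nn_integral_eq_integral fejer_nonneg 1)
  qed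
  then have rd: "real_distribution (M N)" for N
    by (intro real_distribution.intro prob_spaceI real_distribution_axioms.intro) (auto simp: M_def)
  have "tight M"
    unfolding tight_def
  proof (intro conjI allI impI rd)
    fix e :: real assume "e > 0"
    \<comment> \<open>Tightness is phrased with half-open intervals; this one contains
      \<open>{0..2*pi}\<close> because \<open>2 * pi < 7\<close>.\<close>
    have "measure (M N) {-1<..7} = 1" for N
    proof -
      interpret real_distribution "M N" by (rule rd)
      have pi: "2 * pi < 7" using pi_less_4 pi_approx by simp
      have "emeasure (M N) {-1<..7} = (\<integral>\<^sup>+x. ennreal (indicator {0..2*pi} x * fejer f N x) * indicator {-1<..7} x \<partial>lborel)"
        unfolding M_def by (rule emeasure_density) auto
      also have "\<dots> = (\<integral>\<^sup>+x. ennreal (indicator {0..2*pi} x * fejer f N x) * indicator UNIV x \<partial>lborel)"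
        using pi by (intro nn_integral_cong) (auto simp: indicator_def)
      also have "\<dots> = emeasure (M N) UNIV"
        unfolding M_def by (rule emeasure_density[symmetric]) auto
      finally show ?thesis using emeasure_space_1 by (simp add: measure_def)
    qed
    then show "\<exists>a b. a < b \<and> (\<forall>n. 1 - e < measure (M n) {a<..b})"
      using \<open>e > 0\<close> by - (rule exI[of _ "-1"], rule exI[of _ 7], simp)
  qed
  from tight_imp_convergent_subsubsequence[OF this strict_mono_id]
  obtain r L where r: "strict_mono r" "real_distribution L" "weak_conv_m (M \<circ> id \<circ> r) L" by blast
  have "(\<integral>x. cis (of_int k * x) \<partial>L) = cinner f (upow k f)" for k :: int
  proof -
    have cont: "isCont (\<lambda>x. cis (of_int k * x)) x" for x
      unfolding cis_conv_exp by (intro continuous_intros)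
    show ?thesis
    proof (rule LIMSEQ_unique)
      show "(\<lambda>n. \<integral>x. cis (of_int k * x) \<partial>M (r n)) \<longlonglongrightarrow> (\<integral>x. cis (of_int k * x) \<partial>L)"
        using weak_conv_imp_integral_bdd_continuous_conv[OF _ r(2,3), of "\<lambda>x. cis (of_int k * x)" 1] cont
        by (simp add: rd o_def)
      have "(\<lambda>N. of_nat (Suc N - nat \<bar>k\<bar>) / of_nat (Suc N) :: complex) \<longlonglongrightarrow> 1"
      proof -
        have "(\<lambda>N. complex_of_real (1 - real (nat \<bar>k\<bar>) / real (Suc N))) \<longlonglongrightarrow> of_real (1 - 0)"
          by (intro tendsto_intros real_tendsto_divide_at_top[OF tendsto_const] filterlim_real_sequentially
                filterlim_compose[OF filterlim_real_sequentially filterlim_Suc])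
        moreover have "eventually (\<lambda>N. complex_of_real (1 - real (nat \<bar>k\<bar>) / real (Suc N))
            = of_nat (Suc N - nat \<bar>k\<bar>) / of_nat (Suc N)) sequentially"
          using eventually_ge_at_top[of "nat \<bar>k\<bar>"]
        proof eventually_elim
          case (elim N)
          then have "1 - real (nat \<bar>k\<bar>) / real (Suc N) = real (Suc N - nat \<bar>k\<bar>) / real (Suc N)"
            by (simp add: of_nat_diff field_simps del: of_nat_Suc)
          then show ?case by (simp only: of_real_divide of_real_of_nat_eq)
        qed
        ultimately show ?thesis using Lim_transform_eventually by force
      qed
      then have "(\<lambda>N. of_nat (Suc N - nat \<bar>k\<bar>) / of_nat (Suc N) * cinner f (upow k f)) \<longlonglongrightarrow> 1 * cinner f (upow k f)"
        by (intro tendsto_intros)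
      from LIMSEQ_subseq_LIMSEQ[OF this r(1)]
      show "(\<lambda>n. \<integral>x. cis (of_int k * x) \<partial>M (r n)) \<longlonglongrightarrow> cinner f (upow k f)"
        by (simp add: o_def int)
    qed
  qed
  with r(2) show ?thesis by blast
qed

end

section \<open>The Cayley map between the line and the circle\<close>

definition cayley_fun :: "real \<Rightarrow> complex"
  where "cayley_fun x = (of_real x - \<i>) / (of_real x + \<i>)"

definition cayley_pow :: "int \<Rightarrow> real \<Rightarrow> complex"
  where "cayley_pow k x = cayley_fun x powi k"

lemma of_real_plus_i_neq_0 [simp]: "complex_of_real x + \<i> \<noteq> 0" "complex_of_real x - \<i> \<noteq> 0"
  by (auto simp: complex_eq_iff)

lemma cnj_cayley_fun: "cnj (cayley_fun x) = inverse (cayley_fun x)"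
  by (simp add: cayley_fun_def)

lemma cmod_cayley_fun [simp]: "cmod (cayley_fun x) = 1"
proof -
  have "cmod (complex_of_real x - \<i>) = cmod (complex_of_real x + \<i>)"
    by (simp add: cmod_def)
  then show ?thesis by (simp add: cayley_fun_def norm_divide)
qed

lemma cayley_fun_neq_0 [simp]: "cayley_fun x \<noteq> 0"
  by (metis cmod_cayley_fun norm_zero zero_neq_one)

lemma cayley_fun_mult: "cayley_fun x * (of_real x + \<i>) = of_real x - \<i>"
  by (simp add: cayley_fun_def)

lemma one_minus_cayley_fun: "1 - cayley_fun x = 2 * \<i> / (of_real x + \<i>)"
  by (simp add: eq_divide_eq left_diff_distrib cayley_fun_mult)

lemma one_plus_cayley_fun: "1 + cayley_fun x = 2 * of_real x / (of_real x + \<i>)"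
  by (simp add: eq_divide_eq distrib_right cayley_fun_mult)

lemma cayley_fun_inj: "cayley_fun x = cayley_fun y \<Longrightarrow> x = y"
proof -
  assume "cayley_fun x = cayley_fun y"
  then have "2 * \<i> / (complex_of_real x + \<i>) = 2 * \<i> / (complex_of_real y + \<i>)"
    by (metis one_minus_cayley_fun)
  then show "x = y" by (simp add: field_simps)
qed

lemma continuous_cayley_fun: "continuous_on A cayley_fun"
  unfolding cayley_fun_def[abs_def] by (intro continuous_intros) auto

lemma cmod_cayley_pow [simp]: "cmod (cayley_pow k x) = 1"
  by (simp add: cayley_pow_def norm_power_int)

lemma cayley_pow_add: "cayley_pow (j + k) x = cayley_pow j x * cayley_pow k x"
  by (simp add: cayley_pow_def power_int_add)

lemma cayley_pow_0: "cayley_pow 0 x = 1" and cayley_pow_1: "cayley_pow 1 x = cayley_fun x"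
  by (simp_all add: cayley_pow_def)

lemma cayley_pow_measurable [measurable]: "cayley_pow k \<in> borel_measurable borel"
  unfolding cayley_pow_def[abs_def]
  by (intro borel_measurable_continuous_onI continuous_intros continuous_cayley_fun) auto

lemma bounded_borel_cayley_pow: "bounded_borel (cayley_pow k)"
  by (rule bounded_borelI[where B = 1]) auto

lemma bounded_borel_cayley_fun: "bounded_borel cayley_fun"
  using bounded_borel_cayley_pow[of 1] by (simp add: cayley_pow_def[abs_def])

text \<open>Equals \<open>- cot (t / 2)\<close>, the inverse of \<open>cayley_fun\<close> along the
  circle. Where \<open>cis t = 1\<close>, division by zero gives the value 0; that set will turn out
  to be null.\<close>

definition angle_to_real :: "real \<Rightarrow> real"
  where "angle_to_real t = Re (\<i> * (1 + cis t) / (1 - cis t))"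

lemma angle_to_real_measurable [measurable]: "angle_to_real \<in> borel_measurable borel"
proof -
  have [measurable]: "cis \<in> borel_measurable borel"
    by (intro borel_measurable_continuous_onI continuous_intros)
  show ?thesis unfolding angle_to_real_def[abs_def] by measurable
qed

lemma cayley_fun_angle_to_real:
  assumes "cis t \<noteq> 1" shows "cayley_fun (angle_to_real t) = cis t"
proof -
  define z where "z = cis t"
  have z: "z \<noteq> 1" "z \<noteq> 0" "cnj z = inverse z" using assms by (auto simp: z_def cis_cnj cis_inverse)
  then have nz: "1 - z \<noteq> 0" "z - 1 \<noteq> 0" by auto
  define r where "r = \<i> * (1 + z) / (1 - z)"
  have "1 - inverse z \<noteq> 0" using z by (metis eq_iff_diff_eq_0 inverse_eq_1_iff)
  then have "cnj r = r" unfolding r_def using z nz by (simp add: divide_simps) (simp add: algebra_simps)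
  then have "complex_of_real (Re r) = r" by (simp add: complex_eq_iff)
  then have "cayley_fun (angle_to_real t) = (r - \<i>) / (r + \<i>)"
    by (simp add: cayley_fun_def angle_to_real_def r_def z_def)
  also have "r - \<i> = 2 * \<i> * z / (1 - z)" unfolding r_def using nz by (simp add: field_simps)
  also have "r + \<i> = 2 * \<i> / (1 - z)" unfolding r_def using nz by (simp add: field_simps)
  finally show ?thesis using nz by (simp add: z_def)
qed

text \<open>The powers span the trigonometric polynomials in \<open>cayley_fun\<close>.
  Stone-Weierstrass on the compact circle reaches continuous functions of \<open>cayley_fun\<close>,
  these reach indicators of compact intervals, and a Borel induction reaches the rest.\<close>

lemma bp_generating_cayley_pow: "bp_generating (range cayley_pow)"
  unfolding bp_generating_def
proof (intro allI impI)
  fix P and \<phi> :: "real \<Rightarrow> complex"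
  assume P: "bp_closed P" "\<forall>\<phi>\<in>range cayley_pow. P \<phi>" and \<phi>: "bounded_borel \<phi>"
  have lin: "P (\<lambda>x. \<phi> x + c * \<eta> x)" if "bounded_borel \<phi>" "bounded_borel \<eta>" "P \<phi>" "P \<eta>" for \<phi> \<eta> c
    using P(1) that unfolding bp_closed_def by blast
  have lim: "P \<phi>" if "\<And>n. bounded_borel (F n) \<and> P (F n)" "\<And>n x. cmod (F n x) \<le> B" "\<And>x. (\<lambda>n. F n x) \<longlonglongrightarrow> \<phi> x" for F \<phi> B
    using P(1) that bounded_borel_measurable unfolding bp_closed_def by blast
  have pow: "P (cayley_pow k)" for k using P(2) by auto
  \<comment> \<open>\<open>P\<close> alone is stable under linear combinations but not under
    products. \<open>Q\<close> asks for \<open>P\<close> after multiplication by every power, and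
    \<open>S\<close> collects the multipliers of \<open>Q\<close>, which form an algebra containing
    the powers; \<open>S_P\<close> returns to \<open>P\<close>.\<close>
  define Q where "Q \<phi> \<longleftrightarrow> bounded_borel \<phi> \<and> (\<forall>k. P (\<lambda>x. \<phi> x * cayley_pow k x))" for \<phi>
  define S where "S \<phi> \<longleftrightarrow> bounded_borel \<phi> \<and> (\<forall>\<eta>. Q \<eta> \<longrightarrow> Q (\<lambda>x. \<phi> x * \<eta> x))" for \<phi>
  have Q_lin: "Q (\<lambda>x. \<phi> x + c * \<eta> x)" if "Q \<phi>" "Q \<eta>" for \<phi> \<eta> c
  proof -
    have "P (\<lambda>x. \<phi> x * cayley_pow k x + c * (\<eta> x * cayley_pow k x))" for k
      using that by (intro lin bounded_borel_mult bounded_borel_cayley_pow) (auto simp: Q_def)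
    then show ?thesis using that by (simp add: Q_def bounded_borel_add_cmult algebra_simps)
  qed
  have S_lin: "S (\<lambda>x. \<phi> x + c * \<eta> x)" if "S \<phi>" "S \<eta>" for \<phi> \<eta> c
  proof -
    have "Q (\<lambda>x. \<phi> x * \<theta> x + c * (\<eta> x * \<theta> x))" if "Q \<theta>" for \<theta>
      using \<open>S \<phi>\<close> \<open>S \<eta>\<close> that by (intro Q_lin) (auto simp: S_def)
    then show ?thesis using that by (simp add: S_def bounded_borel_add_cmult algebra_simps)
  qed
  have S_pow: "S (cayley_pow j)" for j
    unfolding S_def Q_def
  proof (intro conjI allI impI bounded_borel_cayley_pow bounded_borel_mult; (elim conjE)?)
    fix \<eta> k assume "\<forall>k. P (\<lambda>x. \<eta> x * cayley_pow k x)"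
    then have "P (\<lambda>x. \<eta> x * cayley_pow (j + k) x)" by blast
    then show "P (\<lambda>x. cayley_pow j x * \<eta> x * cayley_pow k x)" by (simp add: cayley_pow_add mult_ac)
  qed
  have S_mult: "S (\<lambda>x. \<phi> x * \<eta> x)" if "S \<phi>" "S \<eta>" for \<phi> \<eta>
    using that unfolding S_def by (simp add: bounded_borel_mult mult.assoc)
  have S_scale: "S (\<lambda>x. c * \<eta> x)" if "S \<eta>" for c \<eta>
    using S_lin[OF that that, of "c - 1"] by (simp add: algebra_simps)
  have Q1: "Q (\<lambda>_. 1)" unfolding Q_def by (simp add: pow bounded_borel_const)
  have S_P: "bounded_borel \<phi> \<and> P \<phi>" if "S \<phi>" for \<phi>
  proof -
    from that Q1 have "Q \<phi>" unfolding S_def by fastforce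
    then have "P (\<lambda>x. \<phi> x * cayley_pow 0 x)" "bounded_borel \<phi>" unfolding Q_def by blast+
    then show ?thesis by (simp add: cayley_pow_0)
  qed
  have S_Re: "S (\<lambda>x. complex_of_real (Re (cayley_fun x)))"
    and S_Im: "S (\<lambda>x. complex_of_real (Im (cayley_fun x)))"
  proof -
    have c: "cayley_pow (-1) x = cnj (cayley_fun x)" for x
      by (simp add: cayley_pow_def cnj_cayley_fun power_int_minus)
    have "complex_of_real (Re (cayley_fun x)) = (1/2) * (cayley_pow 1 x + 1 * cayley_pow (-1) x)"
      and "complex_of_real (Im (cayley_fun x)) = (1/(2*\<i>)) * (cayley_pow 1 x + (-1) * cayley_pow (-1) x)" for x
      unfolding c cayley_pow_1 by (simp_all add: complex_eq_iff)
    then show "S (\<lambda>x. complex_of_real (Re (cayley_fun x)))" "S (\<lambda>x. complex_of_real (Im (cayley_fun x)))"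
      by (simp_all only:) (intro S_scale S_lin S_pow)+
  qed
  have S_poly: "S (\<lambda>x. complex_of_real (p (cayley_fun x)))" if "real_polynomial_function p" for p :: "complex \<Rightarrow> real"
    using that
  proof induction
    case (linear h)
    have "h z = Re z * h 1 + Im z * h \<i>" for z
    proof -
      have "z = Re z *\<^sub>R 1 + Im z *\<^sub>R \<i>" by (simp add: complex_eq_iff)
      then have "h z = h (Re z *\<^sub>R 1 + Im z *\<^sub>R \<i>)" by simp
      also have "\<dots> = Re z * h 1 + Im z * h \<i>"
        by (simp add: bounded_linear.linear[OF linear] linear_add linear_scale)
      finally show ?thesis .
    qed
    then have "(\<lambda>x. complex_of_real (h (cayley_fun x)))
        = (\<lambda>x. complex_of_real (h 1) * complex_of_real (Re (cayley_fun x)) + complex_of_real (h \<i>) * complex_of_real (Im (cayley_fun x)))"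
      by (metis (no_types, opaque_lifting) mult.commute of_real_add of_real_mult)
    then show ?case using S_lin[OF S_scale[OF S_Re] S_Im] by simp
  next
    case (const c)
    show ?case using S_scale[OF S_pow[of 0], of "complex_of_real c"] by (simp add: cayley_pow_0)
  next
    case (add f g) then show ?case using S_lin[of _ _ 1] by fastforce
  next
    case (mult f g) then show ?case using S_mult by fastforce
  qed
  have cont: "bounded_borel (\<lambda>x. complex_of_real (f (cayley_fun x))) \<and> P (\<lambda>x. complex_of_real (f (cayley_fun x)))"
    if f: "continuous_on (sphere 0 1) f" for f :: "complex \<Rightarrow> real"
  proof -
    have "\<exists>p. real_polynomial_function p \<and> (\<forall>z\<in>sphere 0 1. \<bar>f z - p z\<bar> < 1 / Suc n)" for n
      by (rule Stone_Weierstrass_real_polynomial_function[OF compact_sphere f, of "1 / Suc n"]) (simp, blast)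
    then obtain p where p: "\<And>n. real_polynomial_function (p n)"
        "\<And>n z. z \<in> sphere 0 1 \<Longrightarrow> \<bar>f z - p n z\<bar> < 1 / Suc n" by metis
    have p': "\<bar>f (cayley_fun x) - p n (cayley_fun x)\<bar> < 1 / Suc n" for n x using p(2)[of "cayley_fun x"] by simp
    have "bounded (f ` sphere 0 1)" by (intro compact_imp_bounded compact_continuous_image f compact_sphere)
    then obtain B where "\<forall>y\<in>f ` sphere 0 1. norm y \<le> B" unfolding bounded_iff by blast
    then have B: "\<bar>f (cayley_fun x)\<bar> \<le> B" for x by simp
    have "P (\<lambda>x. complex_of_real (f (cayley_fun x)))"
    proof (rule lim)
      show "bounded_borel (\<lambda>x. complex_of_real (p n (cayley_fun x))) \<and> P (\<lambda>x. complex_of_real (p n (cayley_fun x)))" for n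
        using S_P[OF S_poly[OF p(1)]] .
      show "cmod (complex_of_real (p n (cayley_fun x))) \<le> B + 1" for n x
      proof -
        have "1 / real (Suc n) \<le> 1" by simp
        then show ?thesis using p'[of x n] B[of x] unfolding norm_of_real by linarith
      qed
      show "(\<lambda>n. complex_of_real (p n (cayley_fun x))) \<longlonglongrightarrow> complex_of_real (f (cayley_fun x))" for x
      proof (intro tendsto_of_real LIMSEQ_I)
        fix r :: real assume "r > 0"
        then obtain N where N: "1 / real (Suc N) < r" using nat_approx_posE by blast
        have "norm (p n (cayley_fun x) - f (cayley_fun x)) < r" if "n \<ge> N" for n
        proof -
          have "1 / real (Suc n) \<le> 1 / real (Suc N)" using that by (simp add: frac_le)
          then show ?thesis using p'[of x n] N by (simp only: real_norm_def abs_minus_commute)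
        qed
        then show "\<exists>no. \<forall>n\<ge>no. norm (p n (cayley_fun x) - f (cayley_fun x)) < r" by blast
      qed
    qed
    moreover have "f \<circ> cayley_fun \<in> borel_measurable borel"
      by (intro borel_measurable_continuous_onI continuous_on_compose continuous_cayley_fun
          continuous_on_subset[OF f]) auto
    then have "bounded_borel (\<lambda>x. complex_of_real (f (cayley_fun x)))"
      by (intro bounded_borel_of_real[OF _ B]) (simp add: o_def)
    ultimately show ?thesis by simp
  qed
  have one: "P (\<lambda>_. 1)" using pow[of 0] by (simp add: cayley_pow_def[abs_def])
  have ind: "P (indicator A)" if "A \<in> sets borel" for A :: "real set"
    using that
  proof (induction A rule: borel_set_induct)
    case empty
    show ?case using lin[OF bounded_borel_const bounded_borel_const one one, of "-1"] by (simp add: indicator_def[abs_def])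
  next
    case (interval a b)
    \<comment> \<open>The image of a compact interval is compact in the circle, and by injectivity
      its preimage is the interval again. Hence the tent functions \<open>F n\<close> of the
      distance to \<open>K\<close> are continuous on the circle and decrease to the
      indicator.\<close>
    define K where "K = cayley_fun ` {a..b}"
    have K: "closed K" "K \<noteq> {}" unfolding K_def using interval
      by (auto intro!: compact_imp_closed compact_continuous_image continuous_cayley_fun)
    have K_iff: "cayley_fun x \<in> K \<longleftrightarrow> x \<in> {a..b}" for x unfolding K_def by (auto dest: cayley_fun_inj)
    define F where "F n z = max 0 (1 - real n * infdist z K)" for n z
    show ?case
    proof (rule lim)
      show "bounded_borel (\<lambda>x. complex_of_real (F n (cayley_fun x))) \<and> P (\<lambda>x. complex_of_real (F n (cayley_fun x)))" for n
        by (rule cont) (unfold F_def, intro continuous_intros)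
      show "cmod (complex_of_real (F n (cayley_fun x))) \<le> 1" for n x
        by (simp add: F_def infdist_nonneg)
      show "(\<lambda>n. complex_of_real (F n (cayley_fun x))) \<longlonglongrightarrow> indicator {a..b} x" for x
      proof (cases "x \<in> {a..b}")
        case True
        then have "infdist (cayley_fun x) K = 0" using K_iff by simp
        then show ?thesis using True by (simp add: F_def)
      next
        case False
        then have d: "infdist (cayley_fun x) K > 0" using K K_iff infdist_pos_not_in_closed by blast
        obtain N :: nat where N: "1 / infdist (cayley_fun x) K \<le> real N" using real_arch_simple by blast
        have "F n (cayley_fun x) = 0" if "n \<ge> N" for n
        proof -
          have "1 / infdist (cayley_fun x) K \<le> real n" using N that by linarith
          then have "1 \<le> real n * infdist (cayley_fun x) K" using d by (simp add: field_simps)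
          then show ?thesis by (simp add: F_def)
        qed
        then have "eventually (\<lambda>n. complex_of_real (F n (cayley_fun x)) = indicator {a..b} x) sequentially"
          using False by (auto simp: eventually_sequentially indicator_def intro!: exI[of _ N])
        then show ?thesis by (rule tendsto_eventually)
      qed
    qed
  next
    case (compl A)
    have "P (\<lambda>x. 1 + (-1) * indicator A x)"
      using compl by (intro lin bounded_borel_const bounded_borel_indicator one) auto
    moreover have "(\<lambda>x. 1 + (-1) * indicator A x) = (indicator (- A) :: real \<Rightarrow> complex)"
      by (auto simp: indicator_def)
    ultimately show ?case by simp
  next
    case (union A)
    have fin: "bounded_borel (indicator (\<Union>i<n. A i)) \<and> P (indicator (\<Union>i<n. A i))" for n
    proof (induction n)
      case 0
      show ?case using lin[OF bounded_borel_const bounded_borel_const one one, of "-1"] bounded_borel_const[of 0]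
        by (simp add: indicator_def[abs_def])
    next
      case (Suc n)
      have "A n \<inter> A i = {}" if "i < n" for i
        by (rule disjoint_family_onD[OF \<open>disjoint_family A\<close>]) (use that in auto)
      then have "indicator (\<Union>i<Suc n. A i) = (\<lambda>x. indicator (\<Union>i<n. A i) x + 1 * indicator (A n) x :: complex)"
        unfolding lessThan_Suc by (auto simp: indicator_def fun_eq_iff)
      then show ?case using Suc union lin[of "indicator (\<Union>i<n. A i)" "indicator (A n)" 1]
        bounded_borel_add_cmult[of "indicator (\<Union>i<n. A i)" "indicator (A n)" 1] bounded_borel_indicator by simp
    qed
    show ?case
    proof (rule lim[OF fin])
      show "cmod (indicator (\<Union>i<n. A i) x) \<le> 1" for n x by (simp add: indicator_def)
      show "(\<lambda>n. indicator (\<Union>i<n. A i) x) \<longlonglongrightarrow> (indicator (\<Union>i. A i) x :: complex)" for x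
        by (rule LIMSEQ_indicator_UN)
    qed
  qed
  from bp_generating_indicators P(1) ind \<phi> show "P \<phi>" unfolding bp_generating_def by blast
qed

text \<open>Density of the range of \<open>1 - U\<close> excludes the eigenvalue 1, the one point of
  the circle that \<open>cayley_fun\<close> misses.\<close>

locale cayley_unitary = unitary_operator +
  assumes range_dense: "e > 0 \<Longrightarrow> \<exists>y. norm (x - (y - U y)) < e"
begin

lemma sum_upow_clinear:
  "(\<Sum>k<N. upow (int k) (x + y)) = (\<Sum>k<N. upow (int k) x) + (\<Sum>k<N. upow (int k) y)"
  by (simp add: clinearD(3)[OF clinear_upow] sum.distrib)

text \<open>Von Neumann's mean ergodic theorem without invariant vectors: sums telescope on the
  range of \<open>1 - U\<close>, and the rest is small by density.\<close>

lemma mean_ergodic: "(\<lambda>N. norm (\<Sum>k<Suc N. upow (int k) f) / real (Suc N)) \<longlonglongrightarrow> 0"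
proof (rule LIMSEQ_I)
  fix e :: real assume e: "e > 0"
  obtain y where y: "norm (f - (y - U y)) < e / 2" using range_dense[of "e/2" f] e by auto
  \<comment> \<open>Makes the telescoped remainder, at most \<open>2 * norm y\<close>, smaller than
    half of \<open>Suc N * e\<close>.\<close>
  obtain N0 where N0: "4 * norm y / e < real (Suc N0)" using reals_Archimedean2 by (metis less_Suc_eq of_nat_less_iff order.strict_trans)
  have "norm (norm (\<Sum>k<Suc N. upow (int k) f) / real (Suc N) - 0) < e" if N: "N \<ge> N0" for N
  proof -
    have tel: "(\<Sum>k<M. upow (int k) (y - U y)) = y - upow (int M) y" for M
    proof (induction M)
      case (Suc M)
      have "upow (int M) (U y) = upow (int M + 1) y" using upow_add[of "int M" 1 y] by (simp add: upow_1)
      then show ?case using Suc by (simp add: clinearD(4)[OF clinear_upow] add.commute)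
    qed (simp add: upow_0)
    have "(\<Sum>k<Suc N. upow (int k) f) = (\<Sum>k<Suc N. upow (int k) ((f - (y - U y)) + (y - U y)))" by simp
    also have "\<dots> = (\<Sum>k<Suc N. upow (int k) (f - (y - U y))) + (y - upow (int (Suc N)) y)"
      unfolding sum_upow_clinear tel ..
    finally have "norm (\<Sum>k<Suc N. upow (int k) f)
        \<le> norm (\<Sum>k<Suc N. upow (int k) (f - (y - U y))) + norm (y - upow (int (Suc N)) y)"
      by (metis norm_triangle_ineq)
    also have "norm (\<Sum>k<Suc N. upow (int k) (f - (y - U y))) \<le> (\<Sum>k<Suc N. e / 2)"
      by (rule sum_norm_le) (use y in \<open>simp add: norm_upow\<close>)
    also have "norm (y - upow (int (Suc N)) y) \<le> 2 * norm y"
      using norm_triangle_ineq4[of y "upow (int (Suc N)) y"] by (simp add: norm_upow)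
    finally have "norm (\<Sum>k<Suc N. upow (int k) f) \<le> real (Suc N) * (e / 2) + 2 * norm y" by simp
    moreover have "real (Suc N0) \<le> real (Suc N)" using N by simp
    then have "4 * norm y / e < real (Suc N)" using N0 by linarith
    then have "2 * norm y < real (Suc N) * (e / 2)" using e by (simp add: field_simps)
    ultimately have "norm (\<Sum>k<Suc N. upow (int k) f) < real (Suc N) * e" by linarith
    then show ?thesis by (simp add: field_simps)
  qed
  then show "\<exists>no. \<forall>n\<ge>no. norm (norm (\<Sum>k<Suc n. upow (int k) f) / real (Suc n) - 0) < e" by blast
qed

text \<open>The Herglotz measure on angles is pushed forward to the line. The only obstruction is
  mass on angles with \<open>cis t = 1\<close>, and ergodic averages show that there is
  none.\<close>

lemma scalar_spectral_measure_unit: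
  assumes f: "norm f = 1"
  shows "\<exists>M. finite_borel M \<and> (\<forall>k. (\<integral>x. cayley_pow k x \<partial>M) = cinner f (upow k f))"
proof -
  obtain M where M: "real_distribution M" and int: "\<And>k::int. (\<integral>x. cis (of_int k * x) \<partial>M) = cinner f (upow k f)"
    using herglotz[OF f] by blast
  interpret real_distribution M by (rule M)
  have [measurable]: "cis \<in> borel_measurable borel"
    by (intro borel_measurable_continuous_onI continuous_intros)
  have cis_m [measurable]: "(\<lambda>x. cis (r * x)) \<in> borel_measurable borel" for r
    by (intro borel_measurable_continuous_onI continuous_intros)
  have fM: "finite_borel M" by (simp add: finite_borel_def finite_measure_axioms)
  define Z where "Z = {t. cis t = 1}"
  have Z [measurable]: "Z \<in> sets borel"
    unfolding Z_def by measurable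
  \<comment> \<open>Both sides expand into the same double sum, since the moments of
    \<open>M\<close> are the matrix elements of the powers of \<open>U\<close>.\<close>
  have sq: "(\<integral>x. (cmod (\<Sum>k<N. cis (of_int (int k) * x)))\<^sup>2 \<partial>M) = (norm (\<Sum>k<N. upow (int k) f))\<^sup>2" for N
  proof -
    have ci: "integrable M (\<lambda>x. cis (of_int j * x))" for j :: int
      by (rule finite_borel_integrable[OF fM cis_m, of _ 1]) simp
    have eq: "complex_of_real ((cmod (\<Sum>k<N. cis (of_int (int k) * x)))\<^sup>2)
        = (\<Sum>k<N. \<Sum>l<N. cis (of_int (int k - int l) * x))" for x
      unfolding complex_norm_square cnj_sum sum_product
      by (simp add: cis_cnj cis_mult algebra_simps)
    have "complex_of_real (\<integral>x. (cmod (\<Sum>k<N. cis (of_int (int k) * x)))\<^sup>2 \<partial>M)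
        = (\<Sum>k<N. \<Sum>l<N. cinner f (upow (int k - int l) f))"
      unfolding integral_complex_of_real[symmetric] eq
      by (simp only: Bochner_Integration.integral_sum Bochner_Integration.integrable_sum ci int)
    also have "\<dots> = complex_of_real ((norm (\<Sum>k<N. upow (int k) f))\<^sup>2)"
      unfolding norm_sum_square by (subst sum.swap) (simp add: cinner_upow_upow)
    finally show ?thesis by (simp only: of_real_eq_iff)
  qed
  \<comment> \<open>On \<open>Z\<close> all the exponentials equal 1, so the squared modulus of
    their sum is \<open>(Suc N)^2\<close> there; its integral is computed in
    \<open>sq\<close>.\<close>
  have Z_le: "measure M Z \<le> (norm (\<Sum>k<Suc N. upow (int k) f) / real (Suc N))\<^sup>2" for N
  proof -
    have "real (Suc N) ^ 2 * measure M Z = (\<integral>x. real (Suc N) ^ 2 * indicator Z x \<partial>M)" by simp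
    also have "\<dots> \<le> (\<integral>x. (cmod (\<Sum>k<Suc N. cis (of_int (int k) * x)))\<^sup>2 \<partial>M)"
    proof (rule integral_mono)
      show "integrable M (\<lambda>x. (real (Suc N))\<^sup>2 * indicator Z x)"
        by (rule finite_borel_integrable[OF fM, of _ "(real (Suc N))\<^sup>2"]) (auto simp: indicator_def)
      have "cmod (\<Sum>k<Suc N. cis (of_int (int k) * x)) \<le> real (Suc N)" for x
        using sum_norm_le[of "{..<Suc N}" "\<lambda>k. cis (of_int (int k) * x)" "\<lambda>_. 1"] by simp
      then show "integrable M (\<lambda>x. (cmod (\<Sum>k<Suc N. cis (of_int (int k) * x)))\<^sup>2)"
        by (intro finite_borel_integrable[OF fM, of _ "(real (Suc N))\<^sup>2"]) (auto simp del: sum.lessThan_Suc intro!: power_mono)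
      show "(real (Suc N))\<^sup>2 * indicator Z x \<le> (cmod (\<Sum>k<Suc N. cis (of_int (int k) * x)))\<^sup>2" for x
      proof (cases "x \<in> Z")
        case True
        then have "cis (of_int (int k) * x) = 1" for k
          using cis_power_int[of x "int k"] by (simp add: Z_def)
        then have "(\<Sum>k<Suc N. cis (of_int (int k) * x)) = of_nat (Suc N)" by simp
        then have "cmod (\<Sum>k<Suc N. cis (of_int (int k) * x)) = real (Suc N)" by (simp only: norm_of_nat)
        then show ?thesis using True by (simp only:) simp
      qed simp
    qed
    finally show ?thesis unfolding sq power_divide by (simp add: field_simps del: of_nat_Suc)
  qed
  have "(\<lambda>N. (norm (\<Sum>k<Suc N. upow (int k) f) / real (Suc N))\<^sup>2) \<longlonglongrightarrow> 0\<^sup>2"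
    by (intro tendsto_power mean_ergodic)
  then have "measure M Z \<le> 0\<^sup>2" by (rule LIMSEQ_le_const) (use Z_le in blast)
  then have "measure M Z = 0" using measure_nonneg[of M Z] by simp
  then have "Z \<in> null_sets M" by (simp add: emeasure_eq_measure null_sets_def)
  then have AE: "AE t in M. cis t \<noteq> 1" using AE_not_in[of Z M] by (simp add: Z_def)
  define N where "N = distr M borel angle_to_real"
  have "finite_borel N" unfolding N_def finite_borel_def using finite_measure_distr[of angle_to_real borel] by simp
  moreover have "(\<integral>x. cayley_pow k x \<partial>N) = cinner f (upow k f)" for k
  proof -
    have "(\<integral>x. cayley_pow k x \<partial>N) = (\<integral>t. cayley_pow k (angle_to_real t) \<partial>M)"
      unfolding N_def by (rule integral_distr) auto
    also have "\<dots> = (\<integral>t. cis (of_int k * t) \<partial>M)"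
      by (rule integral_cong_AE; measurable?) (use AE in \<open>auto simp: cayley_pow_def cayley_fun_angle_to_real cis_power_int\<close>)
    finally show ?thesis by (simp add: int)
  qed
  ultimately show ?thesis by blast
qed

lemma scalar_spectral_measure_exists:
  "\<exists>M. finite_borel M \<and> (\<forall>k. (\<integral>x. cayley_pow k x \<partial>M) = cinner f (upow k f))"
proof (cases "f = 0")
  case True
  have "finite_borel (null_measure borel)" unfolding finite_borel_def by (auto intro!: finite_measureI)
  moreover have "(\<integral>x. cayley_pow k x \<partial>null_measure borel) = cinner f (upow k f)" for k
    using True by simp
  ultimately show ?thesis by blast
next
  case False
  define g where "g = complex_of_real (inverse (norm f)) *\<^sub>C f"
  have "norm g = 1" using False unfolding g_def scaleC_of_real by simp
  from scalar_spectral_measure_unit[OF this] obtain M where M: "finite_borel M"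
    "\<And>k. (\<integral>x. cayley_pow k x \<partial>M) = cinner g (upow k g)" by blast
  define N where "N = density M (\<lambda>_. ennreal ((norm f)\<^sup>2))"
  have m: "cayley_pow k \<in> borel_measurable M" for k using M(1) by (simp add: finite_borel_sets cong: measurable_cong_sets)
  have "finite_measure N"
    using finite_measure.emeasure_finite[OF finite_borel_finite[OF M(1)], of UNIV]
    by (intro finite_measureI) (simp add: N_def emeasure_density_const finite_borel_space[OF M(1)] finite_borel_sets[OF M(1)] ennreal_mult_eq_top_iff)
  then have "finite_borel N" using M(1) by (simp add: finite_borel_def N_def)
  moreover have "(\<integral>x. cayley_pow k x \<partial>N) = cinner f (upow k f)" for k
  proof -
    have "(\<integral>x. cayley_pow k x \<partial>N) = (\<integral>x. (norm f)\<^sup>2 *\<^sub>R cayley_pow k x \<partial>M)"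
      unfolding N_def by (intro integral_density m) auto
    also have "\<dots> = of_real ((norm f)\<^sup>2) * cinner g (upow k g)"
      unfolding M(2)[symmetric] by (simp add: scaleR_conv_of_real)
    also have "\<dots> = cinner (complex_of_real (norm f) *\<^sub>C g) (upow k (complex_of_real (norm f) *\<^sub>C g))"
      by (simp add: clinearD(5)[OF clinear_upow] cinner_simps power2_eq_square)
    also have "complex_of_real (norm f) *\<^sub>C g = f" using False by (simp add: g_def)
    finally show ?thesis .
  qed
  ultimately show ?thesis by blast
qed

definition mu :: "'a l2 \<Rightarrow> real measure" where
  "mu f = (SOME M. finite_borel M \<and> (\<forall>k. (\<integral>x. cayley_pow k x \<partial>M) = cinner f (upow k f)))"

definition T_gen :: "(real \<Rightarrow> complex) \<Rightarrow> 'a l2 \<Rightarrow> 'a l2"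
  where "T_gen \<gamma> = upow (SOME k. \<gamma> = cayley_pow k)"

lemma mu: "finite_borel (mu f)" "(\<integral>x. cayley_pow k x \<partial>mu f) = cinner f (upow k f)"
  using someI_ex[OF scalar_spectral_measure_exists[of f]] unfolding mu_def by auto

text \<open>The exponent chosen in \<open>T_gen\<close> must not matter: integrals against
  \<open>mu\<close> determine the quadratic form of \<open>upow k\<close>, hence by polarization the
  operator itself.\<close>

lemma T_gen: "T_gen (cayley_pow k) f = upow k f"
proof -
  define j where "j = (SOME j. cayley_pow k = cayley_pow j)"
  have j: "cayley_pow k = cayley_pow j" unfolding j_def by (rule someI[of _ k]) simp
  have "cinner g (upow j f) = cinner g (upow k f)" for g f
    by (rule sesquilinear_diag_eqI[OF sesquilinear_cinner[OF clinear_id clinear_upow] sesquilinear_cinner[OF clinear_id clinear_upow]])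
      (simp add: mu(2)[symmetric] j)
  then have "upow j f = upow k f" by (rule eq_if_cinner_eq)
  then show ?thesis by (simp add: T_gen_def j_def)
qed

sublocale spectral_family mu "range cayley_pow" T_gen
proof
  show "(\<lambda>_. 1) \<in> range cayley_pow" by (rule range_eqI[of _ _ 0]) (simp add: cayley_pow_def[abs_def])
  have "(\<lambda>_. 1) = cayley_pow 0" by (simp add: cayley_pow_def[abs_def])
  then show "T_gen (\<lambda>_. 1) f = f" for f by (simp only: T_gen upow_0)
  fix \<gamma> assume "\<gamma> \<in> range cayley_pow"
  then obtain k where k: "\<gamma> = cayley_pow k" by blast
  show "clinear (T_gen \<gamma>)" unfolding k clinear_def T_gen by (simp add: clinearD[OF clinear_upow])
  show "cinner f (T_gen \<gamma> f) = (\<integral>x. \<gamma> x \<partial>mu f)" for f by (simp add: k T_gen mu)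
  show "bounded_borel \<gamma>" by (simp add: k bounded_borel_cayley_pow)
  fix \<gamma>' assume "\<gamma>' \<in> range cayley_pow"
  then obtain l where l: "\<gamma>' = cayley_pow l" by blast
  have eq: "(\<lambda>x. \<gamma> x * \<gamma>' x) = cayley_pow (k + l)" by (simp add: k l cayley_pow_add[abs_def])
  show "(\<lambda>x. \<gamma> x * \<gamma>' x) \<in> range cayley_pow" unfolding eq by simp
  show "T_gen (\<lambda>x. \<gamma> x * \<gamma>' x) f = T_gen \<gamma> (T_gen \<gamma>' f)" for f
    unfolding eq unfolding k l T_gen by (rule upow_add)
qed (simp_all add: mu bp_generating_cayley_pow)

lemma op_cayley_fun: "op cayley_fun f = U f"
proof -
  have "cayley_pow 1 = cayley_fun" by (rule ext) (rule cayley_pow_1)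
  then show ?thesis using op_gen[OF rangeI, of 1 f] T_gen[of 1 f] by (simp add: upow_1)
qed

end

section \<open>The spectral theorem\<close>

lemma vec_add_scaleC: "f \<in> ell2 \<Longrightarrow> g \<in> ell2 \<Longrightarrow> vec (\<lambda>x. f x + c * g x) = vec f + c *\<^sub>C vec g"
  by (rule l2_eqI) (simp add: coord_simps vec_inverse ell2_add_cmult)

lemma coord_sum: "coord (\<Sum>i\<in>A. v i) = (\<lambda>n. \<Sum>i\<in>A. coord (v i) n)"
  by (induction A rule: infinite_finite_induct) (simp_all add: coord_simps)

lemma ell2_subspace_ell2: "ell2_subspace ell2"
  by (simp add: ell2_subspace_def ell2_zero ell2_add_cmult)

section \<open>The projection-valued measure of a spectral family\<close>

context spectral_family begin

lemma op_indicator_empty: "op (indicator {}) f = 0"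
proof -
  have "(norm (op (indicator {}) f))\<^sup>2 = 0" using measure_eq_norm_op[of "{}" f] by simp
  then show ?thesis by simp
qed

lemma op_0: "op (\<lambda>_. 0) f = 0"
  using op_indicator_empty[of f] by (simp add: indicator_def[abs_def])

lemma op_1: "op (\<lambda>_. 1) f = f"
  by (simp add: op_gen gen_1 T_1)

lemma op_indicator_UNIV: "op (indicator UNIV) f = f"
  using op_1 by (simp add: indicator_def[abs_def])

lemma op_indicator_Int:
  assumes "S \<in> sets borel" "S' \<in> sets borel"
  shows "op (indicator (S \<inter> S')) f = op (indicator S) (op (indicator S') f)"
  using op_mult[OF bounded_borel_indicator[OF assms(1)] bounded_borel_indicator[OF assms(2)], of f]
  by (simp add: indicator_inter_arith[abs_def])

lemma op_indicator_sums:
  assumes "range B \<subseteq> sets borel" "disjoint_family B"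
  shows "(\<lambda>N. \<Sum>i<N. op (indicator (B i)) f) \<longlonglongrightarrow> op (indicator (\<Union>i. B i)) f"
proof -
  have B: "B i \<in> sets borel" for i using assms by auto
  have "op (indicator (\<Union>i<N. B i)) f = (\<Sum>i<N. op (indicator (B i)) f)" for N
  proof (induction N)
    case (Suc N)
    have "B N \<inter> B i = {}" if "i < N" for i
      by (rule disjoint_family_onD[OF assms(2)]) (use that in auto)
    then have *: "indicator (\<Union>i<Suc N. B i) = (\<lambda>x. indicator (\<Union>i<N. B i) x + 1 * indicator (B N) x :: complex)"
      unfolding lessThan_Suc by (auto simp: indicator_def fun_eq_iff)
    have "op (indicator (\<Union>i<Suc N. B i)) f = op (indicator (\<Union>i<N. B i)) f + 1 *\<^sub>C op (indicator (B N)) f"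
      unfolding * by (intro op_add_cmult bounded_borel_indicator) (use B in auto)
    then show ?case by (simp add: Suc)
  qed (simp add: op_0)
  moreover have "(\<lambda>N. op (indicator (\<Union>i<N. B i)) f) \<longlonglongrightarrow> op (indicator (\<Union>i. B i)) f"
  proof (rule op_tendsto[where B = 1])
    show "indicator (\<Union>i<N. B i) \<in> borel_measurable borel" for N
      using B by (intro borel_measurable_indicator sets.finite_UN) auto
    show "cmod (indicator (\<Union>i<N. B i) x) \<le> 1" for N x by (simp add: indicator_def)
    show "(\<lambda>N. indicator (\<Union>i<N. B i) x) \<longlonglongrightarrow> (indicator (\<Union>i. B i) x :: complex)" for x
      by (rule LIMSEQ_indicator_UN)
  qed
  ultimately show ?thesis by simp
qed

definition pvm :: "real set \<Rightarrow> ('a \<Rightarrow> complex) \<Rightarrow> 'a \<Rightarrow> complex"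
  where "pvm S g = coord (op (indicator S) (vec g))"

lemma is_orth_projection_pvm:
  assumes S: "S \<in> sets borel" shows "is_orth_projection (pvm S)"
  unfolding is_orth_projection_def linear_operator_on_def
proof (intro conjI ballI allI ell2_subspace_ell2)
  fix f g :: "'a \<Rightarrow> complex" and c assume f: "f \<in> ell2" and g: "g \<in> ell2"
  show "pvm S (\<lambda>x. f x + c * g x) = (\<lambda>x. pvm S f x + c * pvm S g x)"
    using clinearD(1)[OF clinear_op[OF bounded_borel_indicator[OF S]]] f g
    by (simp add: pvm_def vec_add_scaleC coord_simps)
  have "cnj (indicator S x) = (indicator S x :: complex)" for x by (simp add: indicator_def)
  then show "ell2_inner (pvm S f) g = ell2_inner f (pvm S g)"
    using op_adjoint[OF bounded_borel_indicator[OF S], of "vec f" "vec g"] f g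
    by (simp add: cinner_def pvm_def vec_inverse)
next
  fix f :: "'a \<Rightarrow> complex" assume f: "f \<in> ell2"
  show "pvm S f \<in> ell2" by (simp add: pvm_def)
  show "pvm S (pvm S f) = pvm S f"
    using op_indicator_Int[OF S S] by (simp add: pvm_def coord_inverse)
qed

lemma projection_valued_measure_pvm: "projection_valued_measure pvm"
  unfolding projection_valued_measure_def
proof (intro conjI ballI allI impI is_orth_projection_pvm)
  fix f :: "'a \<Rightarrow> complex" assume f: "f \<in> ell2"
  show "pvm {} f = (\<lambda>_. 0)" unfolding pvm_def op_indicator_empty coord_zero by (rule refl)
  show "pvm UNIV f = f" using f unfolding pvm_def op_indicator_UNIV by (rule vec_inverse)
  show "pvm (S \<inter> S') f = pvm S (pvm S' f)" if "S \<in> sets borel" "S' \<in> sets borel" for S S'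
    using that by (simp add: pvm_def op_indicator_Int coord_inverse)
  fix B :: "nat \<Rightarrow> real set" assume B: "range B \<subseteq> sets borel" "disjoint_family B"
  have "(\<lambda>N. op (indicator (\<Union>i. B i)) (vec f) - (\<Sum>i<N. op (indicator (B i)) (vec f))) \<longlonglongrightarrow>
      op (indicator (\<Union>i. B i)) (vec f) - op (indicator (\<Union>i. B i)) (vec f)"
    by (intro tendsto_diff tendsto_const op_indicator_sums B)
  then have "(\<lambda>N. norm (op (indicator (\<Union>i. B i)) (vec f) - (\<Sum>i<N. op (indicator (B i)) (vec f)))) \<longlonglongrightarrow> 0"
    by (simp add: tendsto_norm_zero)
  then show "(\<lambda>N. ell2_norm (\<lambda>x. pvm (\<Union>i. B i) f x - (\<Sum>i<N. pvm (B i) f x))) \<longlonglongrightarrow> 0"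
    by (simp add: norm_eq_ell2_norm coord_simps coord_sum pvm_def)
qed

lemma emeasure_eq_cinner_op:
  assumes "S \<in> sets borel" shows "emeasure (\<mu> f) S = ennreal (Re (cinner f (op (indicator S) f)))"
proof -
  interpret finite_measure "\<mu> f" by (rule finite_borel_finite[OF \<mu>])
  have "cinner f (op (indicator S) f) = (\<integral>x. indicator S x \<partial>\<mu> f)"
    by (rule cinner_op_diag[OF bounded_borel_indicator[OF assms]])
  also have "\<dots> = complex_of_real (\<integral>x. indicator S x \<partial>\<mu> f)"
    unfolding integral_complex_of_real[symmetric] by (intro Bochner_Integration.integral_cong) (auto simp: indicator_def)
  finally show ?thesis using assms by (simp add: emeasure_eq_measure finite_borel_sets[OF \<mu>])
qed

text \<open>\<open>measure_of\<close> looks only at the values on Borel sets, and these are the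
  values of an existing measure, so countable additivity is inherited.\<close>

lemma scalar_measure_pvm:
  assumes "f \<in> ell2" shows "scalar_measure pvm f = \<mu> (vec f)"
proof -
  have "scalar_measure pvm f = measure_of UNIV (sets borel) (emeasure (\<mu> (vec f)))"
    unfolding scalar_measure_def
    by (rule measure_of_eq) (use assms in \<open>auto simp: sets.sigma_sets_eq[of borel, simplified] emeasure_eq_cinner_op pvm_def cinner_def vec_inverse\<close>)
  then show ?thesis
    using measure_of_of_measure[of "\<mu> (vec f)"] by (simp add: finite_borel_sets[OF \<mu>] finite_borel_space[OF \<mu>])
qed

lemma \<mu>_op:
  assumes "bounded_borel \<phi>" shows "\<mu> (op \<phi> f) = density (\<mu> f) (\<lambda>x. ennreal ((cmod (\<phi> x))\<^sup>2))"
proof (rule measure_eqI)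
  show "sets (\<mu> (op \<phi> f)) = sets (density (\<mu> f) (\<lambda>x. ennreal ((cmod (\<phi> x))\<^sup>2)))"
    by (simp add: finite_borel_sets[OF \<mu>])
  fix S assume "S \<in> sets (\<mu> (op \<phi> f))"
  then have S: "S \<in> sets borel" by (simp add: finite_borel_sets[OF \<mu>])
  obtain B where B: "\<And>x. cmod (\<phi> x) \<le> B" using bounded_borel_bound[OF assms] by blast
  have m [measurable]: "\<phi> \<in> borel_measurable borel" using assms by (rule bounded_borel_measurable)
  have bb: "norm (indicator S x * (cmod (\<phi> x))\<^sup>2) \<le> B\<^sup>2" for x
    using B[of x] by (auto simp: indicator_def intro: power_mono)
  have int: "integrable (\<mu> f) (\<lambda>x. indicator S x * (cmod (\<phi> x))\<^sup>2)"
    by (rule finite_borel_integrable[OF \<mu> _ bb]) (use S in measurable)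
  have "emeasure (\<mu> (op \<phi> f)) S = ennreal (Re (\<integral>x. indicator S x \<partial>\<mu> (op \<phi> f)))"
    using emeasure_eq_cinner_op[OF S] cinner_op_diag[OF bounded_borel_indicator[OF S]] by simp
  also have "(\<integral>x. indicator S x \<partial>\<mu> (op \<phi> f)) = (\<integral>x. complex_of_real (indicator S x * (cmod (\<phi> x))\<^sup>2) \<partial>\<mu> f)"
    unfolding integral_op[OF assms bounded_borel_indicator[OF S]] by (intro Bochner_Integration.integral_cong) (auto simp: indicator_def)
  also have "Re \<dots> = (\<integral>x. indicator S x * (cmod (\<phi> x))\<^sup>2 \<partial>\<mu> f)"
    unfolding integral_complex_of_real by (rule Re_complex_of_real)
  also have "ennreal \<dots> = (\<integral>\<^sup>+x. ennreal (indicator S x * (cmod (\<phi> x))\<^sup>2) \<partial>\<mu> f)"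
    by (rule nn_integral_eq_integral[OF int, symmetric]) (intro AE_I2 mult_nonneg_nonneg; simp)
  also have "\<dots> = (\<integral>\<^sup>+x. ennreal ((cmod (\<phi> x))\<^sup>2) * indicator S x \<partial>\<mu> f)"
    by (intro nn_integral_cong) (auto simp: indicator_def)
  also have "\<dots> = emeasure (density (\<mu> f) (\<lambda>x. ennreal ((cmod (\<phi> x))\<^sup>2))) S"
    by (rule emeasure_density[symmetric]) (use S in \<open>simp_all add: finite_borel_sets[OF \<mu>] cong: measurable_cong_sets\<close>)
  finally show "emeasure (\<mu> (op \<phi> f)) S = emeasure (density (\<mu> f) (\<lambda>x. ennreal ((cmod (\<phi> x))\<^sup>2))) S" .
qed

end

section \<open>Recovering the operator from its Cayley transform\<close>

context self_adjoint_operator begin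

sublocale U: cayley_unitary cayley cayley_inv
proof
  fix e :: real and x assume "e > 0"
  then obtain f where "f \<in> Dom" "norm (x - f) < e" using Dom_dense by blast
  then show "\<exists>y. norm (x - (y - cayley y)) < e" using Dom_iff_cayley by metis
qed (simp_all add: clinear_cayley cayley_cayley_inv norm_cayley)

lemma minus_cayley_eq_op: "y - cayley y = U.op (\<lambda>x. 1 - cayley_fun x) y"
  by (simp add: U.op_diff bounded_borel_const bounded_borel_cayley_fun U.op_1 U.op_cayley_fun)

lemma cmod_one_minus_cayley_fun: "(cmod (1 - cayley_fun x))\<^sup>2 = 4 / (1 + x\<^sup>2)"
  unfolding one_minus_cayley_fun
  by (simp add: norm_divide norm_mult power_divide cmod_power2 add.commute)

lemma bounded_borel_one_minus_cayley_fun: "bounded_borel (\<lambda>x. 1 - cayley_fun x)"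
  using bounded_borel_add_cmult[OF bounded_borel_const bounded_borel_cayley_fun, of 1 "-1"] by simp

lemma mu_minus_cayley: "U.mu (y - cayley y) = density (U.mu y) (\<lambda>x. ennreal (4 / (1 + x\<^sup>2)))"
  unfolding minus_cayley_eq_op U.\<mu>_op[OF bounded_borel_one_minus_cayley_fun] cmod_one_minus_cayley_fun ..

text \<open>Writing \<open>f = (1 - U) y\<close> puts the density \<open>4 / (1 + x^2)\<close> on
  the measure of \<open>y\<close>, and this cancels the growth of \<open>x^2\<close>.\<close>

lemma second_moment_finite:
  assumes "f \<in> Dom" shows "(\<integral>\<^sup>+x. ennreal (x\<^sup>2) \<partial>U.mu f) < \<infinity>"
proof -
  obtain y where y: "f = y - cayley y" using assms Dom_iff_cayley by blast
  interpret finite_measure "U.mu y" by (rule finite_borel_finite[OF U.mu(1)])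
  have "(\<integral>\<^sup>+x. ennreal (x\<^sup>2) \<partial>U.mu f) = (\<integral>\<^sup>+x. ennreal (4 / (1 + x\<^sup>2)) * ennreal (x\<^sup>2) \<partial>U.mu y)"
    unfolding y mu_minus_cayley
    by (rule nn_integral_density) (simp_all add: finite_borel_sets[OF U.mu(1)] cong: measurable_cong_sets)
  also have "\<dots> \<le> (\<integral>\<^sup>+x. ennreal 4 \<partial>U.mu y)"
  proof (rule nn_integral_mono)
    fix x :: real
    have "1 + x\<^sup>2 > 0" by (simp add: add_pos_nonneg)
    then have nn: "0 \<le> 4 / (1 + x\<^sup>2)" and le: "4 / (1 + x\<^sup>2) * x\<^sup>2 \<le> 4" by (simp_all add: field_simps)
    show "ennreal (4 / (1 + x\<^sup>2)) * ennreal (x\<^sup>2) \<le> ennreal 4"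
      unfolding ennreal_mult[OF nn zero_le_power2, symmetric] by (rule ennreal_leI[OF le])
  qed
  also have "\<dots> = ennreal 4 * emeasure (U.mu y) UNIV" by (simp add: finite_borel_space[OF U.mu(1)])
  also have "\<dots> < \<infinity>"
    unfolding infinity_ennreal_def less_top[symmetric] ennreal_mult_eq_top_iff by simp
  finally show ?thesis .
qed

text \<open>For \<open>f = (1 - U) y\<close> one has \<open>A f = \<i> (1 + U) y\<close>, so the
  form is the integral of \<open>\<i> cnj (1 - u) (1 + u) = 4 x / (1 + x^2)\<close> with
  \<open>u = cayley_fun x\<close>; here \<open>4 / (1 + x^2)\<close> is the density from
  \<open>mu_minus_cayley\<close>.\<close>

lemma cinner_A_eq_moment:
  assumes "f \<in> Dom" shows "cinner f (A f) = complex_of_real (\<integral>x. x \<partial>U.mu f)"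
proof -
  obtain y where y: "f = y - cayley y" using assms Dom_iff_cayley by blast
  have b: "bounded_borel (\<lambda>x. 1 + cayley_fun x)" using bounded_borel_add[OF bounded_borel_const bounded_borel_cayley_fun, of 1] .
  have b': "bounded_borel (\<lambda>x. cnj (1 - cayley_fun x))" by (rule bounded_borel_cnj[OF bounded_borel_one_minus_cayley_fun])
  have "y + cayley y = U.op (\<lambda>x. 1 + cayley_fun x) y"
    using U.op_add_cmult[OF bounded_borel_const[of 1] bounded_borel_cayley_fun, of 1 y] by (simp add: U.op_1 U.op_cayley_fun)
  then have "cinner f (A f) = \<i> * cinner (U.op (\<lambda>x. 1 - cayley_fun x) y) (U.op (\<lambda>x. 1 + cayley_fun x) y)"
    unfolding y A_cayley minus_cayley_eq_op[symmetric] by (simp add: cinner_simps)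
  also have "\<dots> = \<i> * cinner y (U.op (\<lambda>x. cnj (1 - cayley_fun x) * (1 + cayley_fun x)) y)"
    unfolding U.op_adjoint[OF bounded_borel_one_minus_cayley_fun] U.op_mult[OF b' b] ..
  also have "\<dots> = \<i> * (\<integral>x. cnj (1 - cayley_fun x) * (1 + cayley_fun x) \<partial>U.mu y)"
    by (subst U.cinner_op_diag[OF bounded_borel_mult[OF b' b]]) (rule refl)
  also have "\<dots> = (\<integral>x. \<i> * (cnj (1 - cayley_fun x) * (1 + cayley_fun x)) \<partial>U.mu y)"
    by simp
  also have "\<dots> = (\<integral>x. complex_of_real (4 / (1 + x\<^sup>2) * x) \<partial>U.mu y)"
  proof (intro Bochner_Integration.integral_cong refl)
    fix x :: real
    have *: "(complex_of_real x - \<i>) * (complex_of_real x + \<i>) = complex_of_real (1 + x\<^sup>2)"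
      by (simp add: algebra_simps power2_eq_square)
    have "\<i> * (cnj (1 - cayley_fun x) * (1 + cayley_fun x))
        = 4 * complex_of_real x / ((complex_of_real x - \<i>) * (complex_of_real x + \<i>))"
      unfolding one_minus_cayley_fun one_plus_cayley_fun by (simp add: field_simps)
    then show "\<i> * (cnj (1 - cayley_fun x) * (1 + cayley_fun x)) = complex_of_real (4 / (1 + x\<^sup>2) * x)"
      unfolding * by simp
  qed
  also have "\<dots> = complex_of_real (\<integral>x. 4 / (1 + x\<^sup>2) * x \<partial>U.mu y)" by (rule integral_complex_of_real)
  also have "(\<integral>x. 4 / (1 + x\<^sup>2) * x \<partial>U.mu y) = (\<integral>x. x \<partial>U.mu f)"
    unfolding y mu_minus_cayley
    by (subst integral_density) (simp_all add: finite_borel_sets[OF U.mu(1)] cong: measurable_cong_sets)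
  finally show ?thesis .
qed

text \<open>A preimage of \<open>f\<close> under \<open>1 - U\<close> is wanted. Formally it is the
  multiplier \<open>1 / (1 - cayley_fun x) = (x + \<i>) / (2 \<i>)\<close> applied to
  \<open>f\<close>. This is unbounded, so it is cut off at \<open>n\<close>, and the finite second
  moment makes the truncated vectors Cauchy.\<close>

lemma Dom_if_second_moment_finite:
  assumes fin: "(\<integral>\<^sup>+x. ennreal (x\<^sup>2) \<partial>U.mu f) < \<infinity>" shows "f \<in> Dom"
proof -
  let ?M = "U.mu f"
  interpret finite_measure ?M by (rule finite_borel_finite[OF U.mu(1)])
  have ms: "measurable ?M borel = measurable borel (borel :: real measure)"
    by (intro measurable_cong_sets) (simp_all add: finite_borel_sets[OF U.mu(1)])
  define J :: "nat \<Rightarrow> real set" where "J n = {- real n..real n}" for n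
  have [measurable]: "J n \<in> sets borel" for n by (simp add: J_def)
  \<comment> \<open>The squared modulus of the multiplier before it is cut off.\<close>
  define h where "h x = (1 + x\<^sup>2) / 4" for x :: real
  have h0: "h x \<ge> 0" for x by (simp add: h_def)
  have [measurable]: "h \<in> borel_measurable borel" unfolding h_def[abs_def] by measurable
  have "integrable ?M (\<lambda>x. x\<^sup>2)"
    by (rule integrableI_bounded) (use fin in \<open>simp_all add: ms\<close>)
  then have int_h: "integrable ?M h" unfolding h_def[abs_def] by (intro integrable_divide Bochner_Integration.integrable_add) auto
  define \<phi> where "\<phi> n x = indicator (J n) x * ((of_real x + \<i>) / (2 * \<i>))" for n and x :: real
  have \<phi>: "bounded_borel (\<phi> n)" for n
  proof (rule bounded_borelI)
    show "\<phi> n \<in> borel_measurable borel" unfolding \<phi>_def[abs_def] by measurable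
    show "cmod (\<phi> n x) \<le> real n + 1" for x
    proof (cases "x \<in> J n")
      case True
      have "cmod (of_real x + \<i>) \<le> \<bar>x\<bar> + 1" by (metis norm_triangle_ineq norm_of_real norm_ii)
      moreover have "cmod (\<phi> n x) = cmod (of_real x + \<i>) / 2"
        using True by (simp add: \<phi>_def norm_divide norm_mult)
      moreover have "\<bar>x\<bar> \<le> real n" using True by (auto simp: J_def)
      ultimately show ?thesis by linarith
    qed (simp add: \<phi>_def)
  qed
  have cm: "(cmod (\<phi> n x))\<^sup>2 = indicator (J n) x * h x" for n x
  proof -
    have "(cmod (of_real x + \<i>))\<^sup>2 = 1 + x\<^sup>2" by (simp add: cmod_power2)
    then show ?thesis by (simp add: \<phi>_def h_def norm_divide norm_mult power_divide power_mult_distrib indicator_def)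
  qed
  define g where "g n = U.op (\<phi> n) f" for n
  define a where "a n = (\<integral>x. indicator (J n) x * h x \<partial>?M)" for n
  have int_a: "integrable ?M (\<lambda>x. indicator (J n) x * h x)" for n
    using int_h integrable_mult_indicator[of "J n" ?M h] by (simp add: finite_borel_sets[OF U.mu(1)])
  \<comment> \<open>The windows are nested, so at each point the two truncations agree or one of
    them vanishes; the squared modulus of their difference is then the difference of their squared
    moduli, up to sign.\<close>
  have diff: "(norm (g m - g n))\<^sup>2 = \<bar>a m - a n\<bar>" for m n
  proof -
    have "(cmod (\<phi> m x - \<phi> n x))\<^sup>2 = (if m \<le> n then 1 else -1) * (indicator (J n) x * h x - indicator (J m) x * h x)" for x
    proof -
      have J: "i \<le> j \<Longrightarrow> J i \<subseteq> J j" for i j by (auto simp: J_def)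
      show ?thesis
      proof (cases "m \<le> n")
        case True
        then show ?thesis using J[of m n] cm[of n x] by (auto simp: \<phi>_def indicator_def norm_minus_commute split: if_splits)
      next
        case False
        then show ?thesis using J[of n m] cm[of m x] by (auto simp: \<phi>_def indicator_def norm_minus_commute split: if_splits)
      qed
    qed
    then have "(norm (g m - g n))\<^sup>2 = (if m \<le> n then 1 else -1) * (a n - a m)"
      unfolding g_def U.norm_op_diff[OF \<phi> \<phi>] by (simp add: a_def int_a)
    then show ?thesis using zero_le_power2[of "norm (g m - g n)"] by (auto split: if_splits)
  qed
  have Jlim: "(\<lambda>n. indicator (J n) x :: 'x :: {zero_neq_one, topological_space}) \<longlonglongrightarrow> 1" for x
  proof -
    obtain N where N: "\<bar>x\<bar> \<le> real N" using real_arch_simple by blast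
    have "eventually (\<lambda>n. indicator (J n) x = (1 :: 'x)) sequentially"
      using eventually_ge_at_top[of N]
    proof eventually_elim
      case (elim n)
      then have "\<bar>x\<bar> \<le> real n" using N by linarith
      then show ?case by (auto simp: J_def indicator_def)
    qed
    then show ?thesis by (rule tendsto_eventually)
  qed
  have "a \<longlonglongrightarrow> (\<integral>x. h x \<partial>?M)"
    unfolding a_def
  proof (rule integral_dominated_convergence[where w = h])
    have "(\<lambda>n. indicator (J n) x * h x) \<longlonglongrightarrow> 1 * h x" for x by (intro tendsto_intros Jlim)
    then show "AE x in ?M. (\<lambda>n. indicator (J n) x * h x) \<longlonglongrightarrow> h x" by simp
    show "AE x in ?M. norm (indicator (J n) x * h x) \<le> h x" for n
      using h0 by (simp add: indicator_def)
  qed (use int_h int_a in auto)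
  then have "Cauchy a" by (rule LIMSEQ_imp_Cauchy)
  have "Cauchy g"
  proof (rule CauchyI)
    fix e :: real assume e: "e > 0"
    then obtain N where N: "\<And>m n. m \<ge> N \<Longrightarrow> n \<ge> N \<Longrightarrow> norm (a m - a n) < e\<^sup>2"
      using CauchyD[OF \<open>Cauchy a\<close>, of "e\<^sup>2"] by auto
    then have "(norm (g m - g n))\<^sup>2 < e\<^sup>2" if "m \<ge> N" "n \<ge> N" for m n using that by (simp add: diff)
    then have "norm (g m - g n) < e" if "m \<ge> N" "n \<ge> N" for m n
      using that e by (meson less_imp_le power_less_imp_less_base)
    then show "\<exists>M. \<forall>m\<ge>M. \<forall>n\<ge>M. norm (g m - g n) < e" by blast
  qed
  then obtain y where y: "g \<longlonglongrightarrow> y" using Cauchy_convergent by (auto simp: convergent_def)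
  have "(\<lambda>n. norm (cayley (g n) - cayley y)) \<longlonglongrightarrow> 0"
    using tendsto_norm_zero[OF LIM_zero[OF y]] by (simp add: clinearD(4)[OF clinear_cayley(1), symmetric] norm_cayley)
  then have "(\<lambda>n. cayley (g n)) \<longlonglongrightarrow> cayley y" by (simp add: tendsto_norm_zero_iff LIM_zero_iff)
  then have "(\<lambda>n. g n - cayley (g n)) \<longlonglongrightarrow> y - cayley y" by (intro tendsto_diff y)
  moreover have "g n - cayley (g n) = U.op (indicator (J n)) f" for n
  proof -
    have cancel: "b / c * (i * (c / b)) = i" if "b \<noteq> 0" "c \<noteq> 0" for b c i :: complex using that by simp
    have "(\<lambda>x. (1 - cayley_fun x) * \<phi> n x) = indicator (J n)"
      unfolding one_minus_cayley_fun \<phi>_def by (intro ext cancel) simp_all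
    then show ?thesis
      unfolding minus_cayley_eq_op g_def by (simp add: U.op_mult[OF bounded_borel_one_minus_cayley_fun \<phi>, symmetric])
  qed
  moreover have "(\<lambda>n. U.op (indicator (J n)) f) \<longlonglongrightarrow> U.op (\<lambda>_. 1) f"
    by (rule U.op_tendsto[where B = 1]) (simp_all add: Jlim, simp add: indicator_def)
  ultimately have "y - cayley y = f" using LIMSEQ_unique by (simp add: U.op_1) blast
  then show ?thesis using Dom_iff_cayley by blast
qed

end

lemma self_adjoint_operator_vec:
  assumes "self_adjoint D H"
  shows "self_adjoint_operator {x. coord x \<in> D} (\<lambda>x. vec (H (coord x)))"
proof
  from assms have sub: "ell2_subspace D" and Hell2: "\<And>f. f \<in> D \<Longrightarrow> H f \<in> ell2"
    and lin: "\<And>f g c. f \<in> D \<Longrightarrow> g \<in> D \<Longrightarrow> H (\<lambda>x. f x + c * g x) = (\<lambda>x. H f x + c * H g x)"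
    and dense: "ell2_dense D" and graph: "adjoint_graph D H = (\<lambda>f. (f, H f)) ` D"
    by (auto simp: self_adjoint_def linear_operator_on_def)
  have D: "f \<in> D \<Longrightarrow> f \<in> ell2" for f using sub by (auto simp: ell2_subspace_def)
  show "csubspace {x. coord x \<in> D}" using sub by (auto simp: csubspace_def ell2_subspace_def coord_simps)
  show "vec (H (coord (x + c *\<^sub>C y))) = vec (H (coord x)) + c *\<^sub>C vec (H (coord y))"
    if "x \<in> {x. coord x \<in> D}" "y \<in> {x. coord x \<in> D}" for x y c
    using that by (simp add: coord_simps lin Hell2 vec_add_scaleC)
  show "\<exists>y\<in>{x. coord x \<in> D}. norm (x - y) < e" if "e > 0" for e x
  proof -
    obtain g where "g \<in> D" "ell2_norm (\<lambda>n. coord x n - g n) < e"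
      using dense \<open>e > 0\<close> unfolding ell2_dense_def by (meson coord_ell2)
    then show ?thesis by (intro bexI[of _ "vec g"]) (simp_all add: norm_eq_ell2_norm coord_simps vec_inverse D)
  qed
  show "f \<in> {x. coord x \<in> D} \<and> h = vec (H (coord f)) \<longleftrightarrow>
      (\<forall>g\<in>{x. coord x \<in> D}. cinner f (vec (H (coord g))) = cinner h g)" for f h
  proof -
    have "(\<forall>g\<in>{x. coord x \<in> D}. cinner f (vec (H (coord g))) = cinner h g)
        \<longleftrightarrow> (\<forall>g\<in>D. ell2_inner (coord f) (H g) = ell2_inner (coord h) g)"
    proof (intro iffI ballI)
      fix g assume *: "\<forall>g\<in>{x. coord x \<in> D}. cinner f (vec (H (coord g))) = cinner h g" "g \<in> D"
      then show "ell2_inner (coord f) (H g) = ell2_inner (coord h) g"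
        using bspec[OF *(1), of "vec g"] by (simp add: cinner_def vec_inverse D Hell2)
    qed (simp add: cinner_def vec_inverse Hell2)
    also have "\<dots> \<longleftrightarrow> (coord f, coord h) \<in> adjoint_graph D H" by (simp add: adjoint_graph_def)
    also have "\<dots> \<longleftrightarrow> coord f \<in> D \<and> coord h = H (coord f)" unfolding graph by auto
    also have "\<dots> \<longleftrightarrow> coord f \<in> D \<and> h = vec (H (coord f))"
      by (metis Hell2 coord_inverse vec_inverse)
    finally show ?thesis by simp
  qed
qed

theorem spectral_theorem:
  assumes "self_adjoint D H" shows "\<exists>E. is_spectral_resolution D H E"
proof -
  interpret self_adjoint_operator "{x. coord x \<in> D}" "\<lambda>x. vec (H (coord x))"
    by (rule self_adjoint_operator_vec[OF assms])
  have D: "f \<in> D \<Longrightarrow> f \<in> ell2 \<and> H f \<in> ell2" for f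
    using assms by (auto simp: self_adjoint_def linear_operator_on_def ell2_subspace_def)
  have "is_spectral_resolution D H U.pvm"
    unfolding is_spectral_resolution_def
  proof (intro conjI ballI U.projection_valued_measure_pvm)
    have "f \<in> D \<longleftrightarrow> (\<integral>\<^sup>+x. ennreal (x\<^sup>2) \<partial>scalar_measure U.pvm f) < \<infinity>" if "f \<in> ell2" for f
      using second_moment_finite[of "vec f"] Dom_if_second_moment_finite[of "vec f"] that
      by (auto simp: U.scalar_measure_pvm vec_inverse)
    then show "D = {f \<in> ell2. (\<integral>\<^sup>+x. ennreal (x\<^sup>2) \<partial>scalar_measure U.pvm f) < \<infinity>}"
      using D by blast
    show "ell2_inner f (H f) = complex_of_real (\<integral>x. x \<partial>scalar_measure U.pvm f)" if "f \<in> D" for f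
      using cinner_A_eq_moment[of "vec f"] that D[OF that]
      by (simp add: U.scalar_measure_pvm vec_inverse cinner_def)
  qed
  then show ?thesis by blast
qed

section \<open>The functional calculus of a projection-valued measure\<close>

text \<open>The axioms of a projection-valued measure yield a spectral family over indicators, where
  the Borel set is read off from its indicator as \<open>{x. \<gamma> x = 1}\<close>. This gives the
  chosen resolution the same calculus as the constructed one.\<close>

lemma spectral_family_of_pvm:
  assumes E: "projection_valued_measure E"
  shows "spectral_family (\<lambda>f. scalar_measure E (coord f)) {indicator S | S. S \<in> sets borel}
     (\<lambda>\<gamma> f. vec (E {x. \<gamma> x = 1} (coord f)))"
proof
  define F where "F S f = vec (E S (coord f))" for S and f :: "'a l2"
  have proj: "S \<in> sets borel \<Longrightarrow> is_orth_projection (E S)" for S using E by (simp add: projection_valued_measure_def)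
  have ell2: "S \<in> sets borel \<Longrightarrow> E S (coord f) \<in> ell2" for S f
    using proj[of S] by (simp add: is_orth_projection_def linear_operator_on_def)
  have coordF: "S \<in> sets borel \<Longrightarrow> coord (F S f) = E S (coord f)" for S f
    by (simp add: F_def vec_inverse ell2)
  have lin: "clinear (F S)" if "S \<in> sets borel" for S
    unfolding clinear_def
  proof (intro allI, rule l2_eqI)
    fix x y c n
    have "E S (\<lambda>n. coord x n + c * coord y n) = (\<lambda>n. E S (coord x) n + c * E S (coord y) n)"
      using proj[OF that] by (simp add: is_orth_projection_def linear_operator_on_def)
    then show "coord (F S (x + c *\<^sub>C y)) n = coord (F S x + c *\<^sub>C F S y) n"
      using that by (simp add: coordF coord_simps)
  qed
  have idem: "F S (F S f) = F S f" if "S \<in> sets borel" for S f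
    using proj[OF that] that by (intro l2_eqI) (simp add: coordF is_orth_projection_def)
  have sa: "cinner (F S f) g = cinner f (F S g)" if "S \<in> sets borel" for S f g
    using proj[OF that] that by (simp add: cinner_def coordF is_orth_projection_def)
  have pos: "cinner f (F S f) = of_real ((norm (F S f))\<^sup>2)" if "S \<in> sets borel" for S f
    using sa[OF that, of f "F S f"] idem[OF that] by (simp add: cinner_self)
  have F0: "F {} f = 0" and F1: "F UNIV f = f" for f
    using E coordF[of "{}" f] coordF[of UNIV f]
    by (auto simp: projection_valued_measure_def coord_simps intro!: l2_eqI)
  have Fint: "F (S \<inter> S') f = F S (F S' f)" if "S \<in> sets borel" "S' \<in> sets borel" for S S' f
    using E that by (intro l2_eqI) (simp add: coordF projection_valued_measure_def)
  have Fsums: "(\<lambda>i. F (B i) f) sums F (\<Union>i. B i) f" if "range B \<subseteq> sets borel" "disjoint_family B" for B f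
  proof -
    have B: "B i \<in> sets borel" "(\<Union>i. B i) \<in> sets borel" for i using that by auto
    have "(\<lambda>N. ell2_norm (\<lambda>x. E (\<Union>i. B i) (coord f) x - (\<Sum>i<N. E (B i) (coord f) x))) \<longlonglongrightarrow> 0"
      using E that by (simp add: projection_valued_measure_def)
    then have "(\<lambda>N. norm (F (\<Union>i. B i) f - (\<Sum>i<N. F (B i) f))) \<longlonglongrightarrow> 0"
      by (simp add: norm_eq_ell2_norm coord_simps coord_sum coordF B)
    then have "(\<lambda>N. F (\<Union>i. B i) f - (\<Sum>i<N. F (B i) f)) \<longlonglongrightarrow> 0" by (rule tendsto_norm_zero_cancel)
    from tendsto_diff[OF tendsto_const[of "F (\<Union>i. B i) f"] this] show ?thesis by (simp add: sums_def)
  qed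
  have sig: "sigma_algebra UNIV (sets (borel :: real measure))"
    using sets.sigma_algebra_axioms[of borel] by simp
  have sets_sm: "sets (scalar_measure E g) = sets borel" for g
    unfolding scalar_measure_def by (simp add: sigma_algebra.sigma_sets_eq[OF sig])
  \<comment> \<open>\<open>measure_of\<close> returns the zero measure for a set function that is
    not countably additive, so additivity has to be checked here; it follows from norm convergence
    of the sums of projected vectors.\<close>
  have em: "emeasure (scalar_measure E (coord f)) S = ennreal ((norm (F S f))\<^sup>2)" if S: "S \<in> sets borel" for S f
  proof -
    have eq: "Re (ell2_inner (coord f) (E S (coord f))) = (norm (F S f))\<^sup>2" if "S \<in> sets borel" for S
      using pos[OF that, of f] by (simp add: cinner_def coordF that)
    have "countably_additive (sets borel) (\<lambda>S. ennreal (Re (ell2_inner (coord f) (E S (coord f)))))"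
      unfolding countably_additive_def
    proof (intro allI impI)
      fix B :: "nat \<Rightarrow> real set" assume B: "range B \<subseteq> sets borel" "disjoint_family B" "\<Union> (range B) \<in> sets borel"
      have "(\<lambda>N. Re (cinner f (\<Sum>i<N. F (B i) f))) \<longlonglongrightarrow> Re (cinner f (F (\<Union>i. B i) f))"
        using Fsums[OF B(1,2), of f] unfolding sums_def by (intro tendsto_intros)
      moreover have "Re (cinner f (\<Sum>i<N. F (B i) f)) = (\<Sum>i<N. (norm (F (B i) f))\<^sup>2)" for N
        using B(1) by (induction N) (simp_all add: cinner_simps pos subset_eq)
      ultimately have "(\<lambda>i. (norm (F (B i) f))\<^sup>2) sums (norm (F (\<Union>i. B i) f))\<^sup>2"
        using B(3) by (simp add: sums_def pos)
      then have "(\<Sum>i. ennreal ((norm (F (B i) f))\<^sup>2)) = ennreal ((norm (F (\<Union>i. B i) f))\<^sup>2)"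
        by (intro suminf_ennreal_eq) auto
      moreover have "B i \<in> sets borel" for i using B(1) by auto
      then have "(\<Sum>i. ennreal (Re (ell2_inner (coord f) (E (B i) (coord f))))) = (\<Sum>i. ennreal ((norm (F (B i) f))\<^sup>2))"
        by (intro suminf_cong) (simp only: eq)
      ultimately show "(\<Sum>i. ennreal (Re (ell2_inner (coord f) (E (B i) (coord f)))))
          = ennreal (Re (ell2_inner (coord f) (E (\<Union> (range B)) (coord f))))"
        by (simp only: eq[OF B(3)])
    qed
    moreover have "positive (sets borel) (\<lambda>S. ennreal (Re (ell2_inner (coord f) (E S (coord f)))))"
      by (simp add: positive_def eq F0)
    ultimately show ?thesis unfolding scalar_measure_def
      by (subst emeasure_measure_of_sigma[OF sig _ _ S]) (simp_all add: eq S)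
  qed
  show finite_borel: "finite_borel (scalar_measure E (coord f))" for f
    unfolding finite_borel_def using em[of UNIV f] sets_eq_imp_space_eq[OF sets_sm, of "coord f"]
    by (auto intro!: finite_measureI simp: sets_sm)
  show "bp_generating {indicator S | S. S \<in> sets borel}" by (rule bp_generating_indicators)
  show "(\<lambda>_. 1) \<in> {indicator S :: real \<Rightarrow> complex | S. S \<in> sets borel}"
    by (auto simp: indicator_def[abs_def] intro!: exI[of _ UNIV])
  show "vec (E {x. (1::complex) = 1} (coord f)) = f" for f using F1[of f] by (simp add: F_def)
  have set: "{x. indicator S x = (1::complex)} = S" for S :: "real set" by (auto simp: indicator_def)
  fix \<gamma> :: "real \<Rightarrow> complex" assume "\<gamma> \<in> {indicator S | S. S \<in> sets borel}"
  then obtain S where S: "S \<in> sets borel" "\<gamma> = indicator S" by blast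
  show "bounded_borel \<gamma>" using S by (simp add: bounded_borel_indicator)
  show "clinear (\<lambda>f. vec (E {x. \<gamma> x = 1} (coord f)))" using lin[OF S(1)] by (simp add: S(2) set F_def[abs_def])
  show "cinner f (vec (E {x. \<gamma> x = 1} (coord f))) = (\<integral>x. \<gamma> x \<partial>scalar_measure E (coord f))" for f
  proof -
    interpret finite_measure "scalar_measure E (coord f)" by (rule finite_borel_finite[OF finite_borel])
    have "(\<integral>x. \<gamma> x \<partial>scalar_measure E (coord f)) = (\<integral>x. complex_of_real (indicator S x) \<partial>scalar_measure E (coord f))"
      unfolding S(2) by (intro Bochner_Integration.integral_cong) (auto simp: indicator_def)
    also have "\<dots> = of_real (measure (scalar_measure E (coord f)) S)"
      unfolding integral_complex_of_real using S(1) by (simp add: sets_sm)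
    also have "measure (scalar_measure E (coord f)) S = (norm (F S f))\<^sup>2"
      using em[OF S(1)] by (simp add: measure_def)
    finally show ?thesis using pos[OF S(1), of f] by (simp add: S(2) set F_def)
  qed
  fix \<gamma>' :: "real \<Rightarrow> complex" assume "\<gamma>' \<in> {indicator S | S. S \<in> sets borel}"
  then obtain S' where S': "S' \<in> sets borel" "\<gamma>' = indicator S'" by blast
  have eq: "(\<lambda>x. \<gamma> x * \<gamma>' x) = indicator (S \<inter> S')" by (auto simp: S(2) S'(2) indicator_def)
  show "(\<lambda>x. \<gamma> x * \<gamma>' x) \<in> {indicator S | S. S \<in> sets borel}" unfolding eq using S(1) S'(1) by blast
  show "vec (E {x. \<gamma> x * \<gamma>' x = 1} (coord f)) = vec (E {x. \<gamma> x = 1} (coord (vec (E {x. \<gamma>' x = 1} (coord f)))))" for f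
  proof -
    have "{x. \<gamma> x * \<gamma>' x = 1} = S \<inter> S'" by (auto simp: S(2) S'(2) indicator_def)
    then show ?thesis using Fint[OF S(1) S'(1), of f] by (simp add: S(2) S'(2) set F_def)
  qed
qed

text \<open>The existence theorem makes the choice in \<open>spectral_resolution\<close> an actual
  resolution.\<close>

lemma spectral_family_spectral_measure:
  assumes "self_adjoint D H"
  shows "spectral_family (\<lambda>f. spectral_measure D H (coord f)) {indicator S | S. S \<in> sets borel}
     (\<lambda>\<gamma> f. vec (spectral_resolution D H {x. \<gamma> x = 1} (coord f)))"
proof -
  have "is_spectral_resolution D H (spectral_resolution D H)"
    unfolding spectral_resolution_def by (rule someI_ex[OF spectral_theorem[OF assms]])
  then show ?thesis
    unfolding spectral_measure_def by (intro spectral_family_of_pvm) (simp add: is_spectral_resolution_def)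
qed

section \<open>Decomposition of measures with respect to Hausdorff measures\<close>

lemma hausdorff_dimension_functionD:
  assumes "hausdorff_dimension_function \<rho>"
  shows "t > 0 \<Longrightarrow> \<rho> t > 0" "0 < s \<Longrightarrow> s \<le> t \<Longrightarrow> \<rho> s \<le> \<rho> t"
proof -
  show "t > 0 \<Longrightarrow> \<rho> t > 0" using assms by (simp add: hausdorff_dimension_function_def)
  have "strict_mono_on {0<..} \<rho>" using assms by (simp add: hausdorff_dimension_function_def)
  then show "0 < s \<Longrightarrow> s \<le> t \<Longrightarrow> \<rho> s \<le> \<rho> t"
    by (cases "s = t") (auto simp: strict_mono_on_def intro: less_imp_le)
qed

text \<open>Countable index sets other than the naturals suit Vitali families, and bounds on finite
  subfamilies avoid infinite sums. The infimum is 0 for each \<open>\<delta> > 0\<close>, hence so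
  is the limit.\<close>

lemma hausdorff_measure_eq_0I:
  fixes C :: "real \<Rightarrow> real \<Rightarrow> 'i set" and V :: "'i \<Rightarrow> real set" and \<rho> :: "real \<Rightarrow> real"
  defines "w \<equiv> \<lambda>U. if diameter U = 0 then 0 else \<rho> (diameter U)"
  assumes \<rho>: "hausdorff_dimension_function \<rho>"
    and C: "\<And>\<delta> \<epsilon>. \<delta> > 0 \<Longrightarrow> \<epsilon> > 0 \<Longrightarrow> countable (C \<delta> \<epsilon>) \<and> S \<subseteq> (\<Union>c\<in>C \<delta> \<epsilon>. V c) \<and>
        (\<forall>c\<in>C \<delta> \<epsilon>. bounded (V c) \<and> diameter (V c) \<le> \<delta>) \<and>
        (\<forall>F. finite F \<longrightarrow> F \<subseteq> C \<delta> \<epsilon> \<longrightarrow> (\<Sum>c\<in>F. w (V c)) \<le> \<epsilon>)"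
  shows "hausdorff_measure \<rho> S = 0"
proof -
  define h where "h \<delta> = (INF U \<in> {U :: nat \<Rightarrow> real set.
                S \<subseteq> (\<Union>i. U i) \<and> (\<forall>i. bounded (U i) \<and> diameter (U i) \<le> \<delta>)}. \<Sum>i. ennreal (w (U i)))" for \<delta>
  have w_nonneg: "w U \<ge> 0" if "bounded U" for U
    using diameter_ge_0[OF that] hausdorff_dimension_functionD(1)[OF \<rho>, of "diameter U"]
    by (auto simp: w_def less_le)
  have "h \<delta> = 0" if "\<delta> > 0" for \<delta>
  proof -
    have "h \<delta> \<le> ennreal \<epsilon>" if "\<epsilon> > 0" for \<epsilon>
    proof -
      define B where "B = C \<delta> \<epsilon>"
      have B: "countable B" "S \<subseteq> (\<Union>c\<in>B. V c)" "\<And>c. c \<in> B \<Longrightarrow> bounded (V c) \<and> diameter (V c) \<le> \<delta>"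
          "\<And>F. finite F \<Longrightarrow> F \<subseteq> B \<Longrightarrow> (\<Sum>c\<in>F. w (V c)) \<le> \<epsilon>"
        using C[OF \<open>\<delta> > 0\<close> \<open>\<epsilon> > 0\<close>] unfolding B_def by blast+
      define e where "e = to_nat_on B"
      have e: "inj_on e B" unfolding e_def using B(1) by (rule inj_on_to_nat_on)
      define U where "U n = (if n \<in> e ` B then V (the_inv_into B e n) else {})" for n
      have U_e: "U (e c) = V c" if "c \<in> B" for c
        using that e by (simp add: U_def the_inv_into_f_f)
      have "S \<subseteq> (\<Union>i. U i)" using B(2) U_e by blast
      moreover have "bounded (U i) \<and> diameter (U i) \<le> \<delta>" for i
        using B(3) U_e \<open>\<delta> > 0\<close> by (cases "i \<in> e ` B") (auto, auto simp: U_def)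
      ultimately have "h \<delta> \<le> (\<Sum>i. ennreal (w (U i)))" unfolding h_def by (intro INF_lower) auto
      also have "\<dots> \<le> ennreal \<epsilon>"
      proof (rule suminf_le_const)
        fix N
        define F where "F = {c\<in>B. e c < N}"
        have "e ` F \<subseteq> {..<N}" "inj_on e F" using e by (auto simp: F_def inj_on_def)
        then have "finite F" by (meson finite_imageD finite_lessThan finite_subset)
        have "(\<Sum>n<N. ennreal (w (U n))) = ennreal (\<Sum>n<N. w (U n))"
          using \<open>\<And>i. bounded (U i) \<and> diameter (U i) \<le> \<delta>\<close> w_nonneg by (intro sum_ennreal) auto
        also have "(\<Sum>n<N. w (U n)) = (\<Sum>n\<in>e ` F. w (U n))"
          by (rule sum.mono_neutral_right) (auto simp: F_def U_def w_def)
        also have "\<dots> = (\<Sum>c\<in>F. w (U (e c)))" using \<open>inj_on e F\<close> by (simp add: sum.reindex)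
        also have "\<dots> = (\<Sum>c\<in>F. w (V c))" by (intro sum.cong refl) (simp add: U_e F_def)
        also have "\<dots> \<le> \<epsilon>" by (rule B(4)[OF \<open>finite F\<close>]) (auto simp: F_def)
        finally show "(\<Sum>n<N. ennreal (w (U n))) \<le> ennreal \<epsilon>" by (simp add: ennreal_leI)
      qed simp
      finally show ?thesis .
    qed
    then have "h \<delta> \<le> 0 + ennreal \<epsilon>" if "\<epsilon> > 0" for \<epsilon> using that by simp
    then have "h \<delta> \<le> 0" by (rule ennreal_le_epsilon) auto
    then show ?thesis by simp
  qed
  then have "eventually (\<lambda>\<delta>. h \<delta> = 0) (at_right 0)"
    using eventually_at_right_less[of "0 :: real"] by (auto elim: eventually_mono)
  then have "(h \<longlongrightarrow> 0) (at_right 0)" by (rule tendsto_eventually)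
  then have "Lim (at_right 0) h = 0" by (intro tendsto_Lim) auto
  then show ?thesis unfolding hausdorff_measure_def h_def[abs_def] w_def .
qed

text \<open>Taking all open intervals around a point, not only centred ones, makes the set open and
  therefore Borel. The intersection over all \<open>K\<close> is the set of infinite upper
  density.\<close>

definition heavy_set :: "real measure \<Rightarrow> (real \<Rightarrow> real) \<Rightarrow> real \<Rightarrow> real set" where
  "heavy_set M \<rho> K = (\<Union>(a, b)\<in>{(a, b). a < b \<and> b - a \<le> 1 \<and> K * \<rho> (b - a) < measure M {a<..<b}}. {a<..<b})"

lemma heavy_setI:
  "a < x \<Longrightarrow> x < b \<Longrightarrow> b - a \<le> 1 \<Longrightarrow> K * \<rho> (b - a) < measure M {a<..<b} \<Longrightarrow> x \<in> heavy_set M \<rho> K"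
  unfolding heavy_set_def by (rule UN_I[of "(a, b)"]) auto

lemma heavy_setE:
  assumes "x \<in> heavy_set M \<rho> K"
  obtains a b where "a < x" "x < b" "b - a \<le> 1" "K * \<rho> (b - a) < measure M {a<..<b}"
  using assms unfolding heavy_set_def by auto

lemma heavy_set_borel [measurable]: "heavy_set M \<rho> K \<in> sets borel"
  unfolding heavy_set_def by (intro borel_open open_UN) auto

lemma heavy_set_antimono:
  assumes "hausdorff_dimension_function \<rho>" "K \<le> K'" shows "heavy_set M \<rho> K' \<subseteq> heavy_set M \<rho> K"
proof -
  have "K * \<rho> (b - a) \<le> K' * \<rho> (b - a)" if "a < b" for a b
    using assms hausdorff_dimension_functionD(1)[OF assms(1), of "b - a"] that by (intro mult_right_mono) auto
  note le = this
  show ?thesis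
  proof
    fix x assume "x \<in> heavy_set M \<rho> K'"
    then obtain a b where ab: "a < x" "x < b" "b - a \<le> 1" "K' * \<rho> (b - a) < measure M {a<..<b}"
      by (elim heavy_setE)
    have "K * \<rho> (b - a) < measure M {a<..<b}" using le[of a b] ab by linarith
    with ab(1-3) show "x \<in> heavy_set M \<rho> K" by (rule heavy_setI)
  qed
qed

text \<open>An interval that is not swallowed by the heavy set contains a point outside it, and so
  is itself not one of the heavy intervals.\<close>

lemma measure_outside_heavy_set:
  assumes M: "finite_borel M" and \<rho>: "hausdorff_dimension_function \<rho>" and "K \<ge> 0" "a < b" "b - a \<le> 1"
  shows "measure M ({a<..<b} - heavy_set M \<rho> K) \<le> K * \<rho> (b - a)"
proof (cases "{a<..<b} \<subseteq> heavy_set M \<rho> K")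
  case True
  then have "{a<..<b} - heavy_set M \<rho> K = {}" by blast
  moreover have "0 \<le> K * \<rho> (b - a)"
    using hausdorff_dimension_functionD(1)[OF \<rho>, of "b - a"] assms(3,4) by simp
  ultimately show ?thesis by (simp only: measure_empty)
next
  case False
  then obtain x where "x \<in> {a<..<b}" and x0: "x \<notin> heavy_set M \<rho> K" by blast
  then have x: "a < x" "x < b" by auto
  then have "measure M {a<..<b} \<le> K * \<rho> (b - a)"
    using heavy_setI[OF x(1,2) assms(5), of K \<rho> M] x0 by (cases "K * \<rho> (b - a) < measure M {a<..<b}") auto
  moreover have "measure M ({a<..<b} - heavy_set M \<rho> K) \<le> measure M {a<..<b}"
    by (rule finite_measure.finite_measure_mono[OF finite_borel_finite[OF M]]) (auto simp: finite_borel_sets[OF M])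
  ultimately show ?thesis by linarith
qed

text \<open>Since \<open>\<rho>\<close> need not be doubling, each enlarged Vitali interval is covered by five
  translates of the original one instead.\<close>

lemma hausdorff_measure_heavy:
  assumes M: "finite_borel M" and \<rho>: "hausdorff_dimension_function \<rho>"
  shows "hausdorff_measure \<rho> (\<Inter>k::nat. heavy_set M \<rho> (real k)) = 0"
proof -
  define S where "S = (\<Inter>k::nat. heavy_set M \<rho> (real k))"
  define m where "m = measure M UNIV"
  note \<rho>D = hausdorff_dimension_functionD[OF \<rho>]
  \<comment> \<open>Translates by multiples of the length, beginning two lengths to the left of
    \<open>a\<close>: for \<open>j < 5\<close> they fill the interval concentric with
    \<open>{a..b}\<close> and five times as long.\<close>
  define V :: "(real \<times> real) \<times> nat \<Rightarrow> real set" where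
    "V = (\<lambda>((a, b), j). {a - 2 * (b - a) + real j * (b - a)..a - 2 * (b - a) + real j * (b - a) + (b - a)})"
  define w where "w = (\<lambda>U :: real set. if diameter U = 0 then 0 else \<rho> (diameter U))"
  have "\<exists>C. countable C \<and> S \<subseteq> (\<Union>c\<in>C. V c) \<and> (\<forall>c\<in>C. bounded (V c) \<and> diameter (V c) \<le> \<delta>) \<and>
      (\<forall>F. finite F \<longrightarrow> F \<subseteq> C \<longrightarrow> (\<Sum>c\<in>F. w (V c)) \<le> \<epsilon>)" if \<delta>: "\<delta> > 0" and \<epsilon>: "\<epsilon> > 0" for \<delta> \<epsilon>
  proof -
    define \<delta>' where "\<delta>' = min \<delta> 1"
    have \<delta>': "0 < \<delta>'" using \<delta> by (simp add: \<delta>'_def)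
    \<comment> \<open>One bound on \<open>k\<close> makes five copies of intervals of total weight
      \<open>m / k\<close> cost at most \<open>\<epsilon>\<close>; the other, by monotonicity of
      \<open>\<rho>\<close>, forces the heavy intervals to have length at most
      \<open>\<delta>'\<close>.\<close>
    obtain k :: nat where k: "max 1 (max (5 * m / \<epsilon>) (m / \<rho> \<delta>')) \<le> real k" using real_arch_simple by blast
    then have k1: "real k \<ge> 1" and k2: "5 * m \<le> real k * \<epsilon>" and k3: "m \<le> real k * \<rho> \<delta>'"
      using \<epsilon> \<rho>D(1)[OF \<delta>'] by (simp_all add: field_simps)
    define Ix where "Ix = {(a, b). a < b \<and> b - a \<le> \<delta>' \<and> real k * \<rho> (b - a) < measure M {a<..<b}}"
    have m_ge: "measure M A \<le> m" for A
      unfolding m_def using finite_measure.bounded_measure[OF finite_borel_finite[OF M], of A] by (simp add: finite_borel_space[OF M])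
    have "S \<subseteq> (\<Union>i\<in>Ix. cball ((fst i + snd i) / 2) ((snd i - fst i) / 2))"
    proof
      fix x assume "x \<in> S"
      then have "x \<in> heavy_set M \<rho> (real k)" by (simp add: S_def)
      then obtain a b where ab: "a < b" "b - a \<le> 1" "real k * \<rho> (b - a) < measure M {a<..<b}" "x \<in> {a<..<b}"
        by (elim heavy_setE) auto
      have "b - a \<le> \<delta>'"
      proof (rule ccontr)
        assume "\<not> b - a \<le> \<delta>'"
        then have "\<rho> \<delta>' \<le> \<rho> (b - a)" using \<rho>D(2)[OF \<delta>'] by simp
        then have "real k * \<rho> \<delta>' \<le> real k * \<rho> (b - a)" by (simp add: mult_left_mono)
        then show False using k3 ab(3) m_ge[of "{a<..<b}"] by linarith
      qed
      then have "(a, b) \<in> Ix" using ab by (simp add: Ix_def)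
      moreover have "x \<in> cball ((a + b) / 2) ((b - a) / 2)" using ab(4) by (auto simp: dist_real_def abs_if field_simps)
      ultimately show "x \<in> (\<Union>i\<in>Ix. cball ((fst i + snd i) / 2) ((snd i - fst i) / 2))" by force
    qed
    moreover have "0 < (snd i - fst i) / 2 \<and> (snd i - fst i) / 2 \<le> 1" if "i \<in> Ix" for i
      using that by (auto simp: Ix_def \<delta>'_def)
    ultimately obtain C where C: "countable C" "C \<subseteq> Ix"
        "pairwise (\<lambda>i j. disjnt (cball ((fst i + snd i) / 2) ((snd i - fst i) / 2)) (cball ((fst j + snd j) / 2) ((snd j - fst j) / 2))) C"
        "S \<subseteq> (\<Union>i\<in>C. cball ((fst i + snd i) / 2) (5 * ((snd i - fst i) / 2)))"
      by (rule Vitali_covering_lemma_cballs)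
    have pos: "a < b" "b - a \<le> \<delta>'" "real k * \<rho> (b - a) < measure M {a<..<b}" if "(a, b) \<in> C" for a b
      using C(2) that by (auto simp: Ix_def)
    have diam: "diameter (V ((a, b), j)) = b - a" if "(a, b) \<in> C" for a b j
      using pos[OF that] by (simp add: V_def)
    have cov: "S \<subseteq> (\<Union>c\<in>C \<times> {..<5}. V c)"
    proof
      fix x assume "x \<in> S"
      then obtain a b where ab: "(a, b) \<in> C" "x \<in> cball ((a + b) / 2) (5 * ((b - a) / 2))" using C(4) by fastforce
      define l where "l = b - a"
      have l: "l > 0" using pos(1)[OF ab(1)] by (simp add: l_def)
      have x: "a - 2 * l \<le> x" "x \<le> a + 3 * l"
        using ab(2) by (auto simp: dist_real_def l_def abs_if field_simps split: if_splits)
      have "\<exists>j<5. x \<in> {a - 2 * l + real j * l..a - 2 * l + real j * l + l}"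
      proof -
        consider "x \<le> a - l" | "a - l \<le> x" "x \<le> a" | "a \<le> x" "x \<le> a + l" | "a + l \<le> x" "x \<le> a + 2 * l" | "a + 2 * l \<le> x"
          by linarith
        then show ?thesis
        proof cases
          case 1 then show ?thesis using x by (intro exI[of _ 0]) auto
        next
          case 2 then show ?thesis using x by (intro exI[of _ 1]) auto
        next
          case 3 then show ?thesis using x by (intro exI[of _ 2]) auto
        next
          case 4 then show ?thesis using x by (intro exI[of _ 3]) auto
        next
          case 5 then show ?thesis using x by (intro exI[of _ 4]) auto
        qed
      qed
      then obtain j where "j < 5" "x \<in> V ((a, b), j)" by (auto simp: V_def l_def)
      then show "x \<in> (\<Union>c\<in>C \<times> {..<5}. V c)" using ab(1) by (intro UN_I[of "((a, b), j)"]) auto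
    qed
    have bd: "bounded (V c) \<and> diameter (V c) \<le> \<delta>" if c: "c \<in> C \<times> {..<5}" for c
    proof -
      obtain a b j where "c = ((a, b), j)" by (metis surj_pair)
      then show ?thesis using c pos(2)[of a b] diam[of a b j] by (auto simp: V_def \<delta>'_def)
    qed
    have sum: "(\<Sum>c\<in>F. w (V c)) \<le> \<epsilon>" if F: "finite F" "F \<subseteq> C \<times> {..<5}" for F
    proof -
      define F0 where "F0 = fst ` F"
      have F0: "finite F0" "F0 \<subseteq> C" "F \<subseteq> F0 \<times> {..<5}" using F by (force simp: F0_def)+
      have wV: "w (V (p, j)) = \<rho> (snd p - fst p)" if "p \<in> C" for p j
        using diam[of "fst p" "snd p" j] pos(1)[of "fst p" "snd p"] that by (simp add: w_def)
      have nn: "0 \<le> \<rho> (snd p - fst p)" if "p \<in> C" for p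
        using pos(1)[of "fst p" "snd p"] that \<rho>D(1)[of "snd p - fst p"] by simp
      have "(\<Sum>c\<in>F. w (V c)) \<le> (\<Sum>c\<in>F0 \<times> {..<5}. w (V c))"
        by (rule sum_mono2) (use F0 nn wV in auto)
      also have "\<dots> = (\<Sum>p\<in>F0. \<Sum>j<5::nat. w (V (p, j)))" by (simp add: sum.cartesian_product)
      also have "\<dots> = (\<Sum>p\<in>F0. 5 * \<rho> (snd p - fst p))"
        by (intro sum.cong refl) (use F0(2) wV in \<open>auto simp: subset_eq\<close>)
      finally have "real k * (\<Sum>c\<in>F. w (V c)) \<le> real k * (\<Sum>p\<in>F0. 5 * \<rho> (snd p - fst p))"
        by (rule mult_left_mono) simp
      then have 1: "real k * (\<Sum>c\<in>F. w (V c)) \<le> 5 * (\<Sum>p\<in>F0. real k * \<rho> (snd p - fst p))"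
        by (simp add: sum_distrib_left mult_ac)
      \<comment> \<open>Heaviness is played against disjointness: the selected intervals have total
        mass at most \<open>m\<close>, hence total \<open>\<rho>\<close>-weight at most
        \<open>m / k\<close>.\<close>
      have "(\<Sum>p\<in>F0. real k * \<rho> (snd p - fst p)) \<le> (\<Sum>p\<in>F0. measure M {fst p<..<snd p})"
        by (rule sum_mono) (use F0(2) pos(3) in \<open>force intro: less_imp_le\<close>)
      also have "\<dots> = measure M (\<Union>p\<in>F0. {fst p<..<snd p})"
      proof (rule finite_measure.finite_measure_finite_Union[OF finite_borel_finite[OF M], symmetric])
        have "{fst p<..<snd p} \<subseteq> cball ((fst p + snd p) / 2) ((snd p - fst p) / 2)" for p :: "real \<times> real"
          by (auto simp: dist_real_def abs_if field_simps)
        then show "disjoint_family_on (\<lambda>p. {fst p<..<snd p}) F0"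
          using C(3) F0(2) unfolding disjoint_family_on_def pairwise_def disjnt_def by blast
      qed (use F0 finite_borel_sets[OF M] in auto)
      also have "\<dots> \<le> m" by (rule m_ge)
      finally have "real k * (\<Sum>c\<in>F. w (V c)) \<le> real k * \<epsilon>" using 1 k2 by linarith
      then show ?thesis using k1 by simp
    qed
    have "countable (C \<times> {..<5::nat})" using C(1) by simp
    with cov bd sum show ?thesis by (intro exI[of _ "C \<times> {..<5}"]) auto
  qed
  then obtain C where "\<And>\<delta> \<epsilon>. \<delta> > 0 \<Longrightarrow> \<epsilon> > 0 \<Longrightarrow> countable (C \<delta> \<epsilon>) \<and> S \<subseteq> (\<Union>c\<in>C \<delta> \<epsilon>. V c) \<and>
      (\<forall>c\<in>C \<delta> \<epsilon>. bounded (V c) \<and> diameter (V c) \<le> \<delta>) \<and>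
      (\<forall>F. finite F \<longrightarrow> F \<subseteq> C \<delta> \<epsilon> \<longrightarrow> (\<Sum>c\<in>F. w (V c)) \<le> \<epsilon>)" by metis
  then show ?thesis unfolding S_def[symmetric] w_def by (intro hausdorff_measure_eq_0I[OF \<rho>, of C S V]) auto
qed

section \<open>Gaussian time averages\<close>

lemma nn_integral_gaussian:
  assumes "T > 0" "c > 0"
  shows "(\<integral>\<^sup>+z. ennreal (exp (- (c * T\<^sup>2 * (z - m)\<^sup>2))) \<partial>lborel) = ennreal (sqrt (pi / c) / T)"
proof -
  \<comment> \<open>The standard deviation whose normal density has the given exponent; the
    normalising factor then is the value of the integral.\<close>
  define s where "s = 1 / (T * sqrt (2 * c))"
  have s: "s > 0" "2 * s\<^sup>2 = 1 / (c * T\<^sup>2)" using assms by (simp_all add: s_def power_divide power_mult_distrib)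
  have sq: "sqrt (2 * pi * s\<^sup>2) = sqrt (pi / c) / T"
  proof -
    have "2 * pi * s\<^sup>2 = pi * (2 * s\<^sup>2)" by simp
    also have "\<dots> = (pi / c) / T\<^sup>2" unfolding s(2) by simp
    finally have "sqrt (2 * pi * s\<^sup>2) = sqrt (pi / c) / sqrt (T\<^sup>2)" by (simp only: real_sqrt_divide)
    then show ?thesis using assms by simp
  qed
  have pos: "sqrt (pi / c) / T > 0" using assms by simp
  have eq: "exp (- (c * T\<^sup>2 * (z - m)\<^sup>2)) = (sqrt (pi / c) / T) * normal_density m s z" for z
    using assms unfolding normal_density_def sq s(2) by simp
  have "(\<integral>\<^sup>+z. ennreal (exp (- (c * T\<^sup>2 * (z - m)\<^sup>2))) \<partial>lborel)
      = (\<integral>\<^sup>+z. ennreal (sqrt (pi / c) / T) * ennreal (normal_density m s z) \<partial>lborel)"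
    unfolding eq using pos by (intro nn_integral_cong ennreal_mult) (auto simp: less_imp_le)
  also have "\<dots> = ennreal (sqrt (pi / c) / T) * (\<integral>\<^sup>+z. ennreal (normal_density m s z) \<partial>lborel)"
    by (rule nn_integral_cmult) simp
  also have "(\<integral>\<^sup>+z. ennreal (normal_density m s z) \<partial>lborel) = 1"
    by (subst nn_integral_eq_integral[OF integrable_normal_density[OF s(1)]]) (simp_all add: s(1))
  finally show ?thesis by simp
qed

lemma integral_gaussian:
  assumes "T > 0" "c > 0"
  shows "(\<integral>z. exp (- (c * T\<^sup>2 * (z - m)\<^sup>2)) \<partial>lborel) = sqrt (pi / c) / T"
  using nn_integral_gaussian[OF assms] assms
  by (subst integral_eq_nn_integral) (auto simp: intro!: borel_measurable_continuous_onI continuous_intros)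

text \<open>If \<open>M\<close> gives mass at most \<open>r\<close> to every interval of length \<open>1 / T\<close>, this bounds its
  convolution with a Gaussian of width \<open>1 / T\<close>: cover the interval of radius
  \<open>(j + 1) / T\<close> by \<open>4 (j + 1)\<close> of the short ones.\<close>

lemma gaussian_integral_le:
  assumes M: "finite_borel M" and T: "T > 0" and r: "\<And>a. measure M {a<..<a + 1 / T} \<le> r"
  shows "(\<integral>x. exp (- (T\<^sup>2 * (x - z)\<^sup>2)) \<partial>M) \<le> 16 * r"
proof -
  interpret finite_measure M by (rule finite_borel_finite[OF M])
  have S: "sets M = sets borel" by (rule finite_borel_sets[OF M])
  define J where "J j = {z - real (Suc j) / T<..<z + real (Suc j) / T}" for j
  have J [measurable]: "J j \<in> sets M" for j by (simp add: J_def S)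
  have mJ: "measure M (J j) \<le> 4 * real (Suc j) * r" for j
  proof -
    \<comment> \<open>Steps of half the interval length make consecutive open intervals overlap, so
      no endpoint is missed.\<close>
    define a where "a k = z + (of_int k / 2) / T" for k :: int
    have "J j \<subseteq> (\<Union>k\<in>{- 2 * int (Suc j)..<2 * int (Suc j)}. {a k<..<a k + 1 / T})"
    proof
      fix y assume y: "y \<in> J j"
      define u where "u = 2 * T * (y - z)"
      define k where "k = \<lceil>u\<rceil> - 1"
      have k: "of_int k < u" "u \<le> of_int k + 1" unfolding k_def by linarith+
      have "- (2 * real (Suc j)) < u" "u < 2 * real (Suc j)"
        using y T by (auto simp: u_def J_def field_simps)
      then have "k \<in> {- 2 * int (Suc j)..<2 * int (Suc j)}" unfolding k_def by (auto simp: ceiling_less_iff less_ceiling_iff)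
      moreover have "a k < y" "y < a k + 1 / T" using k T by (auto simp: a_def u_def field_simps)
      ultimately show "y \<in> (\<Union>k\<in>{- 2 * int (Suc j)..<2 * int (Suc j)}. {a k<..<a k + 1 / T})" by auto
    qed
    then have "measure M (J j) \<le> measure M (\<Union>k\<in>{- 2 * int (Suc j)..<2 * int (Suc j)}. {a k<..<a k + 1 / T})"
      by (rule finite_measure_mono) (auto simp: S)
    also have "\<dots> \<le> (\<Sum>k\<in>{- 2 * int (Suc j)..<2 * int (Suc j)}. measure M {a k<..<a k + 1 / T})"
      by (rule finite_measure_subadditive_finite) (auto simp: S)
    also have "\<dots> \<le> (\<Sum>k\<in>{- 2 * int (Suc j)..<2 * int (Suc j)}. r)" by (intro sum_mono r)
    finally show ?thesis by simp
  qed
  have r0: "r \<ge> 0" using order_trans[OF measure_nonneg r] .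
  have le: "ennreal (exp (- (T\<^sup>2 * (x - z)\<^sup>2))) \<le> (\<Sum>j. ennreal ((1/2) ^ j) * indicator (J j) x)" for x
  proof -
    \<comment> \<open>In the shell \<open>j \<le> v < j + 1\<close> one has
      \<open>exp (- v^2) \<le> exp (- j) \<le> (1/2) ^ j\<close>; the crude last step leaves an
      easily summed series.\<close>
    define v where "v = T * \<bar>x - z\<bar>"
    define j where "j = nat \<lfloor>v\<rfloor>"
    have v0: "v \<ge> 0" using T by (simp add: v_def)
    have j: "real j \<le> v" "v < real (Suc j)" using v0 unfolding j_def by linarith+
    have "\<bar>x - z\<bar> < real (Suc j) / T" using j(2) T by (simp add: v_def field_simps)
    then have xJ: "x \<in> J j" by (auto simp: J_def)
    have "T\<^sup>2 * (x - z)\<^sup>2 = v\<^sup>2" by (simp add: v_def power_mult_distrib)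
    moreover have "real j \<le> (real j)\<^sup>2" by (cases j) (auto simp: power2_eq_square algebra_simps)
    moreover have "(real j)\<^sup>2 \<le> v\<^sup>2" using j(1) by (intro power_mono) auto
    ultimately have "real j \<le> T\<^sup>2 * (x - z)\<^sup>2" by linarith
    then have "exp (- (T\<^sup>2 * (x - z)\<^sup>2)) \<le> exp (- real j)" by simp
    also have "\<dots> = inverse (exp 1 ^ j)" by (simp add: exp_minus exp_of_nat_mult[symmetric])
    also have "\<dots> \<le> inverse (2 ^ j)"
      by (intro le_imp_inverse_le power_mono) (use exp_ge_add_one_self[of 1] in auto)
    finally have "exp (- (T\<^sup>2 * (x - z)\<^sup>2)) \<le> (1/2) ^ j" by (simp add: power_divide inverse_eq_divide)
    then have "ennreal (exp (- (T\<^sup>2 * (x - z)\<^sup>2))) \<le> ennreal ((1/2) ^ j) * indicator (J j) x"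
      using xJ by (simp add: ennreal_leI)
    also have "\<dots> \<le> (\<Sum>j. ennreal ((1/2) ^ j) * indicator (J j) x)"
    proof -
      have "f j \<le> suminf f" for f :: "nat \<Rightarrow> ennreal"
        using sum_le_suminf[OF summableI, of "{j}" f] by simp
      then show ?thesis .
    qed
    finally show ?thesis .
  qed
  \<comment> \<open>This 4, times the 4 in \<open>mJ\<close>, is the source of the constant
    16.\<close>
  have geo: "(\<lambda>j. real (Suc j) * (1/2) ^ j) sums 4"
    using geometric_deriv_sums[of "1/2 :: real"] by (simp add: power2_eq_square)
  have "(\<integral>\<^sup>+x. ennreal (exp (- (T\<^sup>2 * (x - z)\<^sup>2))) \<partial>M) \<le> (\<integral>\<^sup>+x. (\<Sum>j. ennreal ((1/2) ^ j) * indicator (J j) x) \<partial>M)"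
    by (rule nn_integral_mono) (rule le)
  also have "\<dots> = (\<Sum>j. \<integral>\<^sup>+x. ennreal ((1/2) ^ j) * indicator (J j) x \<partial>M)"
    by (rule nn_integral_suminf) measurable
  also have "\<dots> = (\<Sum>j. ennreal ((1/2) ^ j * measure M (J j)))"
    by (simp add: nn_integral_cmult emeasure_eq_measure ennreal_mult)
  also have "\<dots> \<le> (\<Sum>j. ennreal (4 * r * (real (Suc j) * (1/2) ^ j)))"
  proof (rule suminf_le[OF _ summableI summableI], rule ennreal_leI)
    fix j
    have "(1/2) ^ j * measure M (J j) \<le> (1/2) ^ j * (4 * real (Suc j) * r)" by (intro mult_left_mono mJ) simp
    then show "(1/2) ^ j * measure M (J j) \<le> 4 * r * (real (Suc j) * (1/2) ^ j)" by (simp add: mult_ac)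
  qed
  also have "\<dots> = ennreal (4 * r * 4)"
    by (intro suminf_ennreal_eq sums_mult geo) (use r0 in simp)
  finally have "(\<integral>\<^sup>+x. ennreal (exp (- (T\<^sup>2 * (x - z)\<^sup>2))) \<partial>M) \<le> ennreal (16 * r)" by (simp add: mult.commute)
  then show ?thesis
    using r0 by (intro integral_real_bounded) auto
qed

text \<open>A product of integrals becomes a double integral whose kernel arises by integrating
  \<open>u\<close> first. \<open>D\<close> bounds the inner integral uniformly, which with finite
  \<open>M\<close> and \<open>N\<close> justifies Fubini. Two measures occur because polarization
  creates cross terms.\<close>

lemma fubini_square:
  assumes M: "finite_borel M" and N: "finite_borel N" and W: "sigma_finite_measure W" "sets W = sets borel"
    and a [measurable]: "(\<lambda>(u, x). a u x) \<in> borel_measurable (borel \<Otimes>\<^sub>M borel)"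
    and a_bdd: "\<And>u x. cmod (a u x) \<le> B"
    and k: "\<And>x y. (\<integral>\<^sup>+u. ennreal (cmod (a u x * cnj (a u y))) \<partial>W) \<le> ennreal D"
  shows "integrable W (\<lambda>u. (\<integral>x. a u x \<partial>M) * cnj (\<integral>y. a u y \<partial>N))"
    and "(\<integral>u. (\<integral>x. a u x \<partial>M) * cnj (\<integral>y. a u y \<partial>N) \<partial>W)
       = (\<integral>x. (\<integral>y. (\<integral>u. a u x * cnj (a u y) \<partial>W) \<partial>N) \<partial>M)"
proof -
  interpret M: finite_measure M by (rule finite_borel_finite[OF M])
  interpret N: finite_measure N by (rule finite_borel_finite[OF N])
  interpret W: sigma_finite_measure W by (rule W)
  have [measurable_cong]: "sets M = sets borel" "sets N = sets borel" "sets W = sets borel"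
    using finite_borel_sets M N W(2) by auto
  interpret MN: pair_sigma_finite M N by standard
  interpret P: finite_measure "M \<Otimes>\<^sub>M N" by (rule finite_measure_pair_measure[OF finite_borel_finite[OF N] finite_borel_finite[OF M]])
  interpret WP: pair_sigma_finite W "M \<Otimes>\<^sub>M N" by standard
  have [measurable]: "cnj \<in> borel_measurable borel"
    by (intro borel_measurable_continuous_onI continuous_intros)
  have [measurable]: "a u \<in> borel_measurable borel" for u
    using measurable_Pair2[OF a, of u] by simp
  let ?f = "\<lambda>(u, x, y). a u x * cnj (a u y)"
  have f [measurable]: "?f \<in> borel_measurable (W \<Otimes>\<^sub>M (M \<Otimes>\<^sub>M N))" by measurable
  have int_f: "integrable (W \<Otimes>\<^sub>M (M \<Otimes>\<^sub>M N)) ?f"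
  proof (rule integrableI_bounded[OF f])
    have "(\<integral>\<^sup>+p. ennreal (norm (?f p)) \<partial>(W \<Otimes>\<^sub>M (M \<Otimes>\<^sub>M N)))
        = (\<integral>\<^sup>+q. (\<integral>\<^sup>+u. ennreal (norm (?f (u, q))) \<partial>W) \<partial>(M \<Otimes>\<^sub>M N))"
      by (rule WP.nn_integral_snd[symmetric]) measurable
    also have "\<dots> \<le> (\<integral>\<^sup>+q. ennreal D \<partial>(M \<Otimes>\<^sub>M N))"
      by (rule nn_integral_mono) (use k in \<open>auto simp: split_beta\<close>)
    also have "\<dots> = ennreal D * emeasure (M \<Otimes>\<^sub>M N) (space (M \<Otimes>\<^sub>M N))" by simp
    also have "\<dots> < \<infinity>"
      unfolding infinity_ennreal_def less_top[symmetric] ennreal_mult_eq_top_iff by simp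
    finally show "(\<integral>\<^sup>+p. ennreal (norm (?f p)) \<partial>(W \<Otimes>\<^sub>M (M \<Otimes>\<^sub>M N))) < \<infinity>" .
  qed
  have B0: "B \<ge> 0" using order_trans[OF norm_ge_zero a_bdd] .
  have prod: "(\<integral>q. ?f (u, q) \<partial>(M \<Otimes>\<^sub>M N)) = (\<integral>x. a u x \<partial>M) * cnj (\<integral>y. a u y \<partial>N)" for u
  proof -
    have [measurable]: "(\<lambda>q. ?f (u, q)) \<in> borel_measurable (M \<Otimes>\<^sub>M N)"
      by (simp add: split_beta')
    have "integrable (M \<Otimes>\<^sub>M N) (\<lambda>q. ?f (u, q))"
    proof (rule P.integrable_const_bound[where B = "B * B"])
      show "AE q in M \<Otimes>\<^sub>M N. norm (?f (u, q)) \<le> B * B"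
        by (auto simp: norm_mult split_beta intro!: mult_mono a_bdd B0)
    qed measurable
    then have "(\<integral>q. ?f (u, q) \<partial>(M \<Otimes>\<^sub>M N)) = (\<integral>x. (\<integral>y. a u x * cnj (a u y) \<partial>N) \<partial>M)"
      using MN.integral_fst'[of "\<lambda>q. ?f (u, q)"] by simp
    then show ?thesis by simp
  qed
  show "integrable W (\<lambda>u. (\<integral>x. a u x \<partial>M) * cnj (\<integral>y. a u y \<partial>N))"
    using WP.integrable_fst'[OF int_f] unfolding prod .
  have "(\<integral>u. (\<integral>x. a u x \<partial>M) * cnj (\<integral>y. a u y \<partial>N) \<partial>W) = (\<integral>u. (\<integral>q. ?f (u, q) \<partial>(M \<Otimes>\<^sub>M N)) \<partial>W)"
    unfolding prod ..
  also have "\<dots> = (\<integral>q. (\<integral>u. ?f (u, q) \<partial>W) \<partial>(M \<Otimes>\<^sub>M N))"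
    using WP.Fubini_integral[of "\<lambda>u q. ?f (u, q)"] int_f by simp
  also have "\<dots> = (\<integral>x. (\<integral>y. (\<integral>u. ?f (u, (x, y)) \<partial>W) \<partial>N) \<partial>M)"
  proof -
    have "integrable (M \<Otimes>\<^sub>M N) (\<lambda>q. \<integral>u. ?f (u, q) \<partial>W)"
      using WP.integrable_snd[of "\<lambda>u q. ?f (u, q)"] int_f by simp
    from MN.integral_fst'[OF this] show ?thesis by simp
  qed
  finally show "(\<integral>u. (\<integral>x. a u x \<partial>M) * cnj (\<integral>y. a u y \<partial>N) \<partial>W)
       = (\<integral>x. (\<integral>y. (\<integral>u. a u x * cnj (a u y) \<partial>W) \<partial>N) \<partial>M)" by simp
qed

section \<open>Plane waves and Gaussians\<close>

definition wave :: "real \<Rightarrow> real \<Rightarrow> complex"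
  where "wave t x = exp (- \<i> * complex_of_real x * complex_of_real t)"

lemma wave_eq_cis: "wave t x = cis (- (x * t))"
  by (simp add: wave_def cis_conv_exp mult.assoc)

lemma cmod_wave [simp]: "cmod (wave t x) = 1"
  by (simp add: wave_eq_cis)

lemma wave_measurable: "(\<lambda>(t, x). wave t x) \<in> borel_measurable (borel \<Otimes>\<^sub>M borel)"
proof -
  have "(\<lambda>p::real \<times> real. wave (fst p) (snd p)) \<in> borel_measurable borel"
    unfolding wave_eq_cis by (intro borel_measurable_continuous_onI continuous_intros)
  then show ?thesis by (simp add: borel_prod split_beta')
qed

lemma bounded_borel_wave: "bounded_borel (wave t)"
  unfolding wave_eq_cis[abs_def]
  by (intro bounded_borelI[where B = 1] borel_measurable_continuous_onI continuous_intros) auto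

definition gauss :: "real \<Rightarrow> real \<Rightarrow> real \<Rightarrow> real"
  where "gauss T z x = exp (- (T\<^sup>2 * (x - z)\<^sup>2))"

lemma gauss_measurable:
  "(\<lambda>p. gauss T (fst p) (snd p)) \<in> borel_measurable (borel \<Otimes>\<^sub>M borel)"
  "(\<lambda>(z, x). complex_of_real (gauss T z x)) \<in> borel_measurable (borel \<Otimes>\<^sub>M borel)"
proof -
  show *: "(\<lambda>p. gauss T (fst p) (snd p)) \<in> borel_measurable (borel \<Otimes>\<^sub>M borel)"
    unfolding borel_prod gauss_def by (intro borel_measurable_continuous_onI continuous_intros)
  show "(\<lambda>(z, x). complex_of_real (gauss T z x)) \<in> borel_measurable (borel \<Otimes>\<^sub>M borel)"
    using measurable_compose[OF * borel_measurable_of_real] by (simp add: split_beta')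
qed

lemma gauss_bounds: "0 < gauss T z x" "gauss T z x \<le> 1"
  by (auto simp: gauss_def)

lemma bounded_borel_gauss: "bounded_borel (\<lambda>x. complex_of_real (gauss T z x))"
  unfolding gauss_def
  by (intro bounded_borel_of_real[where B = 1] borel_measurable_continuous_onI continuous_intros) auto

text \<open>The left side is the characteristic function of the standard normal distribution at
  \<open>- T * (x - y)\<close>.\<close>

lemma wave_kernel:
  "(\<integral>u. wave (T * u) x * cnj (wave (T * u) y) \<partial>std_normal_distribution)
     = complex_of_real (exp (- (T\<^sup>2 * (x - y)\<^sup>2 / 2)))"
proof -
  have "wave (T * u) x * cnj (wave (T * u) y) = cis ((- T * (x - y)) * u)" for u
    by (simp add: wave_eq_cis cis_cnj cis_mult algebra_simps)
  then have "(\<integral>u. wave (T * u) x * cnj (wave (T * u) y) \<partial>std_normal_distribution)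
      = char std_normal_distribution (- T * (x - y))"
    by (simp add: char_def cis_conv_exp)
  also have "\<dots> = complex_of_real (exp (- (T\<^sup>2 * (x - y)\<^sup>2 / 2)))"
    unfolding char_std_normal_distribution by (simp add: power_mult_distrib)
  finally show ?thesis .
qed

text \<open>Completing the square in \<open>z\<close> isolates a factor that depends only on
  \<open>x - y\<close>, and this factor is the kernel of \<open>wave_kernel\<close>.\<close>

lemma gauss_mult: "gauss T z x * gauss T z y = exp (- (T\<^sup>2 * (x - y)\<^sup>2 / 2)) * exp (- (2 * T\<^sup>2 * (z - (x + y) / 2)\<^sup>2))"
proof -
  have "- (T\<^sup>2 * (x - z)\<^sup>2) + - (T\<^sup>2 * (y - z)\<^sup>2) = - (T\<^sup>2 * (x - y)\<^sup>2 / 2) + - (2 * T\<^sup>2 * (z - (x + y) / 2)\<^sup>2)"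
    by (simp add: power2_eq_square field_simps)
  then show ?thesis unfolding gauss_def exp_add[symmetric] by simp
qed

lemma gauss_kernel:
  assumes "T > 0"
  shows "(\<integral>z. complex_of_real (gauss T z x) * cnj (complex_of_real (gauss T z y)) \<partial>lborel)
     = complex_of_real (sqrt (pi / 2) / T * exp (- (T\<^sup>2 * (x - y)\<^sup>2 / 2)))"
proof -
  have "(\<integral>z. complex_of_real (gauss T z x) * cnj (complex_of_real (gauss T z y)) \<partial>lborel)
      = complex_of_real (\<integral>z. gauss T z x * gauss T z y \<partial>lborel)"
    unfolding integral_complex_of_real[symmetric] by simp
  also have "(\<integral>z. gauss T z x * gauss T z y \<partial>lborel) = exp (- (T\<^sup>2 * (x - y)\<^sup>2 / 2)) * (sqrt (pi / 2) / T)"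
    unfolding gauss_mult using integral_gaussian[OF assms, of 2] by simp
  finally show ?thesis by (simp add: mult.commute)
qed

context spectral_family begin

text \<open>The square of the polarization formula runs over sixteen pairs of measures. Keeping the
  scalar \<open>\<kappa>\<close> apart from \<open>K\<close> lets two families \<open>a\<close> with
  proportional kernels be compared through the same double sum.\<close>

lemma polar_integral_square:
  assumes W: "sigma_finite_measure W" "sets W = sets borel"
    and a: "(\<lambda>(u, x). a u x) \<in> borel_measurable (borel \<Otimes>\<^sub>M borel)"
    and a_bdd: "\<And>u x. cmod (a u x) \<le> B"
    and k: "\<And>x y. (\<integral>\<^sup>+u. ennreal (cmod (a u x * cnj (a u y))) \<partial>W) \<le> ennreal D"
    and K: "\<And>x y. (\<integral>u. a u x * cnj (a u y) \<partial>W) = complex_of_real \<kappa> * K x y"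
  shows "integrable W (\<lambda>u. (cmod (I (a u) g f))\<^sup>2)"
    and "complex_of_real (\<integral>u. (cmod (I (a u) g f))\<^sup>2 \<partial>W) = complex_of_real \<kappa> *
       (\<Sum>i<4::nat. \<Sum>j<4::nat. (\<i> ^ i / 4) * cnj (\<i> ^ j / 4) *
          (\<integral>x. (\<integral>y. K x y \<partial>\<mu> (f + \<i> ^ j *\<^sub>C g)) \<partial>\<mu> (f + \<i> ^ i *\<^sub>C g)))"
proof -
  let ?m = "\<lambda>i. \<mu> (f + \<i> ^ i *\<^sub>C g)"
  note fub = fubini_square[OF \<mu> \<mu> W a a_bdd k]
  have sq: "complex_of_real ((cmod (I (a u) g f))\<^sup>2) = (\<Sum>i<4::nat. \<Sum>j<4::nat. (\<i> ^ i / 4) * cnj (\<i> ^ j / 4) *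
      ((\<integral>x. a u x \<partial>?m i) * cnj (\<integral>y. a u y \<partial>?m j)))" for u
  proof -
    have I_eq: "I (a u) g f = (\<Sum>i<4::nat. (\<i> ^ i / 4) * (\<integral>x. a u x \<partial>?m i))"
      by (simp add: polar_integral_def sum_distrib_left)
    show ?thesis unfolding complex_norm_square I_eq cnj_sum sum_product by (simp add: mult_ac)
  qed
  have int: "integrable W (\<lambda>u. complex_of_real ((cmod (I (a u) g f))\<^sup>2))"
    unfolding sq by (intro Bochner_Integration.integrable_sum integrable_mult_right fub(1))
  then show "integrable W (\<lambda>u. (cmod (I (a u) g f))\<^sup>2)"
    using integrable_Re[OF int] by simp
  have "complex_of_real (\<integral>u. (cmod (I (a u) g f))\<^sup>2 \<partial>W)
      = (\<Sum>i<4::nat. \<Sum>j<4::nat. (\<i> ^ i / 4) * cnj (\<i> ^ j / 4) *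
          (\<integral>u. (\<integral>x. a u x \<partial>?m i) * cnj (\<integral>y. a u y \<partial>?m j) \<partial>W))"
    unfolding integral_complex_of_real[symmetric] sq
    by (simp only: Bochner_Integration.integral_sum Bochner_Integration.integrable_sum integrable_mult_right
        integral_mult_right_zero fub(1))
  also have "\<dots> = complex_of_real \<kappa> * (\<Sum>i<4::nat. \<Sum>j<4::nat. (\<i> ^ i / 4) * cnj (\<i> ^ j / 4) *
          (\<integral>x. (\<integral>y. K x y \<partial>?m j) \<partial>?m i))"
    unfolding fub(2) K sum_distrib_left by (simp add: mult_ac)
  finally show "complex_of_real (\<integral>u. (cmod (I (a u) g f))\<^sup>2 \<partial>W) = complex_of_real \<kappa> *
       (\<Sum>i<4::nat. \<Sum>j<4::nat. (\<i> ^ i / 4) * cnj (\<i> ^ j / 4) *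
          (\<integral>x. (\<integral>y. K x y \<partial>?m j) \<partial>?m i))" .
qed

text \<open>A substitute for Plancherel: both sides have the kernel \<open>exp (- L\<^sup>2 (x - y)\<^sup>2 / 2)\<close>
  with respect to the complex spectral measure of \<open>g\<close> and \<open>f\<close>.\<close>

lemma wave_gauss_plancherel:
  assumes L: "L > 0"
  shows "integrable std_normal_distribution (\<lambda>u. (cmod (I (wave (L * u)) g f))\<^sup>2)"
    and "integrable lborel (\<lambda>z. (cmod (I (\<lambda>x. complex_of_real (gauss L z x)) g f))\<^sup>2)"
    and "(\<integral>z. (cmod (I (\<lambda>x. complex_of_real (gauss L z x)) g f))\<^sup>2 \<partial>lborel)
       = sqrt (pi / 2) / L * (\<integral>u. (cmod (I (wave (L * u)) g f))\<^sup>2 \<partial>std_normal_distribution)"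
proof -
  interpret S: real_distribution std_normal_distribution by (rule real_dist_normal_dist)
  have wm: "(\<lambda>(u, x). wave (L * u) x) \<in> borel_measurable (borel \<Otimes>\<^sub>M borel)"
    using measurable_compose[OF _ wave_measurable, of "\<lambda>(u, x). (L * u, x)"] by (simp add: split_beta')
  have wb: "(\<integral>\<^sup>+u. ennreal (cmod (wave (L * u) x * cnj (wave (L * u) y))) \<partial>std_normal_distribution) \<le> ennreal 1" for x y
    using S.emeasure_space_1 by (simp add: norm_mult)
  note w = polar_integral_square[OF S.sigma_finite_measure_axioms _ wm _ wb, of 1 1 "\<lambda>x y. complex_of_real (exp (- (L\<^sup>2 * (x - y)\<^sup>2 / 2)))" g f]
  show w1: "integrable std_normal_distribution (\<lambda>u. (cmod (I (wave (L * u)) g f))\<^sup>2)"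
    by (rule w(1)) (simp_all add: wave_kernel)
  have gb: "(\<integral>\<^sup>+z. ennreal (cmod (complex_of_real (gauss L z x) * cnj (complex_of_real (gauss L z y)))) \<partial>lborel)
      \<le> ennreal (sqrt (pi / 1) / L)" for x y
  proof -
    have "(\<integral>\<^sup>+z. ennreal (cmod (complex_of_real (gauss L z x) * cnj (complex_of_real (gauss L z y)))) \<partial>lborel)
        \<le> (\<integral>\<^sup>+z. ennreal (exp (- (1 * L\<^sup>2 * (z - x)\<^sup>2))) \<partial>lborel)"
    proof (rule nn_integral_mono, rule ennreal_leI)
      fix z
      have "gauss L z x * gauss L z y \<le> gauss L z x * 1"
        using gauss_bounds[of L z x] gauss_bounds[of L z y] by (intro mult_left_mono) auto
      then show "cmod (complex_of_real (gauss L z x) * cnj (complex_of_real (gauss L z y))) \<le> exp (- (1 * L\<^sup>2 * (z - x)\<^sup>2))"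
        using gauss_bounds(1)[of L z x] gauss_bounds(1)[of L z y]
        by (simp add: norm_mult gauss_def power2_commute)
    qed
    also have "\<dots> = ennreal (sqrt (pi / 1) / L)" by (rule nn_integral_gaussian[OF L]) simp
    finally show ?thesis .
  qed
  note gs = polar_integral_square[OF lborel.sigma_finite_measure_axioms _ gauss_measurable(2) _ gb,
      of 1 "sqrt (pi / 2) / L" "\<lambda>x y. complex_of_real (exp (- (L\<^sup>2 * (x - y)\<^sup>2 / 2)))" g f]
  have gk: "(\<integral>z. complex_of_real (gauss L z x) * cnj (complex_of_real (gauss L z y)) \<partial>lborel)
     = complex_of_real (sqrt (pi / 2) / L) * complex_of_real (exp (- (L\<^sup>2 * (x - y)\<^sup>2 / 2)))" for x y
    unfolding gauss_kernel[OF L] by simp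
  have gn: "cmod (complex_of_real (gauss L z x)) \<le> 1" for z x
    using gauss_bounds[of L z x] by simp
  show "integrable lborel (\<lambda>z. (cmod (I (\<lambda>x. complex_of_real (gauss L z x)) g f))\<^sup>2)"
    by (rule gs(1)[OF _ gn gk]) simp
  have "complex_of_real (\<integral>z. (cmod (I (\<lambda>x. complex_of_real (gauss L z x)) g f))\<^sup>2 \<partial>lborel)
      = complex_of_real (sqrt (pi / 2) / L) * complex_of_real (\<integral>u. (cmod (I (wave (L * u)) g f))\<^sup>2 \<partial>std_normal_distribution)"
    by (subst gs(2)[OF _ gn gk], simp, subst w(2)) (simp_all add: wave_kernel)
  then show "(\<integral>z. (cmod (I (\<lambda>x. complex_of_real (gauss L z x)) g f))\<^sup>2 \<partial>lborel)
       = sqrt (pi / 2) / L * (\<integral>u. (cmod (I (wave (L * u)) g f))\<^sup>2 \<partial>std_normal_distribution)"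
    unfolding of_real_mult[symmetric] of_real_eq_iff .
qed

text \<open>The Gaussian is the square of the real function \<open>\<alpha>\<close>, so the form
  equals \<open>cinner (op \<alpha> g) (op \<alpha> f)\<close>; Cauchy-Schwarz then separates
  \<open>f\<close> and \<open>g\<close>.\<close>

lemma cmod_I_gauss_le:
  "(cmod (I (\<lambda>x. complex_of_real (gauss L z x)) g f))\<^sup>2 \<le> (\<integral>x. gauss L z x \<partial>\<mu> g) * (\<integral>x. gauss L z x \<partial>\<mu> f)"
proof -
  define \<alpha> where "\<alpha> x = complex_of_real (exp (- (L\<^sup>2 * (x - z)\<^sup>2 / 2)))" for x
  have b: "bounded_borel \<alpha>"
    unfolding \<alpha>_def[abs_def] by (intro bounded_borel_of_real[where B = 1] borel_measurable_continuous_onI continuous_intros) auto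
  have sq: "\<alpha> x * \<alpha> x = complex_of_real (gauss L z x)" for x
    unfolding \<alpha>_def gauss_def of_real_mult[symmetric] exp_add[symmetric] by simp
  have "cnj (\<alpha> x) = \<alpha> x" for x by (simp add: \<alpha>_def)
  then have "cinner (op \<alpha> g) (op \<alpha> f) = I (\<lambda>x. complex_of_real (gauss L z x)) g f"
    using op_mult[OF b b, of f] cinner_op[OF bounded_borel_gauss, of g L z f] by (simp add: op_adjoint[OF b] sq)
  then have "(cmod (I (\<lambda>x. complex_of_real (gauss L z x)) g f))\<^sup>2 \<le> (norm (op \<alpha> g) * norm (op \<alpha> f))\<^sup>2"
    using cmod_cinner_le[of "op \<alpha> g" "op \<alpha> f"] by (intro power_mono) auto
  also have "\<dots> = (\<integral>x. gauss L z x \<partial>\<mu> g) * (\<integral>x. gauss L z x \<partial>\<mu> f)"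
  proof -
    have "(cmod (\<alpha> x))\<^sup>2 = gauss L z x" for x
      unfolding \<alpha>_def gauss_def norm_of_real by (simp add: power2_eq_square exp_add[symmetric])
    then show ?thesis by (simp add: power_mult_distrib norm_op[OF b])
  qed
  finally show ?thesis .
qed

text \<open>Only the measure of \<open>f\<close> is known to be spread out, and it contributes at
  most \<open>16 * r\<close> for every \<open>z\<close>. The factor of \<open>g\<close> is
  integrated over \<open>z\<close> instead, where Tonelli gives the Gaussian integral
  \<open>sqrt pi / L\<close> times the total mass.\<close>

lemma gauss_average_le:
  assumes L: "L > 0" and r: "\<And>a. measure (\<mu> f) {a<..<a + 1 / L} \<le> r"
  shows "(\<integral>z. (cmod (I (\<lambda>x. complex_of_real (gauss L z x)) g f))\<^sup>2 \<partial>lborel) \<le> 16 * r * (sqrt pi / L) * (norm g)\<^sup>2"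
proof -
  have r0: "r \<ge> 0" using order_trans[OF measure_nonneg r] .
  interpret G: finite_measure "\<mu> g" by (rule finite_borel_finite[OF \<mu>])
  interpret LG: pair_sigma_finite lborel "\<mu> g" by standard
  have [measurable_cong]: "sets (\<mu> g) = sets borel" by (rule finite_borel_sets[OF \<mu>])
  have gm [measurable]: "(\<lambda>p. ennreal (gauss L (fst p) (snd p))) \<in> borel_measurable (lborel \<Otimes>\<^sub>M \<mu> g)"
    using gauss_measurable(1)[of L] by measurable
  have gi: "integrable (\<mu> g) (gauss L z)" for z
    using bounded_borel_integrable[OF \<mu> bounded_borel_gauss[of L z], of g] integrable_Re by force
  have le: "(cmod (I (\<lambda>x. complex_of_real (gauss L z x)) g f))\<^sup>2 \<le> 16 * r * (\<integral>x. gauss L z x \<partial>\<mu> g)" for z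
  proof -
    have "(\<integral>x. gauss L z x \<partial>\<mu> g) * (\<integral>x. gauss L z x \<partial>\<mu> f) \<le> (\<integral>x. gauss L z x \<partial>\<mu> g) * (16 * r)"
      using gaussian_integral_le[OF \<mu> L r, of z] gauss_bounds
      by (intro mult_left_mono) (auto simp: gauss_def less_imp_le)
    then show ?thesis using cmod_I_gauss_le[of L z g f] by (simp add: mult_ac)
  qed
  have "(\<integral>\<^sup>+z. ennreal ((cmod (I (\<lambda>x. complex_of_real (gauss L z x)) g f))\<^sup>2) \<partial>lborel)
      \<le> (\<integral>\<^sup>+z. ennreal (16 * r) * (\<integral>\<^sup>+x. ennreal (gauss L z x) \<partial>\<mu> g) \<partial>lborel)"
  proof (rule nn_integral_mono)
    fix z
    have "ennreal ((cmod (I (\<lambda>x. complex_of_real (gauss L z x)) g f))\<^sup>2) \<le> ennreal (16 * r * (\<integral>x. gauss L z x \<partial>\<mu> g))"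
      by (rule ennreal_leI[OF le])
    also have "\<dots> = ennreal (16 * r) * (\<integral>\<^sup>+x. ennreal (gauss L z x) \<partial>\<mu> g)"
      using r0 gauss_bounds(1) by (subst nn_integral_eq_integral[OF gi]) (auto simp: ennreal_mult' less_imp_le)
    finally show "ennreal ((cmod (I (\<lambda>x. complex_of_real (gauss L z x)) g f))\<^sup>2) \<le> ennreal (16 * r) * (\<integral>\<^sup>+x. ennreal (gauss L z x) \<partial>\<mu> g)" .
  qed
  also have "\<dots> = ennreal (16 * r) * (\<integral>\<^sup>+z. (\<integral>\<^sup>+x. ennreal (gauss L z x) \<partial>\<mu> g) \<partial>lborel)"
    by (rule nn_integral_cmult) (use G.borel_measurable_nn_integral_fst[OF gm] in simp)
  also have "(\<integral>\<^sup>+z. (\<integral>\<^sup>+x. ennreal (gauss L z x) \<partial>\<mu> g) \<partial>lborel) = (\<integral>\<^sup>+x. (\<integral>\<^sup>+z. ennreal (gauss L z x) \<partial>lborel) \<partial>\<mu> g)"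
    using LG.Fubini'[of "\<lambda>z x. ennreal (gauss L z x)"] gm by (simp add: split_beta')
  also have "\<dots> = (\<integral>\<^sup>+x. ennreal (sqrt pi / L) \<partial>\<mu> g)"
  proof (intro nn_integral_cong)
    fix x
    show "(\<integral>\<^sup>+z. ennreal (gauss L z x) \<partial>lborel) = ennreal (sqrt pi / L)"
      using nn_integral_gaussian[OF L, of 1 x] by (simp add: gauss_def power2_commute)
  qed
  also have "\<dots> = ennreal (sqrt pi / L * (norm g)\<^sup>2)"
    unfolding nn_integral_const finite_borel_space[OF \<mu>] G.emeasure_eq_measure measure_UNIV
    by (rule ennreal_mult[symmetric]) (use L in auto)
  also have "ennreal (16 * r) * \<dots> = ennreal (16 * r * (sqrt pi / L) * (norm g)\<^sup>2)"
    using r0 L by (subst ennreal_mult[symmetric]) (auto simp: mult_ac)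
  finally show ?thesis
    using r0 L by (intro integral_real_bounded) auto
qed

text \<open>The uniform weight on \<open>{0..L}\<close> is dominated by a multiple of the Gaussian
  weight in \<open>u = t / L\<close>, and for the latter \<open>wave_gauss_plancherel\<close> passes
  to energies.\<close>

lemma time_average_le:
  assumes L: "L > 0" and r: "\<And>a. measure (\<mu> f) {a<..<a + 1 / L} \<le> r"
  shows "time_average L (\<lambda>t. ennreal ((cmod (I (wave t) g f))\<^sup>2))
     \<le> ennreal (32 * sqrt pi * exp (1/2) * r * (norm g)\<^sup>2)"
proof -
  have r0: "r \<ge> 0" using order_trans[OF measure_nonneg r] .
  define c where "c t = (cmod (I (wave t) g f))\<^sup>2" for t
  have cm [measurable]: "c \<in> borel_measurable borel"
  proof -
    have "(\<lambda>t. \<integral>x. wave t x \<partial>\<mu> h) \<in> borel_measurable borel" for h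
    proof -
      interpret finite_measure "\<mu> h" by (rule finite_borel_finite[OF \<mu>])
      have [measurable_cong]: "sets (\<mu> h) = sets borel" by (rule finite_borel_sets[OF \<mu>])
      have [measurable]: "(\<lambda>(t, x). wave t x) \<in> borel_measurable (borel \<Otimes>\<^sub>M \<mu> h)"
        using wave_measurable by measurable
      show ?thesis by measurable
    qed
    then show ?thesis unfolding c_def[abs_def] polar_integral_def by measurable
  qed
  define Q where "Q = (\<integral>u. c (L * u) \<partial>std_normal_distribution)"
  have intQ: "integrable std_normal_distribution (\<lambda>u. c (L * u))"
    using wave_gauss_plancherel(1)[OF L, of g f] by (simp add: c_def)
  have "sqrt (pi / 2) / L * Q \<le> 16 * r * (sqrt pi / L) * (norm g)\<^sup>2"
    using gauss_average_le[OF L r, of g] wave_gauss_plancherel(3)[OF L, of g f] by (simp add: Q_def c_def)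
  \<comment> \<open>The factor \<open>sqrt 2\<close> is the ratio of \<open>sqrt pi\<close> to
    \<open>sqrt (pi / 2)\<close>; a second one, contained in \<open>d\<close>, completes 16 to
    32.\<close>
  then have "sqrt pi * Q \<le> sqrt pi * (sqrt 2 * (16 * r * (norm g)\<^sup>2))"
    using L by (simp add: real_sqrt_divide field_simps)
  then have Q: "Q \<le> sqrt 2 * (16 * r * (norm g)\<^sup>2)" by simp
  \<comment> \<open>The reciprocal of the normal density at 1, which is its minimum on
    \<open>{0..1}\<close>.\<close>
  define d where "d = sqrt (2 * pi) * exp (1/2 :: real)"
  have dens: "indicator {0..1} u \<le> d * std_normal_density u" for u :: real
  proof (cases "u \<in> {0..1}")
    case True
    then have "u\<^sup>2 \<le> 1" by (simp add: power_le_one)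
    then have "exp 0 \<le> exp (1/2) * exp (- u\<^sup>2 / 2)" unfolding exp_add[symmetric] by (subst exp_le_cancel_iff) simp
    then show ?thesis using True by (simp add: d_def std_normal_density_def)
  qed (simp add: d_def)
  have "(\<integral>\<^sup>+t\<in>{0..L}. ennreal (c t) \<partial>lborel)
      = ennreal L * (\<integral>\<^sup>+u. ennreal (c (L * u)) * indicator {0..L} (L * u) \<partial>lborel)"
    using nn_integral_real_affine[of "\<lambda>t. ennreal (c t) * indicator {0..L} t" L 0] L by simp
  also have "(\<integral>\<^sup>+u. ennreal (c (L * u)) * indicator {0..L} (L * u) \<partial>lborel)
      \<le> (\<integral>\<^sup>+u. ennreal d * (ennreal (std_normal_density u) * ennreal (c (L * u))) \<partial>lborel)"
  proof (rule nn_integral_mono)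
    fix u
    have c0: "c (L * u) \<ge> 0" by (simp add: c_def)
    have "indicator {0..L} (L * u) = (indicator {0..1} u :: real)"
      using L by (auto simp: indicator_def zero_le_mult_iff)
    then have "c (L * u) * indicator {0..L} (L * u) \<le> d * (std_normal_density u * c (L * u))"
      using mult_right_mono[OF dens c0] by (simp add: mult_ac)
    then have *: "ennreal (c (L * u) * indicator {0..L} (L * u)) \<le> ennreal (d * (std_normal_density u * c (L * u)))"
      by (rule ennreal_leI)
    then show "ennreal (c (L * u)) * indicator {0..L} (L * u) \<le> ennreal d * (ennreal (std_normal_density u) * ennreal (c (L * u)))"
    proof -
      have "d \<ge> 0" by (simp add: d_def)
      then have "ennreal d * (ennreal (std_normal_density u) * ennreal (c (L * u))) = ennreal (d * (std_normal_density u * c (L * u)))"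
        by (simp only: ennreal_mult'[symmetric] normal_density_nonneg)
      moreover have "ennreal (c (L * u)) * indicator {0..L} (L * u) = ennreal (c (L * u) * indicator {0..L} (L * u))"
        by (simp add: indicator_def)
      ultimately show ?thesis using * by simp
    qed
  qed
  also have "\<dots> = ennreal d * (\<integral>\<^sup>+u. ennreal (std_normal_density u) * ennreal (c (L * u)) \<partial>lborel)"
    by (rule nn_integral_cmult) measurable
  also have "(\<integral>\<^sup>+u. ennreal (std_normal_density u) * ennreal (c (L * u)) \<partial>lborel) = (\<integral>\<^sup>+u. ennreal (c (L * u)) \<partial>std_normal_distribution)"
    by (rule nn_integral_density[symmetric]) measurable
  also have "\<dots> = ennreal Q" unfolding Q_def by (rule nn_integral_eq_integral[OF intQ]) (simp add: c_def)
  finally have le: "(\<integral>\<^sup>+t\<in>{0..L}. ennreal (c t) \<partial>lborel) \<le> ennreal L * (ennreal d * ennreal Q)"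
    by (simp add: mult_left_mono)
  have "time_average L (\<lambda>t. ennreal (c t)) \<le> ennreal (1 / L) * (ennreal L * (ennreal d * ennreal Q))"
    unfolding time_average_def by (rule mult_left_mono[OF le]) simp
  also have "\<dots> = ennreal (d * Q)"
    using L by (simp add: mult.assoc[symmetric] ennreal_mult[symmetric] d_def Q_def c_def)
  also have "\<dots> \<le> ennreal (32 * sqrt pi * exp (1/2) * r * (norm g)\<^sup>2)"
  proof (rule ennreal_leI)
    have "d * Q \<le> d * (sqrt 2 * (16 * r * (norm g)\<^sup>2))" by (rule mult_left_mono[OF Q]) (simp add: d_def)
    also have "\<dots> = (sqrt 2 * sqrt 2) * (16 * sqrt pi * exp (1/2) * r * (norm g)\<^sup>2)"
      unfolding d_def real_sqrt_mult by (simp only: mult_ac)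
    finally show "d * Q \<le> 32 * sqrt pi * exp (1/2) * r * (norm g)\<^sup>2" by simp
  qed
  finally show ?thesis by (simp add: c_def)
qed

end

section \<open>The lower bound on the moments\<close>

definition trunc :: "'a set \<Rightarrow> 'a l2 \<Rightarrow> 'a l2"
  where "trunc B x = (\<Sum>n\<in>B. coord x n *\<^sub>C basis_vec n)"

lemma coord_trunc: "finite B \<Longrightarrow> coord (trunc B x) k = (if k \<in> B then coord x k else 0)"
  by (simp add: trunc_def coord_sum coord_simps coord_basis_vec delta_def if_distrib cong: if_cong)

lemma cinner_sum_right: "cinner u (\<Sum>n\<in>B. v n) = (\<Sum>n\<in>B. cinner u (v n))"
  by (induction B rule: infinite_finite_induct) (simp_all add: cinner_simps)

lemma cinner_trunc_right: "cinner u (trunc B v) = (\<Sum>n\<in>B. coord v n * cnj (coord u n))"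
proof -
  have "cinner u (basis_vec n) = cnj (coord u n)" for n
    by (metis cinner_commute cinner_basis_vec)
  then show ?thesis unfolding trunc_def cinner_sum_right by (simp add: cinner_scaleC_right)
qed

lemma cinner_trunc_left: "cinner (trunc B u) v = cinner u (trunc B v)"
proof -
  have "cinner (trunc B u) v = cnj (cinner v (trunc B u))" by (rule cinner_commute)
  then show ?thesis unfolding cinner_trunc_right by (simp add: mult.commute)
qed

lemma norm_trunc: "finite B \<Longrightarrow> (norm (trunc B v))\<^sup>2 = (\<Sum>n\<in>B. (cmod (coord v n))\<^sup>2)"
proof -
  assume B: "finite B"
  have "complex_of_real ((norm (trunc B v))\<^sup>2) = complex_of_real (\<Sum>n\<in>B. (cmod (coord v n))\<^sup>2)"
    unfolding cinner_self[symmetric] cinner_trunc_right of_real_sum complex_norm_square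
    by (intro sum.cong refl) (simp add: coord_trunc[OF B])
  then show ?thesis by (simp only: of_real_eq_iff)
qed

lemma norm_diff_trunc:
  assumes B: "finite B" shows "(norm (v - trunc B v))\<^sup>2 = (norm v)\<^sup>2 - (\<Sum>n\<in>B. (cmod (coord v n))\<^sup>2)"
proof -
  have tt: "trunc B (trunc B v) = trunc B v" by (rule l2_eqI) (simp add: coord_trunc[OF B])
  have 1: "cinner (trunc B v) v = cinner v (trunc B v)" by (rule cinner_trunc_left)
  have 2: "cinner (trunc B v) (trunc B v) = cinner v (trunc B v)" by (simp add: cinner_trunc_left tt)
  have "complex_of_real ((norm (v - trunc B v))\<^sup>2) = complex_of_real ((norm v)\<^sup>2 - (norm (trunc B v))\<^sup>2)"
    unfolding of_real_diff cinner_self[symmetric] by (simp add: cinner_simps 1 2)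
  then show ?thesis unfolding norm_trunc[OF B] of_real_eq_iff .
qed

text \<open>Inside \<open>B\<close> the overlap is limited by the mass of \<open>u\<close> there,
  outside by the mass of \<open>v\<close> there. So if \<open>u\<close> is nearly absent from
  \<open>B\<close>, an overlap forces \<open>v\<close> out of \<open>B\<close>. The factor 1/2 comes
  from \<open>(x + y)^2 \<le> 2 x^2 + 2 y^2\<close>.\<close>

lemma cmod_cinner_le_trunc:
  assumes B: "finite B"
  shows "(cmod (cinner u v))\<^sup>2 / 2
     \<le> (\<Sum>n\<in>B. (cmod (coord u n))\<^sup>2) * (norm v)\<^sup>2 + (norm u)\<^sup>2 * ((norm v)\<^sup>2 - (\<Sum>n\<in>B. (cmod (coord v n))\<^sup>2))"
proof -
  define x where "x = norm (trunc B u) * norm v"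
  define y where "y = norm u * norm (v - trunc B v)"
  have "cinner u v = cinner (trunc B u) v + cinner u (v - trunc B v)"
    by (simp add: cinner_simps cinner_trunc_left)
  then have "cmod (cinner u v) \<le> x + y"
    unfolding x_def y_def using cmod_cinner_le norm_triangle_mono by metis
  then have "(cmod (cinner u v))\<^sup>2 \<le> (x + y)\<^sup>2" by (intro power_mono) auto
  also have "\<dots> \<le> 2 * x\<^sup>2 + 2 * y\<^sup>2" using sum_squares_bound[of x y] by (simp add: power2_sum)
  finally show ?thesis
    by (simp add: x_def y_def power_mult_distrib norm_trunc[OF B] norm_diff_trunc[OF B])
qed

text \<open>Chebyshev's inequality: every site outside \<open>B\<close> carries weight at least
  \<open>N powr m\<close>.\<close>

lemma position_moment_ge:
  assumes B: "finite B" and m: "m > 0" and N: "N > 0" "\<And>n. n \<notin> B \<Longrightarrow> N \<le> lattice_norm n"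
  shows "ennreal (N powr m * ((norm v)\<^sup>2 - (\<Sum>n\<in>B. (cmod (coord v n))\<^sup>2))) \<le> position_moment m (coord v)"
proof -
  define w where "w = v - trunc B v"
  define h where "h n = N powr m * (cmod (coord w n))\<^sup>2" for n
  have sm: "(\<lambda>n. (cmod (coord w n))\<^sup>2) summable_on UNIV" using coord_ell2[of w] by (simp add: ell2_def)
  have "(norm w)\<^sup>2 = (\<Sum>\<^sub>\<infinity>n. (cmod (coord w n))\<^sup>2)" by (simp add: norm_eq_ell2_norm ell2_norm_def infsum_nonneg)
  then have "N powr m * ((norm v)\<^sup>2 - (\<Sum>n\<in>B. (cmod (coord v n))\<^sup>2)) = infsum h UNIV"
    unfolding norm_diff_trunc[OF B, symmetric] w_def[symmetric] h_def
    by (simp add: infsum_cmult_right[OF sm])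
  \<comment> \<open>The moment may be infinite, so the comparison is made through suprema over
    finite sets of sites.\<close>
  also have "ennreal \<dots> = (SUP F\<in>{F. finite F \<and> F \<subseteq> UNIV}. ennreal (sum h F))"
    by (rule infsum_nonneg_is_SUPREMUM_ennreal) (auto simp: h_def[abs_def] intro!: summable_on_cmult_right sm)
  also have "\<dots> \<le> (SUP F\<in>{F. finite F \<and> F \<subseteq> UNIV}. \<Sum>n\<in>F. ennreal (lattice_norm n powr m * (cmod (ell2_inner (delta n) (coord v)))\<^sup>2))"
  proof (rule SUP_mono', goal_cases)
    case (1 F)
    have "ennreal (sum h F) = (\<Sum>n\<in>F. ennreal (h n))" by (rule sum_ennreal[symmetric]) (simp add: h_def)
    also have "\<dots> \<le> (\<Sum>n\<in>F. ennreal (lattice_norm n powr m * (cmod (ell2_inner (delta n) (coord v)))\<^sup>2))"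
    proof (intro sum_mono ennreal_leI)
      fix n
      show "h n \<le> lattice_norm n powr m * (cmod (ell2_inner (delta n) (coord v)))\<^sup>2"
      proof (cases "n \<in> B")
        case True
        then have "h n = 0" by (simp add: h_def w_def coord_simps coord_trunc[OF B])
        then show ?thesis by simp
      next
        case False
        then have "h n = N powr m * (cmod (coord v n))\<^sup>2" by (simp add: h_def w_def coord_simps coord_trunc[OF B])
        also have "\<dots> \<le> lattice_norm n powr m * (cmod (coord v n))\<^sup>2"
          using N(2)[OF False] N(1) m by (intro mult_right_mono powr_mono2) auto
        finally show ?thesis by (simp add: ell2_inner_delta)
      qed
    qed
    finally show ?case .
  qed
  also have "\<dots> = position_moment m (coord v)"
    unfolding position_moment_def by (rule nonneg_infsum_complete[symmetric]) simp
  finally show ?thesis .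
qed

text \<open>The Euclidean ball sits in a cube, whose integer points form a product of
  intervals.\<close>

lemma finite_lattice_ball: "finite {n :: int ^ 'n. lattice_norm n \<le> N}"
  and card_lattice_ball: "N \<ge> 0 \<Longrightarrow> real (card {n :: int ^ 'n. lattice_norm n \<le> N}) \<le> (2 * N + 1) ^ CARD('n)"
proof -
  define A where "A = {- \<lfloor>N\<rfloor>..\<lfloor>N\<rfloor>}"
  have sub: "{n :: int ^ 'n. lattice_norm n \<le> N} \<subseteq> vec_lambda ` (UNIV \<rightarrow>\<^sub>E A)"
  proof
    fix n :: "int ^ 'n" assume "n \<in> {n. lattice_norm n \<le> N}"
    then have "\<bar>real_of_int (n $ i)\<bar> \<le> N" for i
      using component_le_norm_cart[of "\<chi> i. real_of_int (n $ i)" i] by (simp add: lattice_norm_def)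
    then have "n $ i \<le> \<lfloor>N\<rfloor>" "- (n $ i) \<le> \<lfloor>N\<rfloor>" for i by (simp_all add: abs_le_iff le_floor_iff)
    then have "n $ i \<in> A" for i unfolding A_def atLeastAtMost_iff by (metis minus_le_iff)
    then have "vec_nth n \<in> UNIV \<rightarrow>\<^sub>E A" by (simp add: PiE_def extensional_def)
    then show "n \<in> vec_lambda ` (UNIV \<rightarrow>\<^sub>E A)" by (metis image_eqI vec_nth_inverse)
  qed
  have fin: "finite ((UNIV :: 'n set) \<rightarrow>\<^sub>E A)" by (rule finite_PiE) (auto simp: A_def)
  then show "finite {n :: int ^ 'n. lattice_norm n \<le> N}" using sub finite_subset by blast
  assume N: "N \<ge> 0"
  have "card {n :: int ^ 'n. lattice_norm n \<le> N} \<le> card ((UNIV :: 'n set) \<rightarrow>\<^sub>E A)"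
    using sub fin card_image_le[OF fin, of vec_lambda] card_mono[OF finite_imageI[OF fin] sub] by linarith
  also have "\<dots> = card A ^ CARD('n)" by (simp add: card_PiE)
  finally have "real (card {n :: int ^ 'n. lattice_norm n \<le> N}) \<le> real (card A) ^ CARD('n)"
    by (metis of_nat_le_iff of_nat_power)
  also have "\<dots> \<le> (2 * N + 1) ^ CARD('n)"
  proof (rule power_mono)
    have "real (card A) = real_of_int (2 * \<lfloor>N\<rfloor> + 1)" using N by (simp add: A_def)
    then show "real (card A) \<le> 2 * N + 1" by linarith
  qed simp
  finally show "real (card {n :: int ^ 'n. lattice_norm n \<le> N}) \<le> (2 * N + 1) ^ CARD('n)" .
qed

lemma coord_tendsto: "X \<longlonglongrightarrow> x \<Longrightarrow> (\<lambda>k. coord (X k) n) \<longlonglongrightarrow> coord x n"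
  unfolding cinner_basis_vec[symmetric] by (intro tendsto_intros)

lemma time_average_mono:
  "(\<And>t. f t \<le> g t) \<Longrightarrow> time_average L f \<le> time_average L g"
  unfolding time_average_def by (intro mult_left_mono nn_integral_mono mult_right_mono) auto

lemma time_average_const: "L > 0 \<Longrightarrow> time_average L (\<lambda>_. ennreal c) = ennreal c"
  by (cases "c \<ge> 0")
    (simp_all add: time_average_def nn_integral_cmult_indicator ennreal_mult[symmetric] mult.commute[of _ "ennreal L"] ennreal_neg)

lemma time_average_add:
  assumes "f \<in> borel_measurable borel" "g \<in> borel_measurable borel"
  shows "time_average L (\<lambda>t. f t + g t) = time_average L f + time_average L g"
  using assms by (simp add: time_average_def distrib_right nn_integral_add distrib_left)

lemma time_average_cmult:
  assumes "f \<in> borel_measurable borel"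
  shows "time_average L (\<lambda>t. c * f t) = c * time_average L f"
  using assms by (simp add: time_average_def mult.assoc nn_integral_cmult mult.left_commute)

lemma time_average_sum:
  assumes "\<And>i. i \<in> A \<Longrightarrow> f i \<in> borel_measurable borel"
  shows "time_average L (\<lambda>t. \<Sum>i\<in>A. f i t) = (\<Sum>i\<in>A. time_average L (f i))"
  using assms
proof (induction A rule: infinite_finite_induct)
  case (insert i A)
  then show ?case by (simp add: time_average_add)
qed (simp_all add: time_average_def)

section \<open>The unitary group and the mass outside a finite set\<close>

context spectral_family begin

lemma norm_op_wave: "norm (op (wave t) f) = norm f"
proof -
  have "(norm (op (wave t) f))\<^sup>2 = (norm f)\<^sup>2"
    unfolding norm_op[OF bounded_borel_wave] by (simp add: finite_borel_space[OF \<mu>] measure_UNIV)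
  then show ?thesis by (simp add: power2_eq_iff_nonneg)
qed

lemma cinner_op_wave: "cinner (op (wave t) f) (op (wave t) g) = cinner f g"
  by (rule sesquilinear_diag_eqI[OF sesquilinear_cinner sesquilinear_cinner])
    (simp_all add: clinear_op bounded_borel_wave clinear_id cinner_self norm_op_wave)

lemma op_wave_add: "op (wave (s + t)) f = op (wave s) (op (wave t) f)"
proof -
  have "wave (s + t) = (\<lambda>x. wave s x * wave t x)" by (rule ext) (simp add: wave_eq_cis cis_mult algebra_simps)
  then show ?thesis by (simp add: op_mult bounded_borel_wave)
qed

lemma op_wave_tendsto: "u \<longlonglongrightarrow> t \<Longrightarrow> (\<lambda>n. op (wave (u n)) f) \<longlonglongrightarrow> op (wave t) f"
  by (rule op_tendsto[where B = 1]) (auto simp: bounded_borel_measurable bounded_borel_wave wave_def intro!: tendsto_intros)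

lemma continuous_coord_wave: "continuous_on S (\<lambda>t. coord (op (wave t) f) n)"
proof (rule continuous_at_imp_continuous_on, rule ballI)
  fix t show "isCont (\<lambda>t. coord (op (wave t) f) n) t"
    by (rule continuous_at_sequentiallyI) (intro coord_tendsto op_wave_tendsto)
qed

lemma I_basis_vec: "bounded_borel \<phi> \<Longrightarrow> I \<phi> (basis_vec n) f = coord (op \<phi> f) n"
  by (simp add: cinner_op[symmetric] cinner_basis_vec)

text \<open>Mass of the evolved state outside \<open>B\<close>; \<open>norm f\<close> stands for the
  norm at time \<open>t\<close>, by \<open>norm_op_wave\<close>.\<close>

definition escape :: "'a set \<Rightarrow> 'a l2 \<Rightarrow> real \<Rightarrow> real" where
  "escape B f t = (norm f)\<^sup>2 - (\<Sum>n\<in>B. (cmod (coord (op (wave t) f) n))\<^sup>2)"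

lemma continuous_escape: "continuous_on S (escape B f)"
  unfolding escape_def[abs_def] by (intro continuous_intros continuous_coord_wave)

lemma escape_measurable [measurable]: "escape B f \<in> borel_measurable borel"
  by (intro borel_measurable_continuous_onI continuous_escape)

lemma escape_nonneg: "finite B \<Longrightarrow> escape B f t \<ge> 0"
  using sum_coord_le_norm[of B "op (wave t) f"] by (simp add: escape_def norm_op_wave)

lemma escape_antimono: "finite B' \<Longrightarrow> B \<subseteq> B' \<Longrightarrow> escape B' f t \<le> escape B f t"
  unfolding escape_def by (simp add: sum_mono2)

text \<open>Unitarity keeps the overlap of the evolved vectors at \<open>a = (norm f)^2\<close>, so
  at each time the escaped mass of \<open>g\<close> and the mass of \<open>f\<close> in
  \<open>B\<close> divided by \<open>a\<close> add up to at least \<open>a / 2\<close>. The latter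
  averages to at most \<open>a / 4\<close>, since \<open>128 = 4 * 32\<close> with the 32 of
  \<open>time_average_le\<close>.\<close>

lemma escape_average_ge:
  assumes L: "L > 0" and r: "\<And>a. measure (\<mu> f) {a<..<a + 1 / L} \<le> r"
    and f: "f \<noteq> 0" "cinner f g = of_real ((norm f)\<^sup>2)" and g: "norm g = 1"
    and B: "finite B" "128 * sqrt pi * exp (1/2) * real (card B) * r \<le> (norm f)\<^sup>2 * (norm f)\<^sup>2"
  shows "time_average L (\<lambda>t. ennreal (escape B g t)) \<ge> ennreal ((norm f)\<^sup>2 / 4)"
proof -
  define a where "a = (norm f)\<^sup>2"
  have a: "a > 0" using f(1) by (simp add: a_def)
  define X where "X n t = (cmod (coord (op (wave t) f) n))\<^sup>2" for n t
  have Xm [measurable]: "X n \<in> borel_measurable borel" for n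
    unfolding X_def[abs_def] by (intro borel_measurable_continuous_onI continuous_intros continuous_coord_wave)
  define c where "c = 32 * sqrt pi * exp (1/2) * r"
  have "r \<ge> 0" using order_trans[OF measure_nonneg r] .
  then have c0: "c \<ge> 0" by (simp add: c_def)
  have X_le: "time_average L (\<lambda>t. ennreal (X n t)) \<le> ennreal c" for n
    using time_average_le[OF L r, of "basis_vec n"] by (simp add: X_def I_basis_vec bounded_borel_wave c_def)
  have "a / 2 \<le> escape B g t + (1 / a) * (\<Sum>n\<in>B. X n t)" for t
  proof -
    have "a\<^sup>2 / 2 \<le> (\<Sum>n\<in>B. X n t) + a * escape B g t"
      using cmod_cinner_le_trunc[OF B(1), of "op (wave t) f" "op (wave t) g"]
      by (simp add: cinner_op_wave f(2) norm_op_wave g X_def a_def escape_def norm_mult power2_eq_square[symmetric] norm_power)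
    then have "(1 / a) * (a\<^sup>2 / 2) \<le> (1 / a) * ((\<Sum>n\<in>B. X n t) + a * escape B g t)"
      using a by (intro mult_left_mono) auto
    then show ?thesis using a by (simp add: power2_eq_square distrib_left)
  qed
  then have "ennreal (a / 2) \<le> ennreal (escape B g t) + ennreal (1 / a) * (\<Sum>n\<in>B. ennreal (X n t))" for t
    using a by (simp add: ennreal_plus[symmetric] ennreal_mult'[symmetric] escape_nonneg[OF B(1)] sum_ennreal X_def sum_nonneg ennreal_leI del: ennreal_plus)
  then have "time_average L (\<lambda>_. ennreal (a / 2))
      \<le> time_average L (\<lambda>t. ennreal (escape B g t) + ennreal (1 / a) * (\<Sum>n\<in>B. ennreal (X n t)))"
    by (rule time_average_mono)
  also have "\<dots> = time_average L (\<lambda>t. ennreal (escape B g t)) + ennreal (1 / a) * (\<Sum>n\<in>B. time_average L (\<lambda>t. ennreal (X n t)))"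
    by (subst time_average_add; (subst time_average_cmult)?; (subst time_average_sum)?; measurable?) 
  also have "\<dots> \<le> time_average L (\<lambda>t. ennreal (escape B g t)) + ennreal (1 / a) * (\<Sum>n\<in>B. ennreal c)"
    by (intro add_left_mono mult_left_mono sum_mono X_le) auto
  also have "ennreal (1 / a) * (\<Sum>n\<in>B. ennreal c) = ennreal (real (card B) * c / a)"
    using a c0 by (simp add: ennreal_of_nat_eq_real_of_nat ennreal_mult[symmetric])
  also have "\<dots> \<le> ennreal (a / 4)"
  proof (rule ennreal_leI)
    have "4 * (real (card B) * c) \<le> a * a" using B(2) by (simp add: c_def a_def mult_ac)
    then show "real (card B) * c / a \<le> a / 4" using a by (simp add: field_simps)
  qed
  finally have le: "ennreal (a / 2) \<le> time_average L (\<lambda>t. ennreal (escape B g t)) + ennreal (a / 4)"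
    using L by (simp add: time_average_const add_left_mono)
  show ?thesis
  proof (cases "time_average L (\<lambda>t. ennreal (escape B g t))" rule: ennreal_cases)
    case (real q)
    then have "a / 2 \<le> q + a / 4" using le a by (simp add: ennreal_plus[symmetric] del: ennreal_plus)
    then show ?thesis using real a by (simp add: a_def[symmetric] ennreal_leI)
  qed simp
qed

text \<open>If the state stays at the site \<open>z\<close> up to time 1, then the state is an eigenvector of
  the evolution and stays there forever.\<close>

lemma escape_singleton_eq_0:
  assumes g: "norm g = 1" and z: "\<And>t. t \<in> {0..1} \<Longrightarrow> escape {z} g t = 0" and t: "t \<ge> 0"
  shows "escape {z} g t = 0"
proof -
  have span: "\<exists>c. op (wave s) g = c *\<^sub>C basis_vec z" if "s \<in> {0..1}" for s
  proof -
    have "(norm (op (wave s) g - trunc {z} (op (wave s) g)))\<^sup>2 = 0"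
      using norm_diff_trunc[of "{z}" "op (wave s) g"] z[OF that] by (simp add: escape_def norm_op_wave)
    then show ?thesis by (auto simp: trunc_def)
  qed
  have w0: "op (wave 0) g = g" using op_1[of g] by (simp add: wave_def[abs_def])
  obtain c0 where c0: "g = c0 *\<^sub>C basis_vec z" using span[of 0] w0 by auto
  have c0n: "cmod c0 = 1" using g c0 by (metis norm_scaleC norm_basis_vec mult.right_neutral)
  obtain c1 where c1: "op (wave 1) g = c1 *\<^sub>C basis_vec z" using span[of 1] by auto
  \<comment> \<open>At times 0 and 1 the state is a multiple of the same basis vector, so
    \<open>q\<close> is an eigenvalue of the time-one evolution. Integer times multiply by powers of
    \<open>q\<close>, and the fractional part of \<open>t\<close> falls back into
    \<open>{0..1}\<close>.\<close>
  define q where "q = c1 / c0"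
  have c0nz: "c0 \<noteq> 0" using c0n by auto
  have q: "op (wave 1) g = q *\<^sub>C g" unfolding c1 using c0 c0nz by (simp add: q_def)
  have step: "op (wave (real n)) g = (q ^ n) *\<^sub>C g" for n
  proof (induction n)
    case (Suc n)
    have "op (wave (real (Suc n))) g = op (wave (real n)) (op (wave 1) g)"
      using op_wave_add[of "real n" 1 g] by (simp add: add.commute)
    then show ?case using Suc by (simp add: q clinearD(5)[OF clinear_op[OF bounded_borel_wave]] mult.commute)
  qed (simp add: w0)
  define n where "n = nat \<lfloor>t\<rfloor>"
  define s where "s = t - real n"
  have s: "s \<in> {0..1}" "t = s + real n" unfolding s_def n_def using t by (auto; linarith)+
  obtain c where c: "op (wave s) g = c *\<^sub>C basis_vec z" using span[OF s(1)] by blast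
  have "op (wave t) g = (q ^ n * c) *\<^sub>C basis_vec z"
    unfolding s(2) op_wave_add step clinearD(5)[OF clinear_op[OF bounded_borel_wave]] c by simp
  then have eq: "op (wave t) g = (q ^ n * c) *\<^sub>C basis_vec z" .
  then have "cmod (q ^ n * c) = 1" using norm_op_wave[of t g] g by (metis norm_scaleC norm_basis_vec mult.right_neutral)
  then show ?thesis unfolding escape_def eq by (simp add: g coord_simps coord_basis_vec delta_def norm_mult)
qed

text \<open>Spectral projections are linear in the vector. In this form, supersets that serve
  different vectors can be intersected, and the projection of the intersection kills all
  combinations of these vectors.\<close>

lemma null_sets_completion_iff_op:
  "S \<in> null_sets (completion (\<mu> f)) \<longleftrightarrow> (\<exists>N\<in>sets borel. S \<subseteq> N \<and> op (indicator N) f = 0)"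
proof -
  have "N \<in> null_sets (\<mu> f) \<longleftrightarrow> N \<in> sets borel \<and> op (indicator N) f = 0" for N
  proof (cases "N \<in> sets borel")
    case True
    interpret finite_measure "\<mu> f" by (rule finite_borel_finite[OF \<mu>])
    show ?thesis using True measure_eq_norm_op[OF True, of f]
      by (auto simp: null_sets_def finite_borel_sets[OF \<mu>] emeasure_eq_measure)
  qed (simp add: null_sets_def finite_borel_sets[OF \<mu>])
  then show ?thesis unfolding null_sets_completion_iff2 by blast
qed

lemma op_indicator_Int_eq_0:
  assumes "S \<in> sets borel" "S' \<in> sets borel" "op (indicator S') f = 0" shows "op (indicator (S \<inter> S')) f = 0"
  using assms by (simp add: op_indicator_Int clinearD(2)[OF clinear_op] bounded_borel_indicator)

lemma norm_op_indicator_le: "S \<in> sets borel \<Longrightarrow> norm (op (indicator S) f) \<le> norm f"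
proof -
  assume S: "S \<in> sets borel"
  interpret finite_measure "\<mu> f" by (rule finite_borel_finite[OF \<mu>])
  have "(norm (op (indicator S) f))\<^sup>2 \<le> (norm f)\<^sup>2"
    using bounded_measure[of S] by (simp add: finite_borel_space[OF \<mu>] measure_UNIV measure_eq_norm_op[OF S])
  then show ?thesis by (rule power2_le_imp_le) simp
qed

lemma csubspace_rho_continuous: "csubspace {f. rho_continuous \<rho> (\<mu> f)}"
  unfolding csubspace_def
proof (intro conjI ballI allI)
  show "0 \<in> {f. rho_continuous \<rho> (\<mu> f)}"
    unfolding rho_continuous_def mem_Collect_eq null_sets_completion_iff_op
    by (intro allI impI bexI[of _ UNIV]) (simp_all add: op_1)
  fix x y c assume "x \<in> {f. rho_continuous \<rho> (\<mu> f)}" "y \<in> {f. rho_continuous \<rho> (\<mu> f)}"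
  then have xy: "rho_continuous \<rho> (\<mu> x)" "rho_continuous \<rho> (\<mu> y)" by auto
  show "x + c *\<^sub>C y \<in> {f. rho_continuous \<rho> (\<mu> f)}"
    unfolding rho_continuous_def mem_Collect_eq null_sets_completion_iff_op
  proof (intro allI impI)
    fix S assume "hausdorff_measure \<rho> S = 0"
    then obtain N N' where N: "N \<in> sets borel" "S \<subseteq> N" "op (indicator N) x = 0"
        and N': "N' \<in> sets borel" "S \<subseteq> N'" "op (indicator N') y = 0"
      using xy unfolding rho_continuous_def null_sets_completion_iff_op by meson
    have "op (indicator (N \<inter> N')) x = 0" "op (indicator (N \<inter> N')) y = 0"
      using op_indicator_Int_eq_0[OF N'(1) N(1) N(3)] op_indicator_Int_eq_0[OF N(1) N'(1) N'(3)] by (simp_all add: Int_commute)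
    then have "op (indicator (N \<inter> N')) (x + c *\<^sub>C y) = 0"
      using N(1) N'(1) by (simp add: clinearD(1)[OF clinear_op[OF bounded_borel_indicator]])
    then show "\<exists>N\<in>sets borel. S \<subseteq> N \<and> op (indicator N) (x + c *\<^sub>C y) = 0"
      using N N' by (intro bexI[of _ "N \<inter> N'"]) auto
  qed
qed

text \<open>The countable intersection of null supersets for the \<open>X n\<close> serves all of
  them at once; its projection is a contraction, so it annihilates the limit.\<close>

lemma closed_rho_continuous: "closed {f. rho_continuous \<rho> (\<mu> f)}"
  unfolding closed_sequential_limits
proof (intro allI impI, elim conjE)
  fix X l assume X: "\<forall>n. X n \<in> {f. rho_continuous \<rho> (\<mu> f)}" "X \<longlonglongrightarrow> l"
  show "l \<in> {f. rho_continuous \<rho> (\<mu> f)}"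
    unfolding rho_continuous_def mem_Collect_eq null_sets_completion_iff_op
  proof (intro allI impI)
    fix S assume "hausdorff_measure \<rho> S = 0"
    then have "\<forall>n. \<exists>N\<in>sets borel. S \<subseteq> N \<and> op (indicator N) (X n) = 0"
      using X(1) unfolding rho_continuous_def mem_Collect_eq null_sets_completion_iff_op by blast
    then obtain N where N: "\<And>n. N n \<in> sets borel" "\<And>n. S \<subseteq> N n" "\<And>n. op (indicator (N n)) (X n) = 0" by metis
    define A where "A = (\<Inter>n. N n)"
    have A: "A \<in> sets borel" "S \<subseteq> A" unfolding A_def using N by auto
    have "op (indicator A) (X n) = 0" for n
    proof -
      have "A \<inter> N n = A" by (auto simp: A_def)
      then show ?thesis using op_indicator_Int_eq_0[OF A(1) N(1) N(3), of n] by simp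
    qed
    then have "op (indicator A) (X n - l) = - op (indicator A) l" for n
      by (simp add: clinearD(4)[OF clinear_op[OF bounded_borel_indicator[OF A(1)]]])
    then have "norm (op (indicator A) l) \<le> norm (X n - l)" for n
      using norm_op_indicator_le[OF A(1), of "X n - l"] by simp
    moreover have "(\<lambda>n. norm (X n - l)) \<longlonglongrightarrow> 0" using X(2) by (simp add: LIM_zero tendsto_norm_zero)
    ultimately have "norm (op (indicator A) l) \<le> 0" by (intro LIMSEQ_le_const) auto
    then show "\<exists>N\<in>sets borel. S \<subseteq> N \<and> op (indicator N) l = 0" using A by auto
  qed
qed

text \<open>The sets \<open>Bd k\<close> decrease to a set of Hausdorff measure zero, where
  \<open>p\<close> has no mass, so the projections onto them tend to 0 on \<open>p\<close>. For some
  \<open>k\<close> the complement keeps a nonzero part of \<open>p\<close>, and there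
  \<open>measure_outside_heavy_set\<close> applies.\<close>

lemma uniformly_continuous_part:
  assumes \<rho>: "hausdorff_dimension_function \<rho>" and p: "rho_continuous \<rho> (\<mu> p)" "p \<noteq> 0"
  obtains A K where "A \<in> sets borel" "K > 0" "op (indicator A) p \<noteq> 0"
    "\<And>a b. a < b \<Longrightarrow> b - a \<le> 1 \<Longrightarrow> measure (\<mu> (op (indicator A) p)) {a<..<b} \<le> K * \<rho> (b - a)"
proof -
  define Bd where "Bd k = heavy_set (\<mu> p) \<rho> (real k)" for k :: nat
  have Bd: "Bd k \<in> sets borel" for k by (simp add: Bd_def)
  have "hausdorff_measure \<rho> (\<Inter>k. Bd k) = 0" unfolding Bd_def by (rule hausdorff_measure_heavy[OF \<mu> \<rho>])
  then obtain N where N: "N \<in> sets borel" "(\<Inter>k. Bd k) \<subseteq> N" "op (indicator N) p = 0"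
    using p(1) unfolding rho_continuous_def null_sets_completion_iff_op by blast
  have int: "(\<Inter>k. Bd k) \<in> sets borel" using Bd by (intro sets.countable_INT) auto
  have "(\<Inter>k. Bd k) \<inter> N = (\<Inter>k. Bd k)" using N(2) by blast
  then have 0: "op (indicator (\<Inter>k. Bd k)) p = 0" using op_indicator_Int_eq_0[OF int N(1) N(3)] by simp
  have "(\<lambda>k. op (indicator (Bd k)) p) \<longlonglongrightarrow> op (indicator (\<Inter>k. Bd k)) p"
  proof (rule op_tendsto[where B = 1])
    show "(\<lambda>k. indicator (Bd k) x) \<longlonglongrightarrow> (indicator (\<Inter>k. Bd k) x :: complex)" for x
      by (rule LIMSEQ_indicator_decseq) (auto simp: decseq_def Bd_def intro!: heavy_set_antimono[OF \<rho>])
  qed (use Bd in \<open>auto simp: indicator_def\<close>)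
  then have lim: "(\<lambda>k. op (indicator (Bd k)) p) \<longlonglongrightarrow> 0" by (simp add: 0)
  have compl: "op (indicator (- Bd k)) p = p - op (indicator (Bd k)) p" for k
  proof -
    have "indicator (- Bd k) = (\<lambda>x. 1 - indicator (Bd k) x :: complex)" by (auto simp: indicator_def)
    then show ?thesis using op_diff[OF bounded_borel_const bounded_borel_indicator[OF Bd], of 1 k p] by (simp add: op_1)
  qed
  \<comment> \<open>Strict positivity of \<open>k\<close> makes it usable as the constant
    \<open>K\<close>.\<close>
  have "\<exists>k>0. op (indicator (- Bd k)) p \<noteq> 0"
  proof (rule ccontr)
    assume "\<not> ?thesis"
    then have "op (indicator (- Bd k)) p = 0" if "k > 0" for k using that by blast
    then have "p - op (indicator (Bd k)) p = 0" if "k > 0" for k using that by (simp add: compl)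
    then have "eventually (\<lambda>k. op (indicator (Bd k)) p = p) sequentially"
      by (intro eventually_mono[OF eventually_gt_at_top[of 0]]) simp
    then have "(\<lambda>k. op (indicator (Bd k)) p) \<longlonglongrightarrow> p" by (rule tendsto_eventually)
    then show False using lim p(2) LIMSEQ_unique by blast
  qed
  then obtain k where k: "k > 0" "op (indicator (- Bd k)) p \<noteq> 0" by blast
  have cB: "- Bd k \<in> sets borel" using Bd by (simp add: borel_comp)
  have "measure (\<mu> (op (indicator (- Bd k)) p)) {a<..<b} \<le> real k * \<rho> (b - a)" if "a < b" "b - a \<le> 1" for a b
  proof -
    have "measure (\<mu> (op (indicator (- Bd k)) p)) {a<..<b} = (norm (op (indicator ({a<..<b} \<inter> - Bd k)) p))\<^sup>2"
      unfolding measure_eq_norm_op[OF borel_open[OF open_greaterThanLessThan]] by (simp add: op_indicator_Int cB)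
    also have "\<dots> = measure (\<mu> p) ({a<..<b} - Bd k)"
      using Bd by (subst measure_eq_norm_op) (auto simp: Diff_eq borel_comp)
    also have "\<dots> \<le> real k * \<rho> (b - a)"
      unfolding Bd_def by (rule measure_outside_heavy_set[OF \<mu> \<rho> _ that]) simp
    finally show ?thesis .
  qed
  with k cB show thesis by (intro that[of "- Bd k" "real k"]) auto
qed

end

text \<open>A lattice ball of radius comparable to \<open>\<rho> (1 / L) powr (- 1 / CARD('n))\<close> has too few
  sites to hold the uniformly continuous component \<open>f\<close> of the state \<open>g\<close>. For bounded \<open>L\<close> this
  radius may be too small to say anything, and the bound only expresses that \<open>g\<close> does not
  stay at the origin.\<close>

lemma position_moment_average_gt:
  fixes \<mu> :: "(int ^ 'n) l2 \<Rightarrow> real measure"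
  assumes sf: "spectral_family \<mu> G T" and \<rho>: "hausdorff_dimension_function \<rho>" and m: "m > 0"
    and f: "f \<noteq> 0" "cinner f g = of_real ((norm f)\<^sup>2)" and g: "norm g = 1"
    and K: "K > 0" "\<And>a b. a < b \<Longrightarrow> b - a \<le> 1 \<Longrightarrow> measure (\<mu> f) {a<..<b} \<le> K * \<rho> (b - a)"
  shows "\<exists>C>0. \<forall>L>1. time_average L (\<lambda>t. position_moment m (coord (spectral_family.op \<mu> (wave t) g)))
      > ennreal (C * \<rho> (1 / L) powr (- m / real CARD('n)))"
proof -
  interpret spectral_family \<mu> G T by (rule sf)
  note \<rho>D = hausdorff_dimension_functionD[OF \<rho>]
  define a where "a = (norm f)\<^sup>2"
  define S where "S = 128 * sqrt pi * exp (1/2 :: real)"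
  define d where "d = CARD('n)"
  \<comment> \<open>The number of sites that \<open>escape_average_ge\<close> tolerates with
    \<open>r = K * \<rho> (1 / L)\<close>.\<close>
  define q where "q L = a * a / (S * K * \<rho> (1 / L))" for L
  define B where "B N = {n :: int ^ 'n. lattice_norm n \<le> N}" for N
  define P where "P t = position_moment m (coord (op (wave t) g))" for t
  have pos: "a > 0" "S > 0" "d > 0" using f(1) by (simp_all add: a_def S_def d_def)
  have \<rho>0: "\<rho> (1 / L) > 0" if "L > 1" for L using that \<rho>D(1)[of "1 / L"] by simp
  have q0: "q L > 0" if "L > 1" for L using \<rho>0[OF that] pos K(1) by (simp add: q_def)
  have fB: "finite (B N)" for N unfolding B_def by (rule finite_lattice_ball)
  have P_ge: "ennreal (N powr m * escape (B N) g t) \<le> P t" if "N > 0" for N t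
    using position_moment_ge[OF fB m that, of N "op (wave t) g"]
    by (simp add: P_def escape_def norm_op_wave B_def not_le less_imp_le)
  \<comment> \<open>Solves \<open>(2 * N L + 1) ^ d = q L\<close>, so that
    \<open>card_lattice_ball\<close> gives at most \<open>q L\<close> sites.\<close>
  define N where "N L = (q L powr (1 / d) - 1) / 2" for L
  \<comment> \<open>The threshold \<open>3 ^ d\<close> means
    \<open>q L powr (1 / d) \<ge> 3\<close>; since \<open>(x - 1) / 2 \<ge> x / 3\<close> for
    \<open>x \<ge> 3\<close>, the subtraction of 1 in \<open>N L\<close> costs only a constant
    factor.\<close>
  have large: "ennreal (a / 4) \<le> time_average L (\<lambda>t. ennreal (escape (B (N L)) g t))" "q L powr (1 / d) / 3 \<le> N L" "N L > 0"
    if L: "L > 1" and qL: "q L \<ge> 3 ^ d" for L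
  proof -
    have "(3 ^ d) powr (1 / d) \<le> q L powr (1 / d)" using qL by (intro powr_mono2) auto
    then have q3: "3 \<le> q L powr (1 / d)" using pos by (simp add: powr_realpow[symmetric] powr_powr)
    then show "q L powr (1 / d) / 3 \<le> N L" and N0: "N L > 0" by (simp_all add: N_def)
    have "2 * N L + 1 = q L powr (1 / d)" unfolding N_def by argo
    then have "(2 * N L + 1) ^ d = (q L powr (1 / d)) ^ d" by (simp only:)
    also have "\<dots> = (q L powr (1 / d)) powr d"
      by (rule powr_realpow[symmetric]) (use q0[OF L] in simp)
    also have "\<dots> = q L" using q0[OF L] pos by (simp add: powr_powr)
    finally have card: "real (card (B (N L))) \<le> q L" using card_lattice_ball[of "N L", where 'n = 'n] N0 by (simp add: B_def d_def)
    have r: "measure (\<mu> f) {b<..<b + 1 / L} \<le> K * \<rho> (1 / L)" for b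
      using K(2)[of b "b + 1 / L"] L by simp
    have "S * real (card (B (N L))) * (K * \<rho> (1 / L)) \<le> S * q L * (K * \<rho> (1 / L))"
      using card pos K(1) \<rho>0[OF L] by (intro mult_right_mono mult_left_mono) auto
    also have "\<dots> = a * a" using pos K(1) \<rho>0[OF L] by (simp add: q_def)
    finally show "ennreal (a / 4) \<le> time_average L (\<lambda>t. ennreal (escape (B (N L)) g t))"
      unfolding a_def by (intro escape_average_ge[OF _ r f g fB]) (use L in \<open>simp_all add: S_def a_def\<close>)
  qed
  define C1 where "C1 = (a * a / (S * K)) powr (m / d) / 3 powr m * (a / 4)"
  have C1: "C1 > 0" using pos K(1) by (simp add: C1_def)
  have P_large: "ennreal (C1 * \<rho> (1 / L) powr (- m / d)) \<le> time_average L P" if L: "L > 1" and qL: "q L \<ge> 3 ^ d" for L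
  proof -
    note l = large[OF L qL]
    have "q L = a * a / (S * K) / \<rho> (1 / L)" by (simp add: q_def)
    then have "q L powr (m / d) = (a * a / (S * K)) powr (m / d) / \<rho> (1 / L) powr (m / d)"
      using pos K(1) \<rho>0[OF L] by (simp only:) (intro powr_divide; simp)
    then have "C1 * \<rho> (1 / L) powr (- m / d) = q L powr (m / d) / 3 powr m * (a / 4)"
      by (simp add: C1_def powr_minus field_simps)
    also have "q L powr (m / d) / 3 powr m = (q L powr (1 / d) / 3) powr m"
      using q0[OF L] by (simp add: powr_divide powr_powr)
    also have "\<dots> * (a / 4) \<le> N L powr m * (a / 4)"
      using l(2) q0[OF L] m pos by (intro mult_right_mono powr_mono2) auto
    finally have "ennreal (C1 * \<rho> (1 / L) powr (- m / d)) \<le> ennreal (N L powr m) * ennreal (a / 4)"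
      using pos by (simp add: ennreal_mult[symmetric] ennreal_leI)
    also have "\<dots> \<le> ennreal (N L powr m) * time_average L (\<lambda>t. ennreal (escape (B (N L)) g t))"
      by (rule mult_left_mono[OF l(1)]) simp
    also have "\<dots> = time_average L (\<lambda>t. ennreal (N L powr m * escape (B (N L)) g t))"
      by (subst time_average_cmult[symmetric]) (simp_all add: ennreal_mult escape_nonneg[OF fB])
    also have "\<dots> \<le> time_average L P" by (rule time_average_mono[OF P_ge[OF l(3)]])
    finally show ?thesis .
  qed
  \<comment> \<open>\<open>q L\<close> tends to infinity because \<open>\<rho>\<close> tends to 0 at
    0; only \<open>L < L0\<close> remains for separate treatment.\<close>
  obtain L0 where L0: "L0 > 1" "\<And>L. L \<ge> L0 \<Longrightarrow> q L \<ge> 3 ^ d"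
  proof -
    have "(\<rho> \<longlongrightarrow> 0) (at_right 0)" using \<rho> by (simp add: hausdorff_dimension_function_def)
    moreover have e0: "a * a / (S * K * 3 ^ d) > 0" using pos K(1) by simp
    ultimately have "eventually (\<lambda>x. \<rho> x < a * a / (S * K * 3 ^ d)) (at_right 0)"
      by (rule order_tendstoD(2))
    then obtain \<delta> where \<delta>: "\<delta> > 0" "\<And>x. 0 < x \<Longrightarrow> x < \<delta> \<Longrightarrow> \<rho> x < a * a / (S * K * 3 ^ d)"
      unfolding eventually_at_right_field by auto
    have "q L \<ge> 3 ^ d" if L: "L \<ge> max 2 (2 / \<delta>)" for L
    proof -
      have L': "L > 1" "2 / \<delta> \<le> L" using L by auto
      then have "1 / L < \<delta>" using \<delta>(1) by (simp add: field_simps)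
      then have "\<rho> (1 / L) < a * a / (S * K * 3 ^ d)" using \<delta>(2)[of "1 / L"] L' by simp
      then show ?thesis using pos K(1) \<rho>0[OF L'(1)] by (simp add: q_def field_simps)
    qed
    then show thesis by (intro that[of "max 2 (2 / \<delta>)"]) auto
  qed
  \<comment> \<open>The ball of radius 1/2 is the origin alone, and all other sites have norm at
    least 1/2, so \<open>P_ge\<close> applies with \<open>N = 1/2\<close>.\<close>
  define F where "F = escape (B (1/2)) g"
  have F0: "F t \<ge> 0" for t unfolding F_def by (rule escape_nonneg[OF fB])
  have norm_0: "lattice_norm (0 :: int ^ 'n) = 0" by (simp add: lattice_norm_def zero_vec_def[symmetric])
  have B_half: "B (1/2) = {0}"
  proof -
    have "n = 0" if "lattice_norm n \<le> 1/2" for n :: "int ^ 'n"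
    proof -
      have "\<bar>real_of_int (n $ i)\<bar> \<le> 1/2" for i
        using component_le_norm_cart[of "\<chi> i. real_of_int (n $ i)" i] that by (simp add: lattice_norm_def)
      then have "n $ i = 0" for i by (smt (verit) field_sum_of_halves of_int_1_le_iff of_int_minus)
      then show ?thesis by (simp add: vec_eq_iff)
    qed
    with norm_0 show ?thesis by (auto simp: B_def)
  qed
  define J where "J = integral {0..1} F"
  have cF: "continuous_on {0..1} F" unfolding F_def by (rule continuous_escape)
  have hJ: "(F has_integral J) {0..1}"
    unfolding J_def by (intro integrable_integral integrable_continuous_interval cF)
  have si: "set_integrable lborel {0..1} F" by (rule borel_integrable_atLeastAtMost'[OF cF])
  have nJ: "(\<integral>\<^sup>+t\<in>{0..1}. ennreal (F t) \<partial>lborel) = ennreal J"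
  proof -
    have "(\<integral>\<^sup>+t\<in>{0..1}. ennreal (F t) \<partial>lborel) = (\<integral>\<^sup>+t. ennreal (indicator {0..1} t *\<^sub>R F t) \<partial>lborel)"
      by (intro nn_integral_cong) (simp add: indicator_def)
    also have "\<dots> = ennreal (LINT t:{0..1}|lborel. F t)"
      unfolding set_lebesgue_integral_def using si F0
      by (intro nn_integral_eq_integral) (auto simp: set_integrable_def)
    finally show ?thesis unfolding J_def set_borel_integral_eq_integral(2)[OF si] .
  qed
  have "J \<ge> 0" by (rule has_integral_nonneg[OF hJ]) (simp add: F0)
  \<comment> \<open>If \<open>J\<close> vanished, continuity would keep the state at the origin on
    \<open>{0..1}\<close>, hence forever; then nothing would escape from the larger ball at
    \<open>L0\<close>, against \<open>large\<close>.\<close>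
  moreover have "J \<noteq> 0"
  proof
    assume "J = 0"
    then have "F t = 0" if "t \<in> {0..1}" for t
      using has_integral_0_cbox_imp_0[of 0 1 F t] cF hJ F0 that by (simp add: box_real)
    then have F_0: "F t = 0" if "t \<ge> 0" for t
      using escape_singleton_eq_0[OF g, of 0 t] that unfolding F_def B_half by blast
    have "{0} \<subseteq> B (N L0)"
      using large(3)[OF L0(1) L0(2)[OF order_refl]] norm_0 unfolding B_def by simp
    then have le: "escape (B (N L0)) g t \<le> F t" for t unfolding F_def B_half by (rule escape_antimono[OF fB])
    have "time_average L0 (\<lambda>t. ennreal (escape (B (N L0)) g t)) = ennreal (1 / L0) * (\<integral>\<^sup>+t. 0 \<partial>(lborel :: real measure))"
      unfolding time_average_def
    proof (intro arg_cong2[where f = "(*)"] nn_integral_cong refl)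
      fix t
      show "ennreal (escape (B (N L0)) g t) * indicator {0..L0} t = 0"
        using le[of t] F_0[of t] by (auto simp: indicator_def ennreal_neg)
    qed
    then show False using large(1)[OF L0(1) L0(2)[OF order_refl]] pos by simp
  qed
  ultimately have J: "J > 0" by simp
  \<comment> \<open>For \<open>1 < L < L0\<close> the window \<open>{0..L}\<close> contains
    \<open>{0..1}\<close> and \<open>1 / L\<close> exceeds \<open>1 / L0\<close>.\<close>
  define c2 where "c2 = (1/2) powr m * (J / L0)"
  have c2: "c2 > 0" using J L0(1) by (simp add: c2_def)
  have P_small: "ennreal c2 \<le> time_average L P" if L: "1 < L" "L < L0" for L
  proof -
    have "ennreal c2 = ennreal ((1/2) powr m) * (ennreal (1 / L0) * ennreal J)"
      using J L0(1) by (simp add: c2_def ennreal_mult[symmetric])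
    also have "\<dots> \<le> ennreal ((1/2) powr m) * (ennreal (1 / L) * (\<integral>\<^sup>+t\<in>{0..L}. ennreal (F t) \<partial>lborel))"
      unfolding nJ[symmetric] using L
      by (intro mult_left_mono mult_mono nn_integral_mono ennreal_leI) (auto simp: indicator_def frac_le)
    also have "\<dots> = time_average L (\<lambda>t. ennreal ((1/2) powr m * F t))"
      unfolding time_average_def[symmetric]
      by (subst time_average_cmult[symmetric]) (simp_all add: ennreal_mult F0, simp add: F_def)
    also have "\<dots> \<le> time_average L P"
      unfolding F_def by (rule time_average_mono[OF P_ge]) simp
    finally show ?thesis .
  qed
  \<comment> \<open>For \<open>L < L0\<close> monotonicity of \<open>\<rho>\<close> bounds the power
    of \<open>\<rho> (1 / L)\<close> by its value at \<open>L0\<close>, to which \<open>c2\<close>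
    is calibrated.\<close>
  define C2 where "C2 = c2 / \<rho> (1 / L0) powr (- m / d)"
  have C2: "C2 > 0" using c2 \<rho>0[OF L0(1)] by (simp add: C2_def)
  \<comment> \<open>Halving turns the weak bounds into strict ones.\<close>
  define C where "C = min C1 C2 / 2"
  have C: "C > 0" "C < C1" "C < C2" using C1 C2 by (simp_all add: C_def min_def)
  have "ennreal (C * \<rho> (1 / L) powr (- m / d)) < time_average L P" if L: "L > 1" for L
  proof (cases "L \<ge> L0")
    case True
    have "C * \<rho> (1 / L) powr (- m / d) < C1 * \<rho> (1 / L) powr (- m / d)"
      using C(2) \<rho>0[OF L] by (intro mult_strict_right_mono) auto
    then have "ennreal (C * \<rho> (1 / L) powr (- m / d)) < ennreal (C1 * \<rho> (1 / L) powr (- m / d))"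
      using C1 \<rho>0[OF L] by (intro ennreal_lessI) auto
    also have "\<dots> \<le> time_average L P" by (rule P_large[OF L L0(2)[OF True]])
    finally show ?thesis .
  next
    case False
    have "\<rho> (1 / L0) \<le> \<rho> (1 / L)" using False L L0(1) by (intro \<rho>D(2)) (auto simp: field_simps)
    then have "\<rho> (1 / L) powr (- m / d) \<le> \<rho> (1 / L0) powr (- m / d)"
      using m \<rho>0[OF L0(1)] by (intro powr_mono2') auto
    then have "C * \<rho> (1 / L) powr (- m / d) \<le> C * \<rho> (1 / L0) powr (- m / d)"
      using C(1) by (intro mult_left_mono) auto
    also have "\<dots> < C2 * \<rho> (1 / L0) powr (- m / d)"
      using C(3) \<rho>0[OF L0(1)] by (intro mult_strict_right_mono) auto
    also have "\<dots> = c2" using \<rho>0[OF L0(1)] by (simp add: C2_def)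
    finally have "ennreal (C * \<rho> (1 / L) powr (- m / d)) < ennreal c2" using c2 by (intro ennreal_lessI) auto
    also have "\<dots> \<le> time_average L P" using False L by (intro P_small) auto
    finally show ?thesis .
  qed
  then show ?thesis using C(1) unfolding P_def[abs_def] d_def by blast
qed

theorem theorem2p6:
  fixes D :: "(int ^ 'n \<Rightarrow> complex) set"
    and H :: "(int ^ 'n \<Rightarrow> complex) \<Rightarrow> int ^ 'n \<Rightarrow> complex"
    and \<rho> :: "real \<Rightarrow> real"
    and \<psi> :: "int ^ 'n \<Rightarrow> complex"
    and m :: real
  assumes "self_adjoint D H"
    and "hausdorff_dimension_function \<rho>"
    and "\<psi> \<in> ell2" and "ell2_norm \<psi> = 1"
    and "orth_proj (rho_continuous_subspace \<rho> D H) \<psi> \<noteq> (\<lambda>_. 0)"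
    and "m > 0"
  shows "\<exists>C>0. \<forall>T>1.
    time_average T (\<lambda>t. position_moment m (evolution D H \<psi> t))
      > ennreal (C * \<rho> (1 / T) powr (- m / real CARD('n)))"
proof -
  define \<mu> where "\<mu> f = spectral_measure D H (coord f)" for f
  define g where "g = vec \<psi>"
  have sf: "spectral_family \<mu> {indicator S | S. S \<in> sets borel}
      (\<lambda>\<gamma> f. vec (spectral_resolution D H {x. \<gamma> x = 1} (coord f)))"
    using spectral_family_spectral_measure[OF assms(1)] by (simp add: \<mu>_def[abs_def])
  interpret spectral_family \<mu> "{indicator S | S. S \<in> sets borel}"
      "\<lambda>\<gamma> f. vec (spectral_resolution D H {x. \<gamma> x = 1} (coord f))" by (rule sf)
  have \<psi>: "coord g = \<psi>" using assms(3) by (simp add: g_def vec_inverse)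
  have g: "norm g = 1" by (simp add: norm_eq_ell2_norm \<psi> assms(4))
  define M where "M = {f. rho_continuous \<rho> (\<mu> f)}"
  have M: "rho_continuous_subspace \<rho> D H = coord ` M"
  proof -
    have "h \<in> coord ` M" if "h \<in> ell2" "rho_continuous \<rho> (spectral_measure D H h)" for h
      using that by (intro image_eqI[of _ _ "vec h"]) (simp_all add: M_def \<mu>_def vec_inverse)
    then show ?thesis by (auto simp: rho_continuous_subspace_def M_def \<mu>_def)
  qed
  have subM: "csubspace M" unfolding M_def by (rule csubspace_rho_continuous)
  obtain p where p: "p \<in> M" "\<And>h. h \<in> M \<Longrightarrow> cinner h (g - p) = 0"
    using orthogonal_projection_exists[OF subM, of g] closed_rho_continuous[of \<rho>] unfolding M_def by metis
  \<comment> \<open>\<open>orth_proj\<close> is a definite description, so uniqueness of the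
    projection has to be shown along with existence.\<close>
  have "orth_proj (rho_continuous_subspace \<rho> D H) \<psi> = coord p"
    unfolding orth_proj_def M
  proof (rule the_equality)
    show "coord p \<in> coord ` M \<and> (\<forall>h\<in>coord ` M. ell2_inner h (\<lambda>x. \<psi> x - coord p x) = 0)"
      using p by (auto simp: cinner_def coord_simps \<psi>)
    fix p' assume p': "p' \<in> coord ` M \<and> (\<forall>h\<in>coord ` M. ell2_inner h (\<lambda>x. \<psi> x - p' x) = 0)"
    then obtain u where u: "u \<in> M" "p' = coord u" by blast
    have "cinner h (g - u) = 0" if "h \<in> M" for h
      using p' that by (auto simp: cinner_def coord_simps \<psi> u(2))
    then have "cinner (p - u) (g - u) = 0" "cinner (p - u) (g - p) = 0"
      using csubspaceD(4)[OF subM p(1) u(1)] p(2) by auto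
    then have "cinner (p - u) (p - u) = 0" by (simp add: cinner_simps)
    then show "p' = coord p" by (simp add: cinner_self u(2))
  qed
  then have "p \<noteq> 0" using assms(5) by (auto simp: coord_simps)
  moreover have rp: "rho_continuous \<rho> (\<mu> p)" using p(1) by (simp add: M_def)
  ultimately obtain A K where A: "A \<in> sets borel" "K > 0" "op (indicator A) p \<noteq> 0"
      "\<And>a b. a < b \<Longrightarrow> b - a \<le> 1 \<Longrightarrow> measure (\<mu> (op (indicator A) p)) {a<..<b} \<le> K * \<rho> (b - a)"
    using uniformly_continuous_part[OF assms(2)] by metis
  define f where "f = op (indicator A) p"
  \<comment> \<open>Membership in \<open>M\<close> makes \<open>f\<close> orthogonal to
    \<open>g - p\<close>, so \<open>cinner f g = cinner f p\<close>; symmetry and idempotence of the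
    spectral projection turn this into \<open>(norm f)^2\<close>.\<close>
  have "f \<in> M"
    unfolding M_def mem_Collect_eq rho_continuous_def null_sets_completion_iff_op
  proof (intro allI impI)
    fix S assume "hausdorff_measure \<rho> S = 0"
    then obtain N where N: "N \<in> sets borel" "S \<subseteq> N" "op (indicator N) p = 0"
      using rp unfolding rho_continuous_def null_sets_completion_iff_op by blast
    have "op (indicator N) f = op (indicator (A \<inter> N)) p"
      unfolding f_def using op_indicator_Int[OF N(1) A(1), of p] by (simp add: Int_commute)
    then have "op (indicator N) f = 0" using op_indicator_Int_eq_0[OF A(1) N(1,3)] by simp
    then show "\<exists>N\<in>sets borel. S \<subseteq> N \<and> op (indicator N) f = 0" using N by blast
  qed
  then have "cinner f g = cinner f p" using p(2)[of f] by (simp add: cinner_diff_right)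
  also have "\<dots> = cinner p f"
  proof -
    have "cnj (indicator A x) = (indicator A x :: complex)" for x by (simp add: indicator_def)
    then show ?thesis using op_adjoint[OF bounded_borel_indicator[OF A(1)], of p p] by (simp add: f_def)
  qed
  also have "\<dots> = of_real ((norm f)\<^sup>2)"
  proof -
    have "cnj (indicator A x) = (indicator A x :: complex)" for x by (simp add: indicator_def)
    then have "cinner f f = cinner p (op (indicator A) f)"
      using op_adjoint[OF bounded_borel_indicator[OF A(1)], of p f] by (simp add: f_def)
    also have "op (indicator A) f = f" using op_indicator_Int[OF A(1) A(1), of p] by (simp add: f_def)
    finally show ?thesis by (simp add: cinner_self)
  qed
  finally have fg: "cinner f g = of_real ((norm f)\<^sup>2)" .
  \<comment> \<open>\<open>evolution\<close> is given coordinatewise by polarization with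
    \<open>delta n\<close>, which is the form \<open>I\<close> evaluated at a basis vector.\<close>
  have evo: "evolution D H \<psi> t = coord (op (wave t) g)" for t
  proof
    fix n
    have "coord (g + \<i> ^ k *\<^sub>C basis_vec n) = (\<lambda>j. \<psi> j + \<i> ^ k * delta n j)" for k :: nat
      by (simp add: coord_simps coord_basis_vec \<psi>)
    then have "evolution D H \<psi> t n = I (wave t) (basis_vec n) g"
      unfolding evolution_def functional_calculus_def spectral_integral_def polar_integral_def \<mu>_def wave_def[abs_def] by simp
    then show "evolution D H \<psi> t n = coord (op (wave t) g) n" by (simp add: I_basis_vec bounded_borel_wave)
  qed
  show ?thesis
    unfolding evo
    by (rule position_moment_average_gt[OF sf assms(2,6) _ fg g A(2)]) (use A(3,4) in \<open>simp_all add: f_def\<close>)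
qed

end
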